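(* Let $K\subset\mathbb R$ denote a self-similar set for the iterated function system $\Phi$ acting on $X$ which satisfies the open set condition with feasible open set $\operatorname{int}X$. Let $\delta$ denote its Minkowski dimension, let $\mathcal U\supset X$ be a connected open neighbourhood of $X$ in $\mathbb R$ and let $g\colon\mathcal U\to\mathbb R$ be a $\mathcal C^{1+\alpha}(\mathcal U)$ map, $\alpha>0$, for which $|g'|$ is bounded away from $0$. Assume that $\lambda^1(K)=0$ and set $F:=g(K)$. Let $\nu$ denote the $\delta$-conformal measure associated with $K$. Then we have the following. (i) The average Minkowski contents of both $K$ and $F$ exist and satisfy $$\widetilde{\mathcal M}(F)=\widetilde{\mathcal M}(K)\cdot\int|g'|^\delta\,d\nu.$$ (ii) If $\Phi$ is nonlattice, then the Minkowski contents of both $K$ and $F$ exist and satisfy $$\mathcal M(F)=\mathcal M(K)\cdot\int|g'|^\delta\,d\nu.$$ (iii) If $\Phi$ is lattice, then the Minkowski content of $K$ does not exist, whereas the Minkowski content of $F$ might or might not exist (depending on $g$). More precisely, assume that $K\subseteq[0,1]$ and that the geometric potential function $\xi$ associated with $\Phi$ is lattice. Let $a>0$ be maximal such that the range of $\xi$ is contained in $a\mathbb Z$. Define $\tilde g\colon\mathbb R\to\mathbb R$, $\tilde g(x):=\nu((-\infty,x])$, to be the distribution function of $\nu$. For $n\in\mathbb N$ define $g_n\colon[-1,\infty)\to\mathbb R$ by $$g_n(x):=\int_{-1}^x\big(\tilde g(r)(e^{\delta an}-1)+1\big)^{-1/\delta}\,dr$$ and set $F_n:=g_n(K)$. Then for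 every $n\in\mathbb N$ we have $\underline{\mathcal M}(F_n)=\overline{\mathcal M}(F_n)$.
   Context: **Iterated function systems.** $X\subset\mathbb R$ is a nonempty compact interval, $\Phi=\{R_1,\dots,R_N\}$, $N\ge2$, consists of similarities $R_i\colon X\to X$ with similarity ratios $r_i=|R_i'|\in(0,1)$, and $K$ is the unique nonempty compact set with $K=\bigcup_iR_i(K)$. $\Phi$ satisfies the open set condition with feasible open set $O$ if $O\subset\mathbb R$ is nonempty, open and bounded, $\bigcup_iR_i(O)\subseteq O$ and $R_i(O)\cap R_j(O)=\emptyset$ for $i\ne j$. $\mathcal C^{1+\alpha}$ is the class of real valued differentiable functions whose derivative is ($\alpha$-)Hölder continuous. **Conformal measure.** $\nu$ is the unique probability measure supported on $K$ with $\nu(R_iX\cap R_jX)=0$ for $i\ne j$ and $\nu(R_iB)=\int_B|R_i'|^\delta\,d\nu$ for all $i$ and all Borel $B\subseteq X$. **Lattice property.** Let $\Sigma^\infty$ be the set of infinite words over $\{1,\dots,N\}$ with the topology of pointwise convergence, with left shift $\sigma$. The geometric potential function is $\xi(\omega)=-\ln r_{\omega_1}$. $\Phi$ (equivalently $\xi$) is lattice if there are continuous $\zeta,\psi\colon\Sigma^\infty\to\mathbb R$ with $\xi-\zeta=\psi-\psi\circ\sigma$ and the range of $\zeta$ contained in a discrete subgroup of $\mathbb R$; otherwise nonlattice. (For a lattice self-similar system the range of $\xi$ itself is contained in a discrete subgroup of $\mathbb R$.) **Minkowski content.** $\lambda^1$ is Lebesgue measure and $Y_\varepsilon=\{x\in\mathbb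 R:\inf_{y\in Y}|x-y|\le\varepsilon\}$. The Minkowski dimension of $Y$ is $1-\lim_{\varepsilon\searrow0}\ln\lambda^1(Y_\varepsilon)/\ln\varepsilon$ if the limit exists; here $K$, $F$ and $F_n$ all have Minkowski dimension $\delta$. For such $Y$, $\overline{\mathcal M}(Y)$ and $\underline{\mathcal M}(Y)$ are the $\limsup$ and $\liminf$ of $\varepsilon^{\delta-1}\lambda^1(Y_\varepsilon)$ as $\varepsilon\to0$; if they coincide, the common value $\mathcal M(Y)$ is the Minkowski content (said to exist in this case). The average Minkowski content is $\widetilde{\mathcal M}(Y)=\lim_{T\searrow0}|\ln T|^{-1}\int_T^1\varepsilon^{\delta-2}\lambda^1(Y_\varepsilon)\,d\varepsilon$ if this limit exists. *)

theory Defs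
  imports "HOL-Probability.Probability"
begin

text \<open>
  The maps \<open>R i\<close> are total functions on the reals of which only the values on \<open>X\<close> matter.
  \<open>X\<close> is not required to be nondegenerate here; this follows once \<open>interior X\<close> is
  feasible for the open set condition.
\<close>

definition self_similar_IFS ::
    "real set \<Rightarrow> nat \<Rightarrow> (nat \<Rightarrow> real \<Rightarrow> real) \<Rightarrow> (nat \<Rightarrow> real) \<Rightarrow> bool" where
  "self_similar_IFS X N R r \<longleftrightarrow>
     X \<noteq> {} \<and> compact X \<and> is_interval X \<and> 2 \<le> N \<and>
     (\<forall>i\<in>{1..N}. 0 < r i \<and> r i < 1 \<and> R i ` X \<subseteq> X \<and>
        (\<forall>x\<in>X. \<forall>y\<in>X. \<bar>R i x - R i y\<bar> = r i * \<bar>x - y\<bar>))"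

text \<open>\<open>K \<subseteq> X\<close> is part of the notion because the maps act on \<open>X\<close> only.\<close>

definition self_similar_set ::
    "real set \<Rightarrow> nat \<Rightarrow> (nat \<Rightarrow> real \<Rightarrow> real) \<Rightarrow> real set \<Rightarrow> bool" where
  "self_similar_set X N R K \<longleftrightarrow>
     K \<noteq> {} \<and> compact K \<and> K \<subseteq> X \<and> K = (\<Union>i\<in>{1..N}. R i ` K)"

definition open_set_condition :: "nat \<Rightarrow> (nat \<Rightarrow> real \<Rightarrow> real) \<Rightarrow> real set \<Rightarrow> bool" where
  "open_set_condition N R V \<longleftrightarrow>
     V \<noteq> {} \<and> open V \<and> bounded V \<and> (\<Union>i\<in>{1..N}. R i ` V) \<subseteq> V \<and>
     (\<forall>i\<in>{1..N}. \<forall>j\<in>{1..N}. i \<noteq> j \<longrightarrow> R i ` V \<inter> R j ` V = {})"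

text \<open>The derivative of \<open>R i\<close> is taken within \<open>X\<close>, i.e. one-sided at the end points of \<open>X\<close>.\<close>

definition conformal_measure ::
    "real set \<Rightarrow> nat \<Rightarrow> (nat \<Rightarrow> real \<Rightarrow> real) \<Rightarrow> real set \<Rightarrow> real \<Rightarrow> real measure \<Rightarrow> bool" where
  "conformal_measure X N R K \<delta> \<nu> \<longleftrightarrow>
     prob_space \<nu> \<and> sets \<nu> = sets borel \<and> measure \<nu> (- K) = 0 \<and>
     (\<forall>i\<in>{1..N}. \<forall>j\<in>{1..N}. i \<noteq> j \<longrightarrow> measure \<nu> (R i ` X \<inter> R j ` X) = 0) \<and>
     (\<forall>i\<in>{1..N}. \<forall>B\<in>sets borel. B \<subseteq> X \<longrightarrow>
        measure \<nu> (R i ` B) =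
          (LINT x:B|\<nu>. \<bar>vector_derivative (R i) (at x within X)\<bar> powr \<delta>))"

text \<open>
  Infinite words are functions on \<open>nat\<close>, so the first letter is \<open>\<omega> 0\<close>. The type class topology
  on \<open>nat \<Rightarrow> nat\<close> is the product of the discrete topologies; hence \<open>continuous_on (words N)\<close>
  refers to the topology of pointwise convergence.
\<close>

definition words :: "nat \<Rightarrow> (nat \<Rightarrow> nat) set" where
  "words N = {\<omega>. \<forall>k. \<omega> k \<in> {1..N}}"

definition left_shift :: "(nat \<Rightarrow> nat) \<Rightarrow> nat \<Rightarrow> nat" where
  "left_shift \<omega> = (\<lambda>k. \<omega> (Suc k))"

definition geometric_potential :: "(nat \<Rightarrow> real) \<Rightarrow> (nat \<Rightarrow> nat) \<Rightarrow> real" where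
  "geometric_potential r \<omega> = - ln (r (\<omega> 0))"

definition discrete_subgroup :: "real set \<Rightarrow> bool" where
  "discrete_subgroup G \<longleftrightarrow>
     0 \<in> G \<and> (\<forall>x\<in>G. \<forall>y\<in>G. x + y \<in> G) \<and> (\<forall>x\<in>G. - x \<in> G) \<and> (\<forall>x\<in>G. x isolated_in G)"

definition lattice_IFS :: "nat \<Rightarrow> (nat \<Rightarrow> real) \<Rightarrow> bool" where
  "lattice_IFS N r \<longleftrightarrow>
     (\<exists>\<zeta> \<psi> :: (nat \<Rightarrow> nat) \<Rightarrow> real. \<exists>G.
        continuous_on (words N) \<zeta> \<and> continuous_on (words N) \<psi> \<and>
        (\<forall>\<omega>\<in>words N. geometric_potential r \<omega> - \<zeta> \<omega> = \<psi> \<omega> - \<psi> (left_shift \<omega>)) \<and>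
        discrete_subgroup G \<and> \<zeta> ` words N \<subseteq> G)"

definition potential_range_in :: "nat \<Rightarrow> (nat \<Rightarrow> real) \<Rightarrow> real \<Rightarrow> bool" where
  "potential_range_in N r a \<longleftrightarrow>
     geometric_potential r ` words N \<subseteq> range (\<lambda>k::int. a * of_int k)"

definition maximal_lattice_const :: "nat \<Rightarrow> (nat \<Rightarrow> real) \<Rightarrow> real \<Rightarrow> bool" where
  "maximal_lattice_const N r a \<longleftrightarrow>
     0 < a \<and> potential_range_in N r a \<and> (\<forall>b>0. potential_range_in N r b \<longrightarrow> b \<le> a)"

definition parallel_set :: "real set \<Rightarrow> real \<Rightarrow> real set" where
  "parallel_set Y \<epsilon> = {x. infdist x Y \<le> \<epsilon>}"

definition has_minkowski_dimension :: "real set \<Rightarrow> real \<Rightarrow> bool" where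
  "has_minkowski_dimension Y d \<longleftrightarrow>
     (\<exists>L. ((\<lambda>\<epsilon>. ln (measure lborel (parallel_set Y \<epsilon>)) / ln \<epsilon>) \<longlongrightarrow> L) (at_right 0) \<and>
          d = 1 - L)"

text \<open>
  The contents below are relative to a prescribed dimension \<open>\<delta>\<close>. Lower and upper content are
  taken in the extended reals, since a limit inferior or superior may be infinite.
\<close>

definition upper_minkowski_content :: "real \<Rightarrow> real set \<Rightarrow> ereal" where
  "upper_minkowski_content \<delta> Y =
     Limsup (at_right 0) (\<lambda>\<epsilon>. ereal (\<epsilon> powr (\<delta> - 1) * measure lborel (parallel_set Y \<epsilon>)))"

definition lower_minkowski_content :: "real \<Rightarrow> real set \<Rightarrow> ereal" where
  "lower_minkowski_content \<delta> Y =
     Liminf (at_right 0) (\<lambda>\<epsilon>. ereal (\<epsilon> powr (\<delta> - 1) * measure lborel (parallel_set Y \<epsilon>)))"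

definition has_minkowski_content :: "real \<Rightarrow> real set \<Rightarrow> ereal \<Rightarrow> bool" where
  "has_minkowski_content \<delta> Y M \<longleftrightarrow>
     lower_minkowski_content \<delta> Y = M \<and> upper_minkowski_content \<delta> Y = M"

definition has_average_minkowski_content :: "real \<Rightarrow> real set \<Rightarrow> real \<Rightarrow> bool" where
  "has_average_minkowski_content \<delta> Y M \<longleftrightarrow>
     ((\<lambda>T. inverse \<bar>ln T\<bar> *
        integral {T..1} (\<lambda>\<epsilon>. \<epsilon> powr (\<delta> - 2) * measure lborel (parallel_set Y \<epsilon>)))
      \<longlongrightarrow> M) (at_right 0)"

definition C1_Hoelder_on :: "real \<Rightarrow> real set \<Rightarrow> (real \<Rightarrow> real) \<Rightarrow> bool" where
  "C1_Hoelder_on \<alpha> U g \<longleftrightarrow>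
     (\<forall>x\<in>U. g field_differentiable (at x)) \<and>
     (\<exists>C. \<forall>x\<in>U. \<forall>y\<in>U. \<bar>deriv g x - deriv g y\<bar> \<le> C * \<bar>x - y\<bar> powr \<alpha>)"

definition admissible_map :: "real set \<Rightarrow> real \<Rightarrow> real set \<Rightarrow> (real \<Rightarrow> real) \<Rightarrow> bool" where
  "admissible_map X \<alpha> U g \<longleftrightarrow>
     0 < \<alpha> \<and> open U \<and> connected U \<and> X \<subseteq> U \<and> C1_Hoelder_on \<alpha> U g \<and>
     (\<exists>c>0. \<forall>x\<in>U. c \<le> \<bar>deriv g x\<bar>)"

text \<open>
  The integral of \<open>\<bar>g'\<bar>\<^sup>\<delta>\<close> against \<open>\<nu>\<close>. It is written as an integral over \<open>K\<close>, which carries all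
  the mass of \<open>\<nu>\<close>, because \<open>deriv g\<close> is unconstrained (possibly not even measurable)
  outside of the domain \<open>U\<close> of \<open>g\<close>.
\<close>

definition derivative_moment :: "real measure \<Rightarrow> real set \<Rightarrow> real \<Rightarrow> (real \<Rightarrow> real) \<Rightarrow> real" where
  "derivative_moment \<nu> K \<delta> g = (LINT x:K|\<nu>. \<bar>deriv g x\<bar> powr \<delta>)"

text \<open>Only the values for \<open>x \<ge> -1\<close> are meaningful; \<open>cdf \<nu>\<close> is the distribution function of \<open>\<nu>\<close>.\<close>

definition lattice_map :: "real measure \<Rightarrow> real \<Rightarrow> real \<Rightarrow> nat \<Rightarrow> real \<Rightarrow> real" where
  "lattice_map \<nu> \<delta> a n x =
     integral {-1..x} (\<lambda>t. (cdf \<nu> t * (exp (\<delta> * a * real n) - 1) + 1) powr (- 1 / \<delta>))"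

end

theory Submission
  imports Defs
begin

text \<open>
  Write \<open>V \<epsilon>\<close> for the volume of the closed \<open>\<epsilon>\<close>-neighbourhood of \<open>K\<close>. On the line, the volumes of two
  compact sets lying next to each other with gap \<open>d\<close> add up to within \<open>2 \<epsilon> - min (2 \<epsilon>) d\<close>. Hence
  \<open>Z t = exp ((1 - \<delta>) t) V (exp (- t))\<close> satisfies a renewal inequality with weights \<open>r i powr \<delta>\<close> and
  steps \<open>- ln (r i)\<close>, up to an exponentially small defect. The associated functional \<open>D\<close>, a weighted sum
  of integrals of \<open>Z\<close> over windows of the lengths of the steps, is monotone, hence converges; this gives
  the Cesaro limit of \<open>Z\<close>. Moreover, a sequence realising the limit superior of \<open>Z\<close> still does so
  after translation by elements of the semigroup generated by the steps. In the nonlattice case this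
  semigroup is asymptotically dense, so that \<open>D\<close> determines the limit superior, and likewise the limit
  inferior. In the lattice case the same argument works along cosets of the lattice, and \<open>Z\<close> is
  asymptotically periodic; the limit is not constant since \<open>V\<close> is affine on suitable small intervals at
  all scales.

  A monotone map with slopes in \<open>[c, C]\<close> distorts \<open>V \<epsilon>\<close> at most to \<open>c V (\<epsilon> / c)\<close> and \<open>C V (\<epsilon> / C)\<close>;
  applied to the pieces of \<open>K\<close> of a high level this transfers the limits to \<open>g ` K\<close>, with the
  integral of \<open>\<bar>g'\<bar> powr \<delta>\<close> as a factor. For the maps built from the distribution function of \<open>\<nu>\<close>, the
  limit along every coset is a constant multiple of the integral of the periodic limit over whole periods.
\<close>

section \<open>Neighbourhoods of compact sets on the line\<close>

text \<open>Two choices shape the argument. First, \<open>X\<close> is replaced by the hull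
  \<open>{A..B}\<close> of \<open>K\<close>. The images of its interior stay disjoint, and every
  piece of \<open>K\<close> contains the end points of its interval, so that volumes of neighbouring
  pieces combine by an exact formula in which only the gap occurs. Second, the renewal theorem asks
  no continuity of \<open>Z\<close>. Monotonicity of the volume becomes
  \<open>Z t \<le> exp (\<kappa> * (t - s)) * Z s\<close> for \<open>s \<le> t\<close>, with
  \<open>\<kappa> = 1 - \<delta>\<close>; a lower bound thus passes to slightly earlier times and an
  upper bound to slightly later ones, which leads from finitely many times to whole windows.

  The renewal inequality bounds \<open>V\<close> from above. The smaller quantity
  \<open>V \<epsilon> - 2 * \<epsilon>\<close>, the volume between the extreme points, satisfies the
  opposite inequality. It yields the positive lower bound for \<open>Z\<close> and, together with
  the null measure of \<open>K\<close>, also \<open>\<delta> < 1\<close>. The conformal measure ties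
  the exponent to the ratios: the masses of the first-level pieces sum to 1.\<close>

definition tube :: "real set \<Rightarrow> real \<Rightarrow> real" where
  "tube Y \<epsilon> = measure lborel (parallel_set Y \<epsilon>)"

lemma parallel_set_compact:
  assumes "compact Y" "Y \<noteq> {}"
  shows "parallel_set Y \<epsilon> = {x. \<exists>y\<in>Y. \<bar>x - y\<bar> \<le> \<epsilon>}"
proof -
  have "infdist x Y \<le> \<epsilon> \<longleftrightarrow> (\<exists>y\<in>Y. \<bar>x - y\<bar> \<le> \<epsilon>)" for x
  proof
    assume "infdist x Y \<le> \<epsilon>"
    moreover obtain y where "y \<in> Y" "infdist x Y = dist x y"
      using infdist_attains_inf[of Y x] assms compact_imp_closed by blast
    ultimately show "\<exists>y\<in>Y. \<bar>x - y\<bar> \<le> \<epsilon>" by (auto simp: dist_real_def)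
  next
    assume "\<exists>y\<in>Y. \<bar>x - y\<bar> \<le> \<epsilon>"
    then show "infdist x Y \<le> \<epsilon>"
      using infdist_le2[of _ Y x \<epsilon>] by (auto simp: dist_real_def)
  qed
  then show ?thesis by (auto simp: parallel_set_def)
qed

lemma compact_parallel_set:
  assumes "compact Y" "Y \<noteq> {}"
  shows "compact (parallel_set Y \<epsilon>)"
proof -
  have "closed (parallel_set Y \<epsilon>)"
    unfolding parallel_set_def by (intro closed_Collect_le continuous_intros)
  moreover obtain b where b: "\<And>y. y \<in> Y \<Longrightarrow> \<bar>y\<bar> \<le> b"
    using compact_imp_bounded[OF assms(1)] unfolding bounded_iff by auto
  have "bounded (parallel_set Y \<epsilon>)"
    unfolding bounded_iff parallel_set_compact[OF assms]
    by (rule exI[of _ "b + \<epsilon>"]) (use b in force)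
  ultimately show ?thesis by (simp add: compact_eq_bounded_closed)
qed

lemma parallel_set_fmeasurable:
  assumes "compact Y" "Y \<noteq> {}"
  shows "parallel_set Y \<epsilon> \<in> fmeasurable lborel"
  using compact_parallel_set[OF assms] by (simp add: fmeasurable_compact)

lemma tube_nonneg: "0 \<le> tube Y \<epsilon>"
  by (simp add: tube_def)

lemma tube_mono:
  assumes "compact Y" "Y \<noteq> {}" "\<epsilon> \<le> \<epsilon>'"
  shows "tube Y \<epsilon> \<le> tube Y \<epsilon>'"
proof -
  have "parallel_set Y \<epsilon> \<subseteq> parallel_set Y \<epsilon>'" using assms(3) by (auto simp: parallel_set_def)
  then show ?thesis
    unfolding tube_def using parallel_set_fmeasurable[OF assms(1,2)] fmeasurableD
    by (intro measure_mono_fmeasurable) blast+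
qed

lemma tube_singleton: "0 \<le> \<epsilon> \<Longrightarrow> tube {y} \<epsilon> = 2 * \<epsilon>"
proof -
  assume "0 \<le> \<epsilon>"
  moreover have "parallel_set {y} \<epsilon> = {y - \<epsilon>..y + \<epsilon>}"
    by (subst parallel_set_compact) auto
  ultimately show ?thesis by (simp add: tube_def)
qed

text \<open>A point within \<open>\<epsilon>\<close> of both sets is at most
  \<open>m + \<epsilon>\<close> and at least \<open>n - \<epsilon>\<close>, so the neighbourhoods
  overlap exactly in the interval between these bounds. Its length is
  \<open>2 * \<epsilon> - (n - m)\<close> as long as this is nonnegative, and otherwise it is empty;
  hence the minimum.\<close>

lemma tube_Un_ordered:
  assumes Y: "compact Y" "m \<in> Y" "\<And>y. y \<in> Y \<Longrightarrow> y \<le> m"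
    and Z: "compact Z" "n \<in> Z" "\<And>z. z \<in> Z \<Longrightarrow> n \<le> z"
    and "m \<le> n" "0 \<le> \<epsilon>"
  shows "tube (Y \<union> Z) \<epsilon> = tube Y \<epsilon> + tube Z \<epsilon> - 2 * \<epsilon> + min (2 * \<epsilon>) (n - m)"
proof -
  have ne: "Y \<noteq> {}" "Z \<noteq> {}" using Y Z by auto
  have un: "parallel_set (Y \<union> Z) \<epsilon> = parallel_set Y \<epsilon> \<union> parallel_set Z \<epsilon>"
    using Y(1) Z(1) ne by (auto simp: parallel_set_compact compact_Un)
  have int: "parallel_set Y \<epsilon> \<inter> parallel_set Z \<epsilon> = {n - \<epsilon>..m + \<epsilon>}" (is "?L = ?R")
  proof
    show "?L \<subseteq> ?R" using Y Z ne by (force simp: parallel_set_compact abs_le_iff)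
    show "?R \<subseteq> ?L"
    proof
      fix x assume "x \<in> ?R"
      then have "\<bar>x - m\<bar> \<le> \<epsilon>" "\<bar>x - n\<bar> \<le> \<epsilon>" using assms by (auto simp: abs_le_iff)
      then show "x \<in> ?L" using Y Z ne by (auto simp: parallel_set_compact)
    qed
  qed
  have "tube (Y \<union> Z) \<epsilon> = tube Y \<epsilon> + tube Z \<epsilon> - measure lborel {n - \<epsilon>..m + \<epsilon>}"
    unfolding tube_def un int[symmetric]
    by (rule measure_Un3) (use Y Z ne parallel_set_fmeasurable in auto)
  then show ?thesis using assms by (auto simp: min_def)
qed

section \<open>Volume of neighbourhoods as a sum over gaps\<close>

text \<open>The list of neighbouring pairs is chosen before \<open>g\<close> and
  \<open>\<epsilon>\<close>. One list thus serves all monotone maps and all radii, which allows the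
  volumes of a set and of its image to be compared gap by gap.\<close>

lemma tube_finite_image:
  fixes P :: "real set"
  assumes "finite P" "P \<noteq> {}"
  shows "\<exists>ps. (\<forall>(p, q)\<in>set ps. p \<in> P \<and> q \<in> P \<and> p \<le> q) \<and>
    (\<forall>g \<epsilon>. mono_on P g \<longrightarrow> 0 \<le> \<epsilon> \<longrightarrow>
      tube (g ` P) \<epsilon> = 2 * \<epsilon> + (\<Sum>(p, q)\<leftarrow>ps. min (2 * \<epsilon>) (g q - g p)))"
  using assms
proof (induction P rule: finite_linorder_max_induct)
  case empty
  then show ?case by simp
next
  case (insert b A)
  show ?case
  proof (cases "A = {}")
    case True
    then show ?thesis by (intro exI[of _ "[]"]) (auto simp: tube_singleton)
  next
    case False
    then obtain ps where ps: "\<forall>(p, q)\<in>set ps. p \<in> A \<and> q \<in> A \<and> p \<le> q"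
      "\<And>g \<epsilon>. mono_on A g \<Longrightarrow> 0 \<le> \<epsilon> \<Longrightarrow>
        tube (g ` A) \<epsilon> = 2 * \<epsilon> + (\<Sum>(p, q)\<leftarrow>ps. min (2 * \<epsilon>) (g q - g p))"
      using insert.IH[OF False] by blast
    have mx: "Max A \<in> A" "\<And>x. x \<in> A \<Longrightarrow> x \<le> Max A" "Max A < b"
      using insert False by auto
    have "tube (g ` insert b A) \<epsilon> = 2 * \<epsilon> + (\<Sum>(p, q)\<leftarrow>(Max A, b) # ps. min (2 * \<epsilon>) (g q - g p))"
      if g: "mono_on (insert b A) g" "0 \<le> \<epsilon>" for g \<epsilon>
    proof -
      have "mono_on A g" using g(1) by (rule mono_on_subset) auto
      moreover have "tube (g ` A \<union> {g b}) \<epsilon>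
          = tube (g ` A) \<epsilon> + tube {g b} \<epsilon> - 2 * \<epsilon> + min (2 * \<epsilon>) (g b - g (Max A))"
        by (rule tube_Un_ordered)
          (use insert g mx in \<open>auto intro!: finite_imp_compact mono_onD[OF g(1)]\<close>)
      ultimately show ?thesis using ps(2) g(2) by (simp add: tube_singleton)
    qed
    then show ?thesis
      by (intro exI[of _ "(Max A, b) # ps"]) (use ps(1) mx in auto)
  qed
qed

text \<open>Each nonempty cell of a grid of mesh \<open>\<eta>\<close> contributes its least and its
  greatest point of \<open>Y\<close>. Two points per cell enclose every \<open>y\<close> from both
  sides; this makes the net reproduce the neighbourhood of \<open>Y\<close> exactly rather than
  approximately.\<close>

lemma finite_ordered_net:
  fixes Y :: "real set"
  assumes "compact Y" "Y \<noteq> {}" "0 < \<eta>"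
  obtains P where "finite P" "P \<noteq> {}" "P \<subseteq> Y"
    "\<And>y. y \<in> Y \<Longrightarrow> \<exists>p\<in>P. \<exists>q\<in>P. p \<le> y \<and> y \<le> q \<and> q - p \<le> \<eta>"
proof -
  define cell where "cell k = Y \<inter> {of_int k * \<eta>..(of_int k + 1) * \<eta>}" for k :: int
  define I where "I = (\<lambda>y. \<lfloor>y / \<eta>\<rfloor>) ` Y"
  have in_cell: "y \<in> cell \<lfloor>y / \<eta>\<rfloor>" if "y \<in> Y" for y
  proof -
    have "of_int \<lfloor>y / \<eta>\<rfloor> \<le> y / \<eta>" "y / \<eta> \<le> of_int \<lfloor>y / \<eta>\<rfloor> + 1" by linarith+
    then have "of_int \<lfloor>y / \<eta>\<rfloor> * \<eta> \<le> y" "y \<le> (of_int \<lfloor>y / \<eta>\<rfloor> + 1) * \<eta>"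
      using assms(3) by (simp_all only: pos_le_divide_eq pos_divide_le_eq)
    then show ?thesis using that by (simp add: cell_def)
  qed
  obtain b where b: "\<And>y. y \<in> Y \<Longrightarrow> \<bar>y\<bar> \<le> b"
    using compact_imp_bounded[OF assms(1)] unfolding bounded_iff by auto
  have "I \<subseteq> {\<lfloor>- b / \<eta>\<rfloor>..\<lfloor>b / \<eta>\<rfloor>}"
  proof
    fix k assume "k \<in> I"
    then obtain y where "y \<in> Y" "k = \<lfloor>y / \<eta>\<rfloor>" by (auto simp: I_def)
    moreover from b[OF this(1)] have "- b / \<eta> \<le> y / \<eta>" "y / \<eta> \<le> b / \<eta>"
      using assms(3) by (intro divide_right_mono; simp)+
    ultimately show "k \<in> {\<lfloor>- b / \<eta>\<rfloor>..\<lfloor>b / \<eta>\<rfloor>}" by (auto intro: floor_mono)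
  qed
  then have "finite I" by (rule finite_subset) simp
  have cpt: "compact (cell k)" for k
    unfolding cell_def using assms by (intro compact_Int) auto
  have ex: "\<exists>p\<in>cell k. \<forall>y\<in>cell k. p \<le> y" "\<exists>p\<in>cell k. \<forall>y\<in>cell k. y \<le> p" if "k \<in> I" for k
    using compact_attains_inf[OF cpt] compact_attains_sup[OF cpt] in_cell that
    unfolding I_def by blast+
  obtain lo hi where lohi: "\<And>k. k \<in> I \<Longrightarrow> lo k \<in> cell k \<and> (\<forall>y\<in>cell k. lo k \<le> y)"
    "\<And>k. k \<in> I \<Longrightarrow> hi k \<in> cell k \<and> (\<forall>y\<in>cell k. y \<le> hi k)"
    using ex by metis
  show ?thesis
  proof
    show "finite (lo ` I \<union> hi ` I)" using \<open>finite I\<close> by simp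
    show "lo ` I \<union> hi ` I \<noteq> {}" using assms by (auto simp: I_def)
    show "lo ` I \<union> hi ` I \<subseteq> Y" using lohi by (auto simp: cell_def)
    fix y assume y: "y \<in> Y"
    define k where "k = \<lfloor>y / \<eta>\<rfloor>"
    have k: "k \<in> I" "y \<in> cell k" using y in_cell by (auto simp: k_def I_def)
    have "hi k - lo k \<le> \<eta>"
      using lohi[OF k(1)] by (auto simp: cell_def algebra_simps)
    then show "\<exists>p\<in>lo ` I \<union> hi ` I. \<exists>q\<in>lo ` I \<union> hi ` I. p \<le> y \<and> y \<le> q \<and> q - p \<le> \<eta>"
      using lohi k by blast
  qed
qed

text \<open>If \<open>p \<le> y \<le> q\<close> and \<open>q - p \<le> 2 * \<epsilon>\<close>, the
  balls of radius \<open>\<epsilon>\<close> around \<open>p\<close> and \<open>q\<close> together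
  cover the one around \<open>y\<close>. So a finite subset has the same neighbourhood, with no
  error term.\<close>

lemma tube_eq_tube_net:
  assumes "compact Y" "P \<noteq> {}" "finite P" "P \<subseteq> Y" 
    and net: "\<And>y. y \<in> Y \<Longrightarrow> \<exists>p\<in>P. \<exists>q\<in>P. p \<le> y \<and> y \<le> q \<and> q - p \<le> 2 * \<epsilon>"
  shows "tube Y \<epsilon> = tube P \<epsilon>"
proof -
  have "\<exists>p\<in>P. \<bar>x - p\<bar> \<le> \<epsilon>" if xy: "y \<in> Y" "\<bar>x - y\<bar> \<le> \<epsilon>" for x y
  proof -
    obtain p q where "p \<in> P" "q \<in> P" "p \<le> y" "y \<le> q" "q - p \<le> 2 * \<epsilon>" using net xy by blast
    moreover from this xy have "\<bar>x - p\<bar> \<le> \<epsilon> \<or> \<bar>x - q\<bar> \<le> \<epsilon>" by linarith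
    ultimately show ?thesis by blast
  qed
  then have "parallel_set Y \<epsilon> = parallel_set P \<epsilon>"
    using assms by (subst (1 2) parallel_set_compact) (auto intro: finite_imp_compact)
  then show ?thesis by (simp add: tube_def)
qed

text \<open>A net of mesh \<open>\<eta>\<close> is stretched by \<open>g\<close> to mesh at most
  \<open>C * \<eta>\<close>; the condition \<open>C * \<eta> \<le> 2 * \<epsilon>\<close> makes it
  fine enough for the radius \<open>\<epsilon>\<close>. Gaps inside a cell are already filled at
  this scale.\<close>

lemma tube_image_gaps:
  assumes "compact Y" "Y \<noteq> {}" "0 < \<eta>"
  obtains ps where "\<forall>(p, q)\<in>set ps. p \<in> Y \<and> q \<in> Y \<and> p \<le> q"
    "\<And>g C \<epsilon>. mono_on Y g \<Longrightarrow> continuous_on Y g \<Longrightarrow>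
      (\<And>x y. x \<in> Y \<Longrightarrow> y \<in> Y \<Longrightarrow> x \<le> y \<Longrightarrow> g y - g x \<le> C * (y - x)) \<Longrightarrow>
      0 \<le> C \<Longrightarrow> C * \<eta> \<le> 2 * \<epsilon> \<Longrightarrow>
      tube (g ` Y) \<epsilon> = 2 * \<epsilon> + (\<Sum>(p, q)\<leftarrow>ps. min (2 * \<epsilon>) (g q - g p))"
proof -
  obtain P where P: "finite P" "P \<noteq> {}" "P \<subseteq> Y"
    "\<And>y. y \<in> Y \<Longrightarrow> \<exists>p\<in>P. \<exists>q\<in>P. p \<le> y \<and> y \<le> q \<and> q - p \<le> \<eta>"
    using finite_ordered_net[OF assms] by blast
  obtain ps where ps: "\<forall>(p, q)\<in>set ps. p \<in> P \<and> q \<in> P \<and> p \<le> q"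
    "\<And>g \<epsilon>. mono_on P g \<Longrightarrow> 0 \<le> \<epsilon> \<Longrightarrow>
      tube (g ` P) \<epsilon> = 2 * \<epsilon> + (\<Sum>(p, q)\<leftarrow>ps. min (2 * \<epsilon>) (g q - g p))"
    using tube_finite_image[OF P(1,2)] by blast
  show ?thesis
  proof (rule that)
    show "\<forall>(p, q)\<in>set ps. p \<in> Y \<and> q \<in> Y \<and> p \<le> q" using ps(1) P(3) by blast
    fix g C \<epsilon>
    assume g: "mono_on Y g" "continuous_on Y g"
      "\<And>x y. x \<in> Y \<Longrightarrow> y \<in> Y \<Longrightarrow> x \<le> y \<Longrightarrow> g y - g x \<le> C * (y - x)"
      and C: "0 \<le> (C::real)" "C * \<eta> \<le> 2 * \<epsilon>"
    have "0 \<le> C * \<eta>" using C assms by simp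
    then have "0 \<le> \<epsilon>" using C by linarith
    have "tube (g ` Y) \<epsilon> = tube (g ` P) \<epsilon>"
    proof (rule tube_eq_tube_net)
      fix z assume "z \<in> g ` Y"
      then obtain y where y: "y \<in> Y" "z = g y" by blast
      obtain p q where pq: "p \<in> P" "q \<in> P" "p \<le> y" "y \<le> q" "q - p \<le> \<eta>" using P(4) y by blast
      have "g q - g p \<le> C * (q - p)"
        by (rule g(3)) (use pq P(3) in auto)
      also have "\<dots> \<le> C * \<eta>" using pq C by (simp add: mult_left_mono)
      finally have "g q - g p \<le> 2 * \<epsilon>" using C by simp
      moreover have "g p \<le> g y" "g y \<le> g q" using g(1) pq P(3) y by (auto intro: mono_onD)
      ultimately show "\<exists>p\<in>g ` P. \<exists>q\<in>g ` P. p \<le> z \<and> z \<le> q \<and> q - p \<le> 2 * \<epsilon>"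
        using y pq by blast
    qed (use P assms g in \<open>auto intro: compact_continuous_image\<close>)
    also have "\<dots> = 2 * \<epsilon> + (\<Sum>(p, q)\<leftarrow>ps. min (2 * \<epsilon>) (g q - g p))"
      using g(1) P(3) \<open>0 \<le> \<epsilon>\<close> by (intro ps(2)) (auto intro: mono_on_subset)
    finally show "tube (g ` Y) \<epsilon> = 2 * \<epsilon> + (\<Sum>(p, q)\<leftarrow>ps. min (2 * \<epsilon>) (g q - g p))" .
  qed
qed

text \<open>Above any fixed scale the volume is a concave, piecewise affine function of the radius
  with finitely many kinks. Monotonicity, continuity and the behaviour for large radii are read off
  this form.\<close>

lemma tube_gaps:
  assumes "compact Y" "Y \<noteq> {}" "0 < \<eta>"
  obtains ds where "\<forall>d\<in>set ds. 0 \<le> d"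
    "\<And>\<epsilon>. \<eta> \<le> \<epsilon> \<Longrightarrow> tube Y \<epsilon> = 2 * \<epsilon> + (\<Sum>d\<leftarrow>ds. min (2 * \<epsilon>) d)"
proof -
  obtain ps where ps: "\<forall>(p, q)\<in>set ps. p \<in> Y \<and> q \<in> Y \<and> p \<le> q"
    "\<And>g C \<epsilon>. mono_on Y g \<Longrightarrow> continuous_on Y g \<Longrightarrow>
      (\<And>x y. x \<in> Y \<Longrightarrow> y \<in> Y \<Longrightarrow> x \<le> y \<Longrightarrow> g y - g x \<le> C * (y - x)) \<Longrightarrow>
      0 \<le> C \<Longrightarrow> C * \<eta> \<le> 2 * \<epsilon> \<Longrightarrow>
      tube (g ` Y) \<epsilon> = 2 * \<epsilon> + (\<Sum>(p, q)\<leftarrow>ps. min (2 * \<epsilon>) (g q - g p))"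
    using tube_image_gaps[OF assms] by blast
  show ?thesis
  proof
    show "\<forall>d\<in>set (map (\<lambda>(p, q). q - p) ps). 0 \<le> d" using ps(1) by auto
    fix \<epsilon> assume "\<eta> \<le> \<epsilon>"
    then have "tube ((\<lambda>x. x) ` Y) \<epsilon> = 2 * \<epsilon> + (\<Sum>(p, q)\<leftarrow>ps. min (2 * \<epsilon>) (q - p))"
      by (intro ps(2)[of _ 1]) (use assms in \<open>auto intro: mono_onI\<close>)
    moreover have "(\<lambda>(p, q). min (2 * \<epsilon>) (q - p)) = min (2 * \<epsilon>) \<circ> (\<lambda>(p, q). q - p)"
      by (auto simp: fun_eq_iff)
    ultimately show "tube Y \<epsilon> = 2 * \<epsilon> + (\<Sum>d\<leftarrow>map (\<lambda>(p, q). q - p) ps. min (2 * \<epsilon>) d)"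
      by simp
  qed
qed

text \<open>\<open>tube Y \<epsilon> - 2 * \<epsilon>\<close> is the part of the volume that lies
  between the extreme points of \<open>Y\<close>; in the gap formula it is the sum of minima
  alone.\<close>

lemma tube_minus_double_mono:
  assumes "compact Y" "Y \<noteq> {}" "0 < \<epsilon>" "\<epsilon> \<le> \<epsilon>'"
  shows "tube Y \<epsilon> - 2 * \<epsilon> \<le> tube Y \<epsilon>' - 2 * \<epsilon>'"
proof -
  obtain ds where "\<forall>d\<in>set ds. 0 \<le> d"
      and ds: "\<And>x. \<epsilon> \<le> x \<Longrightarrow> tube Y x = 2 * x + (\<Sum>d\<leftarrow>ds. min (2 * x) d)"
    by (rule tube_gaps[OF assms(1-3)]) (rule that)
  have "(\<Sum>d\<leftarrow>ds. min (2 * \<epsilon>) d) \<le> (\<Sum>d\<leftarrow>ds. min (2 * \<epsilon>') d)"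
    by (rule sum_list_mono) (use assms in auto)
  then show ?thesis using ds[of \<epsilon>] ds[of \<epsilon>'] assms by simp
qed

lemma tube_eventually_affine:
  assumes "compact Y" "Y \<noteq> {}"
  obtains \<rho> c where "0 < \<rho>" "\<And>\<epsilon>. \<rho> \<le> \<epsilon> \<Longrightarrow> tube Y \<epsilon> = 2 * \<epsilon> + c"
proof -
  obtain ds where ds: "\<forall>d\<in>set ds. 0 \<le> d" "\<And>x. 1 \<le> x \<Longrightarrow> tube Y x = 2 * x + (\<Sum>d\<leftarrow>ds. min (2 * x) d)"
    using tube_gaps[OF assms, of 1] by auto
  show ?thesis
  proof
    \<comment> \<open>A radius above the sum of all gaps exceeds each of them, so every minimum
      equals its gap. The summand 1 keeps the radius in the range where the gap formula
      holds.\<close>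
    show "0 < 1 + sum_list ds" using ds(1) sum_list_nonneg[of ds] by auto
    fix \<epsilon> assume e: "1 + sum_list ds \<le> \<epsilon>"
    have "d \<le> sum_list ds" if "d \<in> set ds" for d
      by (rule member_le_sum_list) (use ds that in auto)
    moreover have "0 \<le> sum_list ds" using ds(1) sum_list_nonneg[of ds] by auto
    ultimately have "map (min (2 * \<epsilon>)) ds = ds" using e by (force intro: map_idI)
    then show "tube Y \<epsilon> = 2 * \<epsilon> + sum_list ds"
      using ds(2)[of \<epsilon>] e \<open>0 \<le> sum_list ds\<close> by simp
  qed
qed

section \<open>Distortion of neighbourhoods under maps, and unions of consecutive pieces\<close>

text \<open>By the gap formula, \<open>k * tube Y (\<epsilon> / k)\<close> is the volume obtained
  when every gap of \<open>Y\<close> is multiplied by \<open>k\<close>. The three quantities have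
  the same form and differ only in the lengths of the gaps, which the hypothesis on \<open>g\<close>
  orders.\<close>

lemma tube_bilipschitz_image:
  assumes "compact Y" "Y \<noteq> {}" "continuous_on Y g" "0 < c" "0 < \<epsilon>"
    and g: "\<And>x y. x \<in> Y \<Longrightarrow> y \<in> Y \<Longrightarrow> x \<le> y \<Longrightarrow> c * (y - x) \<le> g y - g x \<and> g y - g x \<le> C * (y - x)"
    and "c \<le> C"
  shows "c * tube Y (\<epsilon> / c) \<le> tube (g ` Y) \<epsilon>" "tube (g ` Y) \<epsilon> \<le> C * tube Y (\<epsilon> / C)"
proof -
  have "0 < C" using assms by simp
  \<comment> \<open>Since \<open>c \<le> C\<close>, this mesh is fine enough for \<open>g\<close> at
    radius \<open>\<epsilon>\<close> and for the identity at both radii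
    \<open>\<epsilon> / c\<close> and \<open>\<epsilon> / C\<close>, so one list of gaps serves all
    three.\<close>
  define \<eta> where "\<eta> = \<epsilon> / C"
  have \<eta>: "0 < \<eta>" "C * \<eta> \<le> 2 * \<epsilon>" "1 * \<eta> \<le> 2 * (\<epsilon> / C)" "1 * \<eta> \<le> 2 * (\<epsilon> / c)"
    using assms \<open>0 < C\<close> by (auto simp: \<eta>_def field_simps)
  obtain ps where ps: "\<forall>(p, q)\<in>set ps. p \<in> Y \<and> q \<in> Y \<and> p \<le> q"
    "\<And>g C \<epsilon>. mono_on Y g \<Longrightarrow> continuous_on Y g \<Longrightarrow>
      (\<And>x y. x \<in> Y \<Longrightarrow> y \<in> Y \<Longrightarrow> x \<le> y \<Longrightarrow> g y - g x \<le> C * (y - x)) \<Longrightarrow>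
      0 \<le> C \<Longrightarrow> C * \<eta> \<le> 2 * \<epsilon> \<Longrightarrow>
      tube (g ` Y) \<epsilon> = 2 * \<epsilon> + (\<Sum>(p, q)\<leftarrow>ps. min (2 * \<epsilon>) (g q - g p))"
    using tube_image_gaps[OF assms(1,2) \<eta>(1)] by blast
  have "mono_on Y g"
  proof (rule mono_onI)
    fix x y assume "x \<in> Y" "y \<in> Y" "x \<le> y"
    moreover have "0 \<le> c * (y - x)" using \<open>x \<le> y\<close> assms by simp
    ultimately show "g x \<le> g y" using g[of x y] by simp
  qed
  then have gY: "tube (g ` Y) \<epsilon> = 2 * \<epsilon> + (\<Sum>(p, q)\<leftarrow>ps. min (2 * \<epsilon>) (g q - g p))"
    using ps(2)[of g C \<epsilon>] assms g \<eta> \<open>0 < C\<close> by auto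
  have id: "k * tube Y (\<epsilon> / k) = 2 * \<epsilon> + (\<Sum>(p, q)\<leftarrow>ps. min (2 * \<epsilon>) (k * (q - p)))"
    if "1 * \<eta> \<le> 2 * (\<epsilon> / k)" "0 < k" for k
  proof -
    have "tube ((\<lambda>x. x) ` Y) (\<epsilon> / k)
        = 2 * (\<epsilon> / k) + (\<Sum>(p, q)\<leftarrow>ps. min (2 * (\<epsilon> / k)) (q - p))"
      by (rule ps(2)[where C=1]) (use that in \<open>auto intro: mono_onI\<close>)
    then have "k * tube Y (\<epsilon> / k)
        = 2 * \<epsilon> + k * (\<Sum>(p, q)\<leftarrow>ps. min (2 * (\<epsilon> / k)) (q - p))"
      using that by (simp add: algebra_simps)
    also have "k * (\<Sum>(p, q)\<leftarrow>ps. min (2 * (\<epsilon> / k)) (q - p))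
        = (\<Sum>(p, q)\<leftarrow>ps. min (2 * \<epsilon>) (k * (q - p)))"
      unfolding sum_list_const_mult[symmetric] using that
      by (intro arg_cong[where f=sum_list] map_cong)
        (auto simp: min_mult_distrib_left field_simps min_def)
    finally show ?thesis .
  qed
  have "(\<Sum>(p, q)\<leftarrow>ps. min (2 * \<epsilon>) (c * (q - p))) \<le> (\<Sum>(p, q)\<leftarrow>ps. min (2 * \<epsilon>) (g q - g p))"
    "(\<Sum>(p, q)\<leftarrow>ps. min (2 * \<epsilon>) (g q - g p)) \<le> (\<Sum>(p, q)\<leftarrow>ps. min (2 * \<epsilon>) (C * (q - p)))"
    using ps(1) g by (force intro!: sum_list_mono min.mono)+
  then show "c * tube Y (\<epsilon> / c) \<le> tube (g ` Y) \<epsilon>" "tube (g ` Y) \<epsilon> \<le> C * tube Y (\<epsilon> / C)"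
    using gY id[of c] id[of C] \<eta> assms \<open>0 < C\<close> by auto
qed

text \<open>Both signs of \<open>s\<close> occur: similarities may reverse orientation, and a
  decreasing map is later reflected by \<open>s = - 1\<close>.\<close>

lemma tube_affine_image:
  assumes "compact Y" "Y \<noteq> {}" "s \<noteq> 0"
  shows "tube ((\<lambda>x. s * x + b) ` Y) \<epsilon> = \<bar>s\<bar> * tube Y (\<epsilon> / \<bar>s\<bar>)"
proof -
  have cpt: "compact ((\<lambda>x. s * x + b) ` Y)"
    by (intro compact_continuous_image continuous_intros assms)
  have eq: "parallel_set ((\<lambda>x. s * x + b) ` Y) \<epsilon> = (\<lambda>x. b + s * x) ` parallel_set Y (\<epsilon> / \<bar>s\<bar>)"
    (is "?L = ?f ` ?R")
  proof -
    have "?f x \<in> ?L \<longleftrightarrow> x \<in> ?R" for x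
    proof -
      have "\<bar>?f x - (s * y + b)\<bar> \<le> \<epsilon> \<longleftrightarrow> \<bar>x - y\<bar> \<le> \<epsilon> / \<bar>s\<bar>" for y
      proof -
        have "?f x - (s * y + b) = s * (x - y)" by (simp add: algebra_simps)
        then show ?thesis using assms(3) by (simp only: abs_mult) (simp add: field_simps)
      qed
      then show ?thesis using assms cpt by (simp add: parallel_set_compact)
    qed
    moreover have "z = ?f ((z - b) / s)" for z using assms by simp
    ultimately show ?thesis by (metis (no_types, lifting) image_iff set_eqI)
  qed
  have R: "?f ` parallel_set Y (\<epsilon> / \<bar>s\<bar>) \<in> sets borel"
    unfolding eq[symmetric] using compact_parallel_set[OF cpt] assms by (simp add: borel_compact)
  have pre: "?f -` (?f ` A) = A" for A using assms by (auto simp: image_iff)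
  have "tube ((\<lambda>x. s * x + b) ` Y) \<epsilon>
      = enn2real (\<integral>\<^sup>+x. ennreal \<bar>s\<bar> * indicator (?f ` parallel_set Y (\<epsilon> / \<bar>s\<bar>)) (?f x) \<partial>lborel)"
  proof -
    have "emeasure lborel (?f ` parallel_set Y (\<epsilon> / \<bar>s\<bar>))
      = (\<integral>\<^sup>+x. indicator (?f ` parallel_set Y (\<epsilon> / \<bar>s\<bar>)) x \<partial>lborel)"
      using R by simp
    also have "\<dots> = ennreal \<bar>s\<bar> * (\<integral>\<^sup>+x. indicator (?f ` parallel_set Y (\<epsilon> / \<bar>s\<bar>)) (b + s * x) \<partial>lborel)"
      by (rule nn_integral_real_affine) (use R assms in auto)
    also have "\<dots> = (\<integral>\<^sup>+x. ennreal \<bar>s\<bar> * indicator (?f ` parallel_set Y (\<epsilon> / \<bar>s\<bar>)) (b + s * x) \<partial>lborel)"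
      by (rule nn_integral_cmult[symmetric]) (use R in measurable)
    finally show ?thesis by (simp add: tube_def eq measure_def)
  qed
  also have "\<dots> = enn2real (\<integral>\<^sup>+x. ennreal \<bar>s\<bar> * indicator (parallel_set Y (\<epsilon> / \<bar>s\<bar>)) x \<partial>lborel)"
    using pre[of "parallel_set Y (\<epsilon> / \<bar>s\<bar>)"] assms
    by (auto simp: indicator_def image_iff intro!: arg_cong[where f=enn2real] nn_integral_cong)
  also have "\<dots> = \<bar>s\<bar> * tube Y (\<epsilon> / \<bar>s\<bar>)"
    using compact_parallel_set[OF assms(1,2)]
    by (subst nn_integral_cmult_indicator) (auto simp: borel_compact tube_def measure_def enn2real_mult)
  finally show ?thesis .
qed

text \<open>Adding the piece with the greatest right end costs one application of the two-set
  formula, hence one new gap. The correction \<open>2 * (card I - 1) * \<epsilon>\<close> minus the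
  sum of minima lies between 0 and \<open>2 * (card I - 1) * \<epsilon>\<close>; it becomes the
  defect of the renewal equation.\<close>

lemma tube_UN_ordered:
  fixes l u :: "'i \<Rightarrow> real"
  assumes "finite I" "I \<noteq> {}"
    and "\<And>i. i \<in> I \<Longrightarrow> compact (Y i) \<and> Y i \<subseteq> {l i..u i} \<and> l i \<in> Y i \<and> u i \<in> Y i \<and> l i < u i"
    and "\<And>i j. i \<in> I \<Longrightarrow> j \<in> I \<Longrightarrow> i \<noteq> j \<Longrightarrow> u i \<le> l j \<or> u j \<le> l i"
  shows "\<exists>ds. length ds = card I - 1 \<and> (\<forall>d\<in>set ds. 0 \<le> d) \<and>
    (\<forall>\<epsilon>\<ge>0. tube (\<Union>i\<in>I. Y i) \<epsilon> =
       (\<Sum>i\<in>I. tube (Y i) \<epsilon>) - 2 * (real (card I) - 1) * \<epsilon> + (\<Sum>d\<leftarrow>ds. min (2 * \<epsilon>) d))"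
  using assms
proof (induction I rule: finite_ranking_induct[where f=u])
  case empty
  then show ?case by simp
next
  case (insert x S)
  show ?case
  proof (cases "x \<in> S \<or> S = {}")
    case True
    then show ?thesis
    proof
      assume "x \<in> S"
      then show ?thesis using insert by (metis emptyE insert_absorb)
    qed (intro exI[of _ "[]"], auto)
  next
    case False
    have "\<exists>ds. length ds = card S - 1 \<and> (\<forall>d\<in>set ds. 0 \<le> d) \<and>
      (\<forall>\<epsilon>\<ge>0. tube (\<Union>i\<in>S. Y i) \<epsilon> =
        (\<Sum>i\<in>S. tube (Y i) \<epsilon>) - 2 * (real (card S) - 1) * \<epsilon> + (\<Sum>d\<leftarrow>ds. min (2 * \<epsilon>) d))"
      by (rule insert.IH) (use False insert.prems in blast)+
    then obtain ds where ds: "length ds = card S - 1" "\<forall>d\<in>set ds. 0 \<le> d"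
      "\<forall>\<epsilon>\<ge>0. tube (\<Union>i\<in>S. Y i) \<epsilon> =
       (\<Sum>i\<in>S. tube (Y i) \<epsilon>) - 2 * (real (card S) - 1) * \<epsilon> + (\<Sum>d\<leftarrow>ds. min (2 * \<epsilon>) d)"
      by (elim exE conjE) (rule that)
    have card: "card S > 0" using False insert by (simp add: card_gt_0_iff)
    define m where "m = Max (u ` S)"
    have "m \<in> u ` S" unfolding m_def by (rule Max_in) (use False insert in auto)
    then obtain k where k: "k \<in> S" "m = u k" by blast
    \<comment> \<open>The other alternative \<open>u x \<le> l y\<close> together with
      \<open>l y < u y\<close> contradicts the ranking by right ends; this is where the intervals
      have to be nondegenerate.\<close>
    have le: "u y \<le> l x" if "y \<in> S" for y
      using insert.hyps(2)[OF that] insert.prems(2)[of x] insert.prems(2)[of y]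
        insert.prems(3)[of x y] that False by force
    have um: "u y \<le> m" if "y \<in> S" for y
      unfolding m_def using that insert by auto
    have "tube ((\<Union>i\<in>S. Y i) \<union> Y x) \<epsilon>
        = tube (\<Union>i\<in>S. Y i) \<epsilon> + tube (Y x) \<epsilon> - 2 * \<epsilon> + min (2 * \<epsilon>) (l x - m)" if "0 \<le> \<epsilon>" for \<epsilon>
    proof (rule tube_Un_ordered)
      show "compact (\<Union>i\<in>S. Y i)" using insert by (intro compact_UN) auto
      show "m \<in> (\<Union>i\<in>S. Y i)" using k insert.prems by auto
      show "y \<le> m" if "y \<in> (\<Union>i\<in>S. Y i)" for y
        using that um insert.prems(2) by (force intro: order_trans)
      show "m \<le> l x" using k le by simp
    qed (use insert.prems(2)[of x] that in auto)
    then have *: "tube (Y x \<union> (\<Union>i\<in>S. Y i)) \<epsilon>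
        = tube (\<Union>i\<in>S. Y i) \<epsilon> + tube (Y x) \<epsilon> - 2 * \<epsilon> + min (2 * \<epsilon>) (l x - m)" if "0 \<le> \<epsilon>" for \<epsilon>
      using that by (simp only: Un_commute)
    have "tube (\<Union>i\<in>insert x S. Y i) \<epsilon> =
       (\<Sum>i\<in>insert x S. tube (Y i) \<epsilon>) - 2 * (real (card (insert x S)) - 1) * \<epsilon>
         + (\<Sum>d\<leftarrow>(l x - m) # ds. min (2 * \<epsilon>) d)" if "0 \<le> \<epsilon>" for \<epsilon>
      using *[OF that] ds(3)[rule_format, OF that] that False insert.hyps(1) by (simp add: algebra_simps)
    moreover have "0 \<le> l x - m" using k le by simp
    ultimately show ?thesis
      by (intro exI[of _ "(l x - m) # ds"]) (use ds card insert False in auto)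
  qed
qed

section \<open>A renewal theorem\<close>

text \<open>\<open>S\<close> is the limit superior of \<open>f\<close> along \<open>G\<close>, and
  \<open>F\<close> refines \<open>G\<close> by the preimages of the neighbourhoods of
  \<open>S\<close>. It replaces a subsequence realising the limit superior; being a filter, it is
  translated by \<open>filtermap\<close> without any choice of indices.\<close>

lemma cluster_at_limsup:
  fixes f :: "real \<Rightarrow> real"
  assumes "G \<noteq> bot" "\<forall>\<^sub>F t in G. \<bar>f t\<bar> \<le> B"
  shows "\<exists>S F. F \<le> G \<and> F \<noteq> bot \<and> (f \<longlongrightarrow> S) F \<and> (\<forall>\<eta>>0. \<forall>\<^sub>F t in G. f t < S + \<eta>)"
proof -
  define E where "E = {x. \<forall>\<^sub>F t in G. f t < x}"
  define S where "S = Inf E"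
  have ne: "B + 1 \<in> E" unfolding E_def using assms(2) by (auto elim!: eventually_mono)
  have lb: "- B \<le> x" if "x \<in> E" for x
  proof (rule ccontr)
    assume "\<not> - B \<le> x"
    then have "\<forall>\<^sub>F t in G. False"
      using that assms(2) unfolding E_def mem_Collect_eq
      by (auto elim: eventually_elim2)
    then show False using assms(1) by simp
  qed
  then have bdd: "bdd_below E" by (auto simp: bdd_below_def)
  have up: "\<forall>\<^sub>F t in G. f t < S + \<eta>" if "0 < \<eta>" for \<eta>
  proof -
    have "\<exists>x\<in>E. x < S + \<eta>" by (rule cInf_lessD) (use ne that S_def in auto)
    then obtain x where "x \<in> E" "x < S + \<eta>" by blast
    then show ?thesis unfolding E_def by (auto elim!: eventually_mono)
  qed
  define F where "F = inf G (filtercomap f (nhds S))"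
  have "F \<noteq> bot"
  proof
    assume "F = bot"
    then obtain P Q where P: "eventually P G" and Q: "eventually Q (filtercomap f (nhds S))"
      and PQ: "\<And>t. \<not> (P t \<and> Q t)"
      unfolding F_def trivial_limit_def eventually_inf by auto
    obtain R where R: "eventually R (nhds S)" "\<And>t. R (f t) \<Longrightarrow> Q t"
      using Q unfolding eventually_filtercomap by blast
    obtain d where d: "0 < d" "\<And>x. dist x S < d \<Longrightarrow> R x"
      using R(1) unfolding eventually_nhds_metric by auto
    \<comment> \<open>Along \<open>G\<close> the values of \<open>f\<close> are eventually below
      \<open>S + d\<close> but not within \<open>d\<close> of \<open>S\<close>, so they are at most
      \<open>S - d\<close>. This contradicts the choice of \<open>S\<close> as an infimum.\<close>
    have "\<forall>\<^sub>F t in G. f t < S - d / 2"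
      using P up[OF d(1)]
    proof eventually_elim
      case (elim t)
      then have "\<not> dist (f t) S < d" using PQ R d by blast
      then show ?case using elim d(1) by (auto simp: dist_real_def)
    qed
    then have "S - d / 2 \<in> E" by (simp add: E_def)
    then have "S \<le> S - d / 2" unfolding S_def using bdd by (rule cInf_lower)
    then show False using d(1) by simp
  qed
  moreover have "(f \<longlongrightarrow> S) F"
    unfolding F_def by (rule filterlim_mono[OF filterlim_filtercomap]) auto
  ultimately show ?thesis using up by (intro exI[of _ S] exI[of _ F]) (auto simp: F_def)
qed

text \<open>It suffices to evaluate the two extreme cluster values. The premises pass on that the
  value is extreme for all of \<open>G\<close>, because propagation along translates is available
  only for extreme values. The lower half comes from the limit superior of
  \<open>- f\<close>.\<close>

lemma tendsto_if_extreme_clusters: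
  fixes f :: "real \<Rightarrow> real"
  assumes "G \<noteq> bot" "\<forall>\<^sub>F t in G. \<bar>f t\<bar> \<le> B"
    and up: "\<And>S F. F \<le> G \<Longrightarrow> F \<noteq> bot \<Longrightarrow> (f \<longlongrightarrow> S) F \<Longrightarrow>
      (\<And>\<eta>. 0 < \<eta> \<Longrightarrow> \<forall>\<^sub>F t in G. f t < S + \<eta>) \<Longrightarrow> S \<le> c"
    and low: "\<And>S F. F \<le> G \<Longrightarrow> F \<noteq> bot \<Longrightarrow> (f \<longlongrightarrow> S) F \<Longrightarrow>
      (\<And>\<eta>. 0 < \<eta> \<Longrightarrow> \<forall>\<^sub>F t in G. S - \<eta> < f t) \<Longrightarrow> c \<le> S"
  shows "(f \<longlongrightarrow> c) G"
proof -
  obtain S F where S: "F \<le> G" "F \<noteq> bot" "(f \<longlongrightarrow> S) F" "\<And>\<eta>. 0 < \<eta> \<Longrightarrow> \<forall>\<^sub>F t in G. f t < S + \<eta>"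
    using cluster_at_limsup[OF assms(1,2)] by (elim exE conjE) simp
  have "\<forall>\<^sub>F t in G. \<bar>- f t\<bar> \<le> B" using assms(2) by simp
  from cluster_at_limsup[OF assms(1) this]
  obtain S' F' where S': "F' \<le> G" "F' \<noteq> bot" "((\<lambda>t. - f t) \<longlongrightarrow> S') F'"
    "\<And>\<eta>. 0 < \<eta> \<Longrightarrow> \<forall>\<^sub>F t in G. - f t < S' + \<eta>" by (elim exE conjE) simp
  have le: "S \<le> c" using up[OF S] .
  have "(f \<longlongrightarrow> - S') F'" using tendsto_minus[OF S'(3)] by simp
  moreover have "\<forall>\<^sub>F t in G. - S' - \<eta> < f t" if "0 < \<eta>" for \<eta>
    using S'(4)[OF that] by (auto elim!: eventually_mono)
  ultimately have ge: "c \<le> - S'" using low[OF S'(1,2)] by blast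
  show ?thesis
  proof (rule tendstoI)
    fix e :: real assume "0 < e"
    show "\<forall>\<^sub>F t in G. dist (f t) c < e"
      using S(4)[OF \<open>0 < e\<close>] S'(4)[OF \<open>0 < e\<close>]
      by eventually_elim (use le ge in \<open>auto simp: dist_real_def\<close>)
  qed
qed

inductive_set shift_semigroup :: "'i set \<Rightarrow> ('i \<Rightarrow> real) \<Rightarrow> real set"
  for I a where
  zero: "0 \<in> shift_semigroup I a"
| step: "x \<in> shift_semigroup I a \<Longrightarrow> i \<in> I \<Longrightarrow> x + a i \<in> shift_semigroup I a"

text \<open>\<open>sub\<close> and \<open>defect\<close> play different roles: the one-sided
  inequality makes \<open>D\<close> monotone, the vanishing defect lets extreme values propagate.
  \<open>growth\<close> stands in for continuity; for volumes it expresses monotonicity in the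
  radius.\<close>

locale renewal =
  fixes I :: "'i set" and p a :: "'i \<Rightarrow> real" and Z :: "real \<Rightarrow> real" and \<kappa> :: real
  assumes finite_I: "finite I"
    and p_pos: "i \<in> I \<Longrightarrow> 0 < p i"
    and p_sum: "sum p I = 1"
    and a_pos: "i \<in> I \<Longrightarrow> 0 < a i"
    and Z_nonneg: "0 \<le> Z t"
    and kappa_nonneg: "0 \<le> \<kappa>"
    and growth: "s \<le> t \<Longrightarrow> Z t \<le> exp (\<kappa> * (t - s)) * Z s"
    and sub: "Z t \<le> (\<Sum>i\<in>I. p i * Z (t - a i))"
    and defect: "((\<lambda>t. Z t - (\<Sum>i\<in>I. p i * Z (t - a i))) \<longlongrightarrow> 0) at_top"
begin

section \<open>The monotone functional and Cesaro means\<close>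

definition \<mu> :: real where "\<mu> = (\<Sum>i\<in>I. p i * a i)"

text \<open>For constant \<open>Z = c\<close> the value is \<open>c * \<mu>\<close>, so
  \<open>L / \<mu>\<close> is the only possible limit of \<open>Z\<close>.\<close>

definition D :: "real \<Rightarrow> real" where "D T = (\<Sum>i\<in>I. p i * integral {T - a i..T} Z)"

lemma I_nonempty: "I \<noteq> {}"
  using p_sum by auto

lemma mu_pos: "0 < \<mu>"
  unfolding \<mu>_def using finite_I I_nonempty p_pos a_pos by (intro sum_pos) auto

text \<open>\<open>growth\<close> says that \<open>exp (- \<kappa> * t) * Z t\<close> is
  nonincreasing in \<open>t\<close>, and monotone functions are Borel.\<close>

lemma Z_borel: "Z \<in> borel_measurable borel"
proof -
  have "mono (\<lambda>t. - (exp (- \<kappa> * t) * Z t))"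
  proof (rule monoI)
    fix s t :: real assume "s \<le> t"
    then have "exp (- \<kappa> * t) * Z t \<le> exp (- \<kappa> * t) * (exp (\<kappa> * (t - s)) * Z s)"
      using growth by (intro mult_left_mono) auto
    also have "\<dots> = exp (- \<kappa> * s) * Z s"
      by (simp add: exp_add[symmetric] mult.assoc[symmetric] algebra_simps)
    finally show "- (exp (- \<kappa> * s) * Z s) \<le> - (exp (- \<kappa> * t) * Z t)" by simp
  qed
  then have "(\<lambda>t. - (exp (- \<kappa> * t) * Z t)) \<in> borel_measurable borel"
    by (rule borel_measurable_mono)
  then have "(\<lambda>t. exp (\<kappa> * t) * - (- (exp (- \<kappa> * t) * Z t))) \<in> borel_measurable borel"
    by measurable
  also have "(\<lambda>t. exp (\<kappa> * t) * - (- (exp (- \<kappa> * t) * Z t))) = Z"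
    by (auto simp: fun_eq_iff mult.assoc[symmetric] exp_add[symmetric])
  finally show ?thesis .
qed

lemma Z_bound_local: "t \<in> {x..y} \<Longrightarrow> Z t \<le> exp (\<kappa> * (y - x)) * Z x"
proof -
  assume t: "t \<in> {x..y}"
  then have "Z t \<le> exp (\<kappa> * (t - x)) * Z x" using growth by simp
  also have "\<dots> \<le> exp (\<kappa> * (y - x)) * Z x"
    using t kappa_nonneg Z_nonneg by (intro mult_right_mono) (auto intro: mult_left_mono)
  finally show ?thesis .
qed

lemma Z_set_integrable: "set_integrable lborel {x..y} Z"
  unfolding set_integrable_def
  by (rule integrableI_bounded_set_indicator[where B="exp (\<kappa> * (y - x)) * Z x"])
    (use Z_borel Z_bound_local Z_nonneg in \<open>auto simp: emeasure_lborel_Icc_eq\<close>)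

lemma Z_integrable: "Z integrable_on {x..y}"
  using set_borel_integral_eq_integral(1)[OF Z_set_integrable] .

lemma integral_shift:
  fixes f :: "real \<Rightarrow> real"
  shows "integral {x..y} (\<lambda>t. f (t - c)) = integral {x - c..y - c} f"
  using integral_shift_Icc_real[of x y f "-c"] by (simp add: o_def)

lemma Z_shift_integrable: "(\<lambda>t. Z (t - c)) integrable_on {x..y}"
proof -
  have "(Z has_integral integral {x - c..y - c} Z) {x + - c..y + - c}"
    using integrable_integral[OF Z_integrable] by simp
  then show ?thesis
    unfolding has_integral_shift_Icc_real[symmetric] by (auto simp: o_def)
qed

lemma D_nonneg: "0 \<le> D T"
  unfolding D_def using p_pos
  by (intro sum_nonneg mult_nonneg_nonneg integral_nonneg Z_integrable Z_nonneg) (auto intro: less_imp_le)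

text \<open>Because the weights sum to 1, \<open>D T - D S\<close> is the integral over
  \<open>{S..T}\<close> of \<open>Z t\<close> minus the weighted mean of the translates
  \<open>Z (t - a i)\<close>, an integrand that \<open>sub\<close> makes nonpositive.\<close>

lemma D_antimono: "S \<le> T \<Longrightarrow> D T \<le> D S"
proof -
  assume ST: "S \<le> T"
  have "integral {T - a i..T} Z - integral {S - a i..S} Z
      = integral {S..T} Z - integral {S..T} (\<lambda>t. Z (t - a i))" if "i \<in> I" for i
  proof -
    have "integral {S - a i..S} Z + integral {S..T} Z = integral {S - a i..T} Z"
      "integral {S - a i..T - a i} Z + integral {T - a i..T} Z = integral {S - a i..T} Z"
      using ST a_pos[OF that] by (intro Henstock_Kurzweil_Integration.integral_combine Z_integrable; simp)+
    then show ?thesis by (simp add: integral_shift)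
  qed
  then have "D T - D S = (\<Sum>i\<in>I. p i * (integral {S..T} Z - integral {S..T} (\<lambda>t. Z (t - a i))))"
    unfolding D_def sum_subtractf[symmetric] right_diff_distrib[symmetric]
    by (intro sum.cong refl) (simp add: right_diff_distrib[symmetric])
  also have "\<dots> = integral {S..T} Z - (\<Sum>i\<in>I. p i * integral {S..T} (\<lambda>t. Z (t - a i)))"
    using p_sum by (simp add: right_diff_distrib sum_subtractf sum_distrib_right[symmetric])
  also have "(\<Sum>i\<in>I. p i * integral {S..T} (\<lambda>t. Z (t - a i)))
      = integral {S..T} (\<lambda>t. \<Sum>i\<in>I. p i * Z (t - a i))"
    using finite_I Z_shift_integrable
    by (subst integral_sum) (auto intro: integrable_on_mult_right)
  also have "integral {S..T} Z - \<dots> \<le> 0"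
    using Z_integrable Z_shift_integrable finite_I sub
    by (auto intro!: integral_le integrable_sum integrable_on_mult_right)
  finally show ?thesis by simp
qed

lemma D_tendsto: "\<exists>L. (D \<longlongrightarrow> L) at_top"
proof -
  have bdd: "bdd_below (range D)" using D_nonneg by (auto simp: bdd_below_def)
  have "(D \<longlongrightarrow> Inf (range D)) at_top"
  proof (rule order_tendstoI)
    fix x assume "x < Inf (range D)"
    then show "\<forall>\<^sub>F t in at_top. x < D t"
      using bdd by (auto intro!: always_eventually dest: less_le_trans[OF _ cInf_lower])
  next
    fix x assume "Inf (range D) < x"
    then obtain T where "D T < x" using cInf_lessD[of "range D" x] by auto
    have "\<forall>\<^sub>F t in at_top. T \<le> t" by (rule eventually_ge_at_top)
    then show "\<forall>\<^sub>F t in at_top. D t < x"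
      by eventually_elim (use D_antimono[of T] \<open>D T < x\<close> in \<open>force intro: le_less_trans\<close>)
  qed
  then show ?thesis by blast
qed

definition L :: real where "L = Lim at_top D"

lemma D_tendsto_L: "(D \<longlongrightarrow> L) at_top"
  using D_tendsto tendsto_Lim trivial_limit_at_top_linorder unfolding L_def by metis

lemma integral_Z_le:
  assumes "x \<le> y" "\<And>t. x \<le> t \<Longrightarrow> t \<le> y \<Longrightarrow> Z t \<le> B"
  shows "integral {x..y} Z \<le> B * (y - x)"
proof -
  have "integral {x..y} Z \<le> integral {x..y} (\<lambda>_. B)"
    using assms by (intro integral_le Z_integrable) auto
  then show ?thesis using assms by (simp add: mult.commute)
qed

lemma integral_Z_ge:
  assumes "x \<le> y" "\<And>t. x \<le> t \<Longrightarrow> t \<le> y \<Longrightarrow> B \<le> Z t"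
  shows "B * (y - x) \<le> integral {x..y} Z"
proof -
  have "integral {x..y} (\<lambda>_. B) \<le> integral {x..y} Z"
    using assms by (intro integral_le Z_integrable) auto
  then show ?thesis using assms by (simp add: mult.commute)
qed

text \<open>By \<open>growth\<close> a single value \<open>Z t\<close> bounds \<open>Z\<close> from
  below on the preceding window \<open>{t - a i..t}\<close>. So the window integral in
  \<open>D t\<close> dominates a fixed multiple of \<open>Z t\<close>, and \<open>D t\<close> is at
  most \<open>D x\<close>.\<close>

lemma Z_bounded: "\<exists>B. \<forall>t\<ge>x. Z t \<le> B"
proof -
  obtain i where i: "i \<in> I" using I_nonempty by blast
  define c where "c = p i * a i * exp (- \<kappa> * a i)"
  have "0 < c" using i p_pos a_pos by (simp add: c_def)
  have "c * Z t \<le> D x" if "x \<le> t" for t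
  proof -
    have "exp (- \<kappa> * a i) * Z t \<le> Z s" if s: "s \<in> {t - a i..t}" for s
    proof -
      have "exp (- \<kappa> * a i) * Z t \<le> exp (- \<kappa> * a i) * (exp (\<kappa> * a i) * Z s)"
        using growth[of s t] s kappa_nonneg Z_nonneg[of s]
        by (intro mult_left_mono order_trans[OF growth[of s t]] mult_right_mono) (auto intro: mult_left_mono)
      then show ?thesis by (simp add: mult.assoc[symmetric] exp_add[symmetric])
    qed
    then have "exp (- \<kappa> * a i) * Z t * (t - (t - a i)) \<le> integral {t - a i..t} Z"
      using a_pos[OF i] by (intro integral_Z_ge) auto
    then have "p i * (exp (- \<kappa> * a i) * Z t * (t - (t - a i))) \<le> p i * integral {t - a i..t} Z"
      using p_pos[OF i] by (intro mult_left_mono) auto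
    also have "p i * (exp (- \<kappa> * a i) * Z t * (t - (t - a i))) = c * Z t"
      by (simp add: c_def)
    finally have "c * Z t \<le> p i * integral {t - a i..t} Z" .
    also have "\<dots> \<le> D t"
      unfolding D_def using i finite_I p_pos
      by (intro member_le_sum[where f="\<lambda>i. p i * integral {t - a i..t} Z"])
        (auto intro!: mult_nonneg_nonneg integral_nonneg Z_integrable Z_nonneg simp: less_imp_le)
    also have "\<dots> \<le> D x" using that by (rule D_antimono)
    finally show ?thesis .
  qed
  then have "\<forall>t\<ge>x. Z t \<le> D x / c" using \<open>0 < c\<close> by (simp add: field_simps)
  then show ?thesis by blast
qed

definition J :: "real \<Rightarrow> real" where "J T = integral {0..T} Z"

lemma J_diff: "0 \<le> x \<Longrightarrow> x \<le> y \<Longrightarrow> J y - J x = integral {x..y} Z"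
  unfolding J_def using Henstock_Kurzweil_Integration.integral_combine[of 0 x y Z] Z_integrable by auto

text \<open>\<open>J\<close> is a primitive of \<open>Z\<close> and \<open>G\<close> one of
  \<open>J\<close>. The second-order quantity \<open>H\<close> has derivative \<open>D\<close>, so
  \<open>H T / T\<close> tends to \<open>L\<close> by l'Hospital; and \<open>H\<close> differs from
  \<open>\<mu> * J\<close> only by a bounded amount, as \<open>J\<close> is Lipschitz.\<close>

lemma Cesaro_Z: "((\<lambda>T. J T / T) \<longlongrightarrow> L / \<mu>) at_top"
proof -
  obtain B where B: "\<And>t. 0 \<le> t \<Longrightarrow> Z t \<le> B" using Z_bounded[of 0] by auto
  have J_lip: "0 \<le> J y - J x" "J y - J x \<le> B * (y - x)" if "0 \<le> x" "x \<le> y" for x y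
    using that integral_Z_le[of x y B] B Z_nonneg
    by (auto simp: J_diff intro!: integral_nonneg Z_integrable)
  have J_cont: "continuous_on {0..y} J" for y
    unfolding J_def by (rule indefinite_integral_continuous_1[OF Z_integrable])
  define G where "G T = integral {0..T} J" for T
  have G_deriv: "(G has_real_derivative J T) (at T)" if "0 < T" for T
  proof -
    have "(G has_real_derivative J T) (at T within {0..T + 1})"
      unfolding G_def using that by (intro integral_has_real_derivative J_cont) auto
    moreover have "T \<in> interior {0..T + 1}" using that by simp
    ultimately show ?thesis by (metis at_within_interior)
  qed
  define H where "H T = (\<Sum>i\<in>I. p i * (G T - G (T - a i)))" for T
  define M where "M = Max (a ` I)"
  have M: "a i \<le> M" if "i \<in> I" for i using that finite_I by (simp add: M_def)
  have "((\<lambda>T. H T / T) \<longlongrightarrow> L) at_top"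
  proof (rule lhospital_at_top_at_top[where g'="\<lambda>_. 1" and f'=D])
    show "\<forall>\<^sub>F T in at_top. (H has_real_derivative D T) (at T)"
      using eventually_gt_at_top[of "max 0 M"]
    proof eventually_elim
      case (elim T)
      have "((\<lambda>T. G (T - a i)) has_real_derivative J (T - a i)) (at T)" if "i \<in> I" for i
        using DERIV_shift[of G "J (T - a i)" T "- a i"] G_deriv[of "T - a i"] M[OF that] elim
        by simp
      then have "(H has_real_derivative (\<Sum>i\<in>I. p i * (J T - J (T - a i)))) (at T)"
        unfolding H_def using elim G_deriv
        by (intro DERIV_sum DERIV_cmult DERIV_diff) auto
      also have "(\<Sum>i\<in>I. p i * (J T - J (T - a i))) = D T"
        unfolding D_def using M elim a_pos
        by (intro sum.cong refl) (force simp: J_diff less_imp_le)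
      finally show ?case .
    qed
  qed (use D_tendsto_L in \<open>auto intro: filterlim_ident\<close>)
  moreover have "((\<lambda>T. (\<mu> * J T - H T) / T) \<longlongrightarrow> 0) at_top"
  proof (rule Lim_null_comparison)
    \<comment> \<open>By the mean value theorem \<open>G T - G (T - a i) = a i * J \<xi>\<close>
      with \<open>\<xi>\<close> within \<open>a i\<close> of \<open>T\<close>, so replacing
      \<open>J \<xi>\<close> by \<open>J T\<close> costs at most
      \<open>a i * (B * a i)\<close>.\<close>
    define C where "C = (\<Sum>i\<in>I. p i * (a i * (B * a i)))"
    show "\<forall>\<^sub>F T in at_top. norm ((\<mu> * J T - H T) / T) \<le> C / T"
      using eventually_gt_at_top[of "max 0 M"]
    proof eventually_elim
      case (elim T)
      have "0 \<le> a i * J T - (G T - G (T - a i)) \<and> a i * J T - (G T - G (T - a i)) \<le> a i * (B * a i)"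
        if i: "i \<in> I" for i
      proof -
        have pos: "0 < T - a i" "T - a i < T" using elim M[OF i] a_pos[OF i] by auto
        obtain \<xi> where \<xi>: "T - a i < \<xi>" "\<xi> < T" "G T - G (T - a i) = (T - (T - a i)) * J \<xi>"
          using MVT2[OF pos(2), of G J] G_deriv pos by (metis less_le_trans)
        have "a i * J T - (G T - G (T - a i)) = a i * (J T - J \<xi>)"
          using \<xi> by (simp add: algebra_simps)
        moreover have "0 \<le> J T - J \<xi>" "J T - J \<xi> \<le> B * (T - \<xi>)"
          using J_lip[of \<xi> T] pos \<xi> by auto
        moreover have "B * (T - \<xi>) \<le> B * a i"
          using \<xi> B[of 0] Z_nonneg[of 0] by (intro mult_left_mono) auto
        ultimately show ?thesis using a_pos[OF i] by (auto intro!: mult_left_mono)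
      qed
      moreover have "\<mu> * J T - H T = (\<Sum>i\<in>I. p i * (a i * J T - (G T - G (T - a i))))"
        by (simp add: \<mu>_def H_def sum_distrib_right sum_subtractf right_diff_distrib mult.assoc)
      ultimately have "0 \<le> \<mu> * J T - H T" "\<mu> * J T - H T \<le> C"
        unfolding C_def using p_pos
        by (auto intro!: sum_nonneg sum_mono mult_left_mono mult_nonneg_nonneg simp: less_imp_le)
      then show ?case using elim by (simp add: divide_right_mono)
    qed
    show "((\<lambda>T. C / T) \<longlongrightarrow> 0) at_top"
      by (rule tendsto_divide_0[OF tendsto_const]) (rule filterlim_at_top_imp_at_infinity[OF filterlim_ident])
  qed
  ultimately have "((\<lambda>T. H T / T + (\<mu> * J T - H T) / T) \<longlongrightarrow> L + 0) at_top"
    by (rule tendsto_add)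
  then have "((\<lambda>T. (\<mu> * J T / T) / \<mu>) \<longlongrightarrow> L / \<mu>) at_top"
    using mu_pos by (intro tendsto_divide) (auto simp: add_divide_distrib[symmetric])
  then show ?thesis using mu_pos by simp
qed

lemma Cesaro_Z_shift: "((\<lambda>T. integral {0..T} (\<lambda>t. Z (t + x)) / T) \<longlongrightarrow> L / \<mu>) at_top"
proof -
  \<comment> \<open>Since \<open>J\<close> starts at 0 and \<open>x\<close> may be negative, the
    integral is split at \<open>\<bar>x\<bar>\<close>; \<open>c\<close> collects what does not
    depend on \<open>T\<close>.\<close>
  define c where "c = integral {x..\<bar>x\<bar>} Z - J \<bar>x\<bar>"
  have top: "filterlim (\<lambda>T. T + x) at_top at_top"
    using filterlim_tendsto_add_at_top[OF tendsto_const filterlim_ident, of x]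
    by (simp add: add.commute)
  have "((\<lambda>T. c / T + J (T + x) / (T + x) * (1 + x / T)) \<longlongrightarrow> 0 + L / \<mu> * (1 + 0)) at_top"
  proof (intro tendsto_add tendsto_mult tendsto_const)
    show "((\<lambda>T. J (T + x) / (T + x)) \<longlongrightarrow> L / \<mu>) at_top"
      by (rule filterlim_compose[OF Cesaro_Z top])
  qed (auto intro!: tendsto_divide_0[OF tendsto_const] filterlim_at_top_imp_at_infinity filterlim_ident)
  moreover have "\<forall>\<^sub>F T in at_top. c / T + J (T + x) / (T + x) * (1 + x / T)
      = integral {0..T} (\<lambda>t. Z (t + x)) / T"
    using eventually_gt_at_top[of "2 * \<bar>x\<bar>"]
  proof eventually_elim
    case (elim T)
    then have T: "0 < T" "0 < T + x" "\<bar>x\<bar> \<le> T + x" by linarith+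
    have "integral {0..T} (\<lambda>t. Z (t + x)) = integral {x..T + x} Z"
      using integral_shift[of 0 T Z "-x"] by simp
    also have "\<dots> = integral {x..\<bar>x\<bar>} Z + integral {\<bar>x\<bar>..T + x} Z"
      using T by (intro Henstock_Kurzweil_Integration.integral_combine[symmetric] Z_integrable) auto
    also have "\<dots> = c + J (T + x)" using T J_diff[of "\<bar>x\<bar>" "T + x"] by (simp add: c_def)
    finally have "integral {0..T} (\<lambda>t. Z (t + x)) = c + J (T + x)" .
    moreover have "1 + x / T = (T + x) / T" using T by (simp add: add_divide_distrib)
    then have "J (T + x) / (T + x) * (1 + x / T) = J (T + x) / T" using T by simp
    ultimately show ?case by (simp add: add_divide_distrib)
  qed
  ultimately show ?thesis using Lim_transform_eventually by force
qed

section \<open>Propagation of extreme values and the limit theorems\<close>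

abbreviation "\<Sigma> \<equiv> shift_semigroup I a"

text \<open>A weighted mean that is close to the upper bound \<open>S\<close> of its terms forces
  every term with positive weight close to \<open>S\<close>. This moves the convergence from
  \<open>t\<close> to \<open>t - a i\<close>, and induction reaches the whole semigroup.
  \<open>G\<close> is left open so that it can be all large times or a single coset of a
  lattice.\<close>

lemma limsup_propagates:
  fixes f :: "real \<Rightarrow> real"
  assumes f: "((\<lambda>t. f t - (\<Sum>i\<in>I. p i * f (t - a i))) \<longlongrightarrow> 0) at_top"
    and G: "G \<le> at_top" "\<And>i. i \<in> I \<Longrightarrow> filtermap (\<lambda>t. t - a i) G \<le> G"
    and up: "\<And>\<eta>. 0 < \<eta> \<Longrightarrow> \<forall>\<^sub>F t in G. f t < S + \<eta>"
    and F: "F \<le> G" "(f \<longlongrightarrow> S) F"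
    and "\<sigma> \<in> \<Sigma>"
  shows "((\<lambda>t. f (t - \<sigma>)) \<longlongrightarrow> S) F \<and> filtermap (\<lambda>t. t - \<sigma>) F \<le> G"
  using \<open>\<sigma> \<in> \<Sigma>\<close>
proof induction
  case zero
  then show ?case using F by (simp add: filtermap_ident)
next
  case (step \<sigma> i)
  define F' where "F' = filtermap (\<lambda>t. t - \<sigma>) F"
  have F': "F' \<le> G" "(f \<longlongrightarrow> S) F'"
    using step unfolding F'_def by (auto simp: filterlim_filtermap)
  have shift: "filtermap (\<lambda>t. t - a j) F' \<le> G" if "j \<in> I" for j
    using G(2)[OF that] filtermap_mono[OF F'(1)] order_trans by blast
  have up': "\<forall>\<^sub>F t in F'. \<forall>j\<in>I. f (t - a j) < S + \<eta>" if "0 < \<eta>" for \<eta>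
  proof (rule eventually_ball_finite[OF finite_I], rule ballI)
    fix j assume "j \<in> I"
    then show "\<forall>\<^sub>F t in F'. f (t - a j) < S + \<eta>"
      using filter_leD[OF shift up[OF that]] by (simp add: eventually_filtermap)
  qed
  have "((\<lambda>t. f (t - a i)) \<longlongrightarrow> S) F'"
  proof (rule order_tendstoI)
    fix y assume "S < y"
    then show "\<forall>\<^sub>F t in F'. f (t - a i) < y"
      using up'[of "y - S"] step(2) by (auto elim!: eventually_mono)
  next
    fix y assume y: "y < S"
    \<comment> \<open>The loss is \<open>\<eta>\<close> from \<open>f t\<close>,
      \<open>\<eta>\<close> from the defect and less than \<open>\<eta>\<close> from the remaining
      terms; \<open>4 * \<eta>\<close> equals the margin \<open>p i * (S - y)\<close>.\<close>
    define \<eta> where "\<eta> = p i * (S - y) / 4"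
    have "0 < \<eta>" using y p_pos[OF step(2)] by (simp add: \<eta>_def)
    have "\<forall>\<^sub>F t in F'. dist (f t) S < \<eta>" using tendstoD[OF F'(2) \<open>0 < \<eta>\<close>] .
    moreover have "\<forall>\<^sub>F t in F'. dist (f t - (\<Sum>i\<in>I. p i * f (t - a i))) 0 < \<eta>"
      using tendstoD[OF f \<open>0 < \<eta>\<close>] F'(1) G(1) by (meson filter_leD order_trans)
    ultimately show "\<forall>\<^sub>F t in F'. y < f (t - a i)"
      using up'[OF \<open>0 < \<eta>\<close>]
    proof eventually_elim
      case (elim t)
      have "(\<Sum>j\<in>I. p j * f (t - a j)) = p i * f (t - a i) + (\<Sum>j\<in>I - {i}. p j * f (t - a j))"
        using finite_I step(2) by (simp add: sum.remove)
      also have "(\<Sum>j\<in>I - {i}. p j * f (t - a j)) \<le> (\<Sum>j\<in>I - {i}. p j * (S + \<eta>))"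
        using elim p_pos by (intro sum_mono mult_left_mono) (auto intro: less_imp_le)
      also have "\<dots> = (1 - p i) * (S + \<eta>)"
        using p_sum finite_I step(2) by (simp add: sum_distrib_right[symmetric] sum_diff1)
      finally have "S - 2 * \<eta> - (1 - p i) * (S + \<eta>) < p i * f (t - a i)"
        using elim by (auto simp: dist_real_def)
      moreover have "p i * \<eta> > 0" using p_pos[OF step(2)] \<open>0 < \<eta>\<close> by simp
      ultimately have "p i * S - 4 * \<eta> < p i * f (t - a i)"
        using \<open>0 < \<eta>\<close> by (simp add: algebra_simps)
      moreover have "4 * \<eta> = p i * S - p i * y" by (simp add: \<eta>_def right_diff_distrib)
      ultimately have "p i * y < p i * f (t - a i)" by linarith
      then show ?case using p_pos[OF step(2)] by simp
    qed
  qed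
  then show ?case
    using shift[OF step(2)] unfolding F'_def
    by (simp add: filterlim_filtermap filtermap_filtermap diff_diff_eq)
qed

text \<open>The passage to \<open>- Z\<close> is why the previous lemma treats an arbitrary
  \<open>f\<close> with vanishing defect: the inequality \<open>sub\<close> would be lost under the
  change of sign.\<close>

lemma liminf_propagates:
  assumes G: "G \<le> at_top" "\<And>i. i \<in> I \<Longrightarrow> filtermap (\<lambda>t. t - a i) G \<le> G"
    and low: "\<And>\<eta>. 0 < \<eta> \<Longrightarrow> \<forall>\<^sub>F t in G. S - \<eta> < Z t"
    and F: "F \<le> G" "(Z \<longlongrightarrow> S) F"
    and "\<sigma> \<in> \<Sigma>"
  shows "((\<lambda>t. Z (t - \<sigma>)) \<longlongrightarrow> S) F \<and> filtermap (\<lambda>t. t - \<sigma>) F \<le> G"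
proof -
  have "((\<lambda>t. - Z (t - \<sigma>)) \<longlongrightarrow> - S) F \<and> filtermap (\<lambda>t. t - \<sigma>) F \<le> G"
  proof (rule limsup_propagates[where f="\<lambda>t. - Z t"])
    show "((\<lambda>t. - Z t - (\<Sum>i\<in>I. p i * - Z (t - a i))) \<longlongrightarrow> 0) at_top"
      using tendsto_minus[OF defect] by (simp add: sum_negf)
    show "\<forall>\<^sub>F t in G. - Z t < - S + \<eta>" if "0 < \<eta>" for \<eta>
      using low[OF that] by (auto elim!: eventually_mono)
  qed (use assms in \<open>auto intro: tendsto_minus\<close>)
  then show ?thesis by (auto dest: tendsto_minus_cancel)
qed

text \<open>Along \<open>F\<close> the values \<open>Z (t - \<sigma>)\<close> tend to the extreme
  value \<open>S\<close> for each \<open>\<sigma>\<close> separately. Finitely many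
  \<open>\<sigma>\<close>, spaced by about \<open>d\<close>, cover a window as long as the longest
  step, and \<open>growth\<close> interpolates between them. Then \<open>D\<close> at the right end
  of the window is comparable with \<open>S * \<mu>\<close> up to errors that vanish with
  \<open>d\<close>, while its limit is \<open>L\<close>.\<close>

lemma tendsto_nonlattice:
  assumes dense: "\<And>d. 0 < d \<Longrightarrow> \<exists>x0. \<forall>u\<ge>x0. \<exists>\<sigma>\<in>\<Sigma>. u \<le> \<sigma> \<and> \<sigma> \<le> u + d"
  shows "(Z \<longlongrightarrow> L / \<mu>) at_top"
proof -
  define M where "M = Max (a ` I)"
  have M: "a i \<le> M" if "i \<in> I" for i using that finite_I by (simp add: M_def)
  obtain i0 where "i0 \<in> I" using I_nonempty by blast
  then have "0 < M" using M a_pos by force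
  have at_top_shift: "filtermap (\<lambda>t. t - c) at_top \<le> at_top" for c :: real
  proof -
    have "filterlim (\<lambda>t. - c + t) at_top at_top"
      by (rule filterlim_tendsto_add_at_top[OF tendsto_const filterlim_ident])
    then show ?thesis by (simp add: filterlim_def)
  qed
  \<comment> \<open>Elements are supplied on both sides of \<open>s\<close>. The lower estimate uses
    the later time \<open>t - \<sigma>\<close> with \<open>\<sigma> \<le> s\<close>, the upper one
    the earlier time \<open>t - \<sigma>'\<close> with \<open>s \<le> \<sigma>'\<close>.\<close>
  have window: "\<exists>c. \<forall>\<^sub>F t in F. \<forall>s\<in>{c..c + M}. \<exists>\<sigma> \<sigma>'. s - 3 * d \<le> \<sigma> \<and> \<sigma> \<le> s \<and> s \<le> \<sigma>' \<and>
      \<sigma>' \<le> s + 3 * d \<and> P t \<sigma> \<and> P t \<sigma>'"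
    if "0 < d" and P: "\<And>\<sigma>. \<sigma> \<in> \<Sigma> \<Longrightarrow> \<forall>\<^sub>F t in F. P t \<sigma>" for d P and F :: "real filter"
  proof -
    obtain x0 where x0: "\<And>u. x0 \<le> u \<Longrightarrow> \<exists>\<sigma>\<in>\<Sigma>. u \<le> \<sigma> \<and> \<sigma> \<le> u + d" using dense[OF \<open>0 < d\<close>] by blast
    then obtain \<tau> where \<tau>: "\<And>u. x0 \<le> u \<Longrightarrow> \<tau> u \<in> \<Sigma> \<and> u \<le> \<tau> u \<and> \<tau> u \<le> u + d" by metis
    \<comment> \<open>For \<open>s\<close> in cell \<open>j\<close> the nodes \<open>j - 1\<close>
      and \<open>j + 1\<close> are used, as \<open>\<tau>\<close> may overshoot by \<open>d\<close>;
      hence the window starts at \<open>x0 + d\<close> and the grid ends beyond it.\<close>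
    define n where "n = nat \<lceil>M / d\<rceil> + 3"
    define grid where "grid = (\<lambda>j. x0 + real j * d) ` {..n}"
    have "\<forall>\<^sub>F t in F. \<forall>u\<in>grid. P t (\<tau> u)"
      unfolding grid_def using \<tau> P \<open>0 < d\<close> by (intro eventually_ball_finite) auto
    then have "\<forall>\<^sub>F t in F. \<forall>s\<in>{x0 + d..(x0 + d) + M}. \<exists>\<sigma> \<sigma>'. s - 3 * d \<le> \<sigma> \<and> \<sigma> \<le> s \<and> s \<le> \<sigma>' \<and>
      \<sigma>' \<le> s + 3 * d \<and> P t \<sigma> \<and> P t \<sigma>'"
    proof eventually_elim
      case (elim t)
      show ?case
      proof
        fix s assume s: "s \<in> {x0 + d..(x0 + d) + M}"
        define j where "j = nat \<lfloor>(s - x0) / d\<rfloor>"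
        have fl: "1 \<le> (s - x0) / d" using s \<open>0 < d\<close> by (simp add: field_simps)
        then have "real j \<le> (s - x0) / d" "(s - x0) / d < real j + 1" "1 \<le> j"
          unfolding j_def by linarith+
        then have j: "x0 + real j * d \<le> s" "s < x0 + real j * d + d" "1 \<le> j"
          using \<open>0 < d\<close> by (auto simp: field_simps)
        have "(s - x0) / d \<le> (M + d) / d" using s \<open>0 < d\<close> by (intro divide_right_mono) auto
        also have "\<dots> = M / d + 1" using \<open>0 < d\<close> by (simp add: add_divide_distrib)
        finally have "(s - x0) / d \<le> M / d + 1" .
        then have "j + 1 \<le> n"
          unfolding n_def using \<open>real j \<le> (s - x0) / d\<close> by linarith
        then have "x0 + real (j - 1) * d \<in> grid" "x0 + real (j + 1) * d \<in> grid"
          unfolding grid_def by (intro imageI; simp)+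
        moreover have "real (j - 1) * d = real j * d - d" "real (j + 1) * d = real j * d + d"
          using j(3) by (auto simp: of_nat_diff algebra_simps)
        ultimately have *: "x0 + (real j * d - d) \<in> grid" "x0 + (real j * d + d) \<in> grid" by auto
        have ge: "x0 \<le> x0 + (real j * d - d)" "x0 \<le> x0 + (real j * d + d)"
          using j(3) \<open>0 < d\<close> by (auto simp: mult_le_cancel_right1)
        show "\<exists>\<sigma> \<sigma>'. s - 3 * d \<le> \<sigma> \<and> \<sigma> \<le> s \<and> s \<le> \<sigma>' \<and> \<sigma>' \<le> s + 3 * d \<and> P t \<sigma> \<and> P t \<sigma>'"
          using elim * \<tau>[OF ge(1)] \<tau>[OF ge(2)] j \<open>0 < d\<close>
          by (intro exI[of _ "\<tau> (x0 + (real j * d - d))"] exI[of _ "\<tau> (x0 + (real j * d + d))"]) auto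
      qed
    qed
    then show ?thesis by blast
  qed
  have D_lim: "((\<lambda>t. D (t - c)) \<longlongrightarrow> L) F" if "F \<le> at_top" for F c
  proof -
    have "filtermap (\<lambda>t. t - c) F \<le> at_top"
      using filtermap_mono[OF that] at_top_shift order_trans by blast
    then have "(D \<longlongrightarrow> L) (filtermap (\<lambda>t. t - c) F)" using D_tendsto_L filterlim_mono by blast
    then show ?thesis by (simp add: filterlim_filtermap)
  qed
  have sum_mu: "(\<Sum>i\<in>I. p i * (y * a i)) = y * \<mu>" for y
    by (simp add: \<mu>_def sum_distrib_left algebra_simps)
  obtain B where B: "\<And>t. 0 \<le> t \<Longrightarrow> Z t \<le> B" using Z_bounded[of 0] by auto
  show ?thesis
  proof (rule tendsto_if_extreme_clusters[where B=B])
    show "\<forall>\<^sub>F t in at_top. \<bar>Z t\<bar> \<le> B"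
      using eventually_ge_at_top[of 0] by eventually_elim (use B Z_nonneg in auto)
  next
    fix S F assume F: "F \<le> at_top" "F \<noteq> bot" "(Z \<longlongrightarrow> S) F"
      and up: "\<And>\<eta>. 0 < \<eta> \<Longrightarrow> \<forall>\<^sub>F t in at_top. Z t < S + \<eta>"
    have lim: "((\<lambda>t. Z (t - \<sigma>)) \<longlongrightarrow> S) F" if "\<sigma> \<in> \<Sigma>" for \<sigma>
      using limsup_propagates[OF defect order_refl at_top_shift up F(1,3) that] by simp
    have "0 \<le> S" using tendsto_lowerbound[OF F(3) _ F(2), of 0] Z_nonneg by simp
    have main: "exp (- (3 * \<kappa> * d)) * (S - d) * \<mu> \<le> L" if "0 < d" for d
    proof -
      have "\<forall>\<^sub>F t in F. S - d < Z (t - \<sigma>)" if "\<sigma> \<in> \<Sigma>" for \<sigma>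
        using order_tendstoD(1)[OF lim[OF that], of "S - d"] \<open>0 < d\<close> by simp
      then have "\<exists>c. \<forall>\<^sub>F t in F. \<forall>s\<in>{c..c + M}. \<exists>\<sigma> \<sigma>'.
        s - 3 * d \<le> \<sigma> \<and> \<sigma> \<le> s \<and> s \<le> \<sigma>' \<and> \<sigma>' \<le> s + 3 * d \<and> S - d < Z (t - \<sigma>) \<and> S - d < Z (t - \<sigma>')"
        by (intro window[where P="\<lambda>t \<sigma>. S - d < Z (t - \<sigma>)", OF that])
      then obtain c where c: "\<forall>\<^sub>F t in F. \<forall>s\<in>{c..c + M}. \<exists>\<sigma> \<sigma>'.
        s - 3 * d \<le> \<sigma> \<and> \<sigma> \<le> s \<and> s \<le> \<sigma>' \<and> \<sigma>' \<le> s + 3 * d \<and> S - d < Z (t - \<sigma>) \<and> S - d < Z (t - \<sigma>')" ..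
      have "\<forall>\<^sub>F t in F. exp (- (3 * \<kappa> * d)) * (S - d) * \<mu> \<le> D (t - c)"
        using c
      proof eventually_elim
        case (elim t)
        have Zlow: "exp (- (3 * \<kappa> * d)) * (S - d) \<le> Z (t - s)" if "s \<in> {c..c + M}" for s
        proof -
          from bspec[OF elim that] obtain \<sigma> \<sigma>' where
            "s - 3 * d \<le> \<sigma> \<and> \<sigma> \<le> s \<and> s \<le> \<sigma>' \<and> \<sigma>' \<le> s + 3 * d \<and> S - d < Z (t - \<sigma>) \<and> S - d < Z (t - \<sigma>')"
            by (elim exE)
          then have \<sigma>: "s - 3 * d \<le> \<sigma>" "\<sigma> \<le> s" "S - d < Z (t - \<sigma>)" by simp_all
          have "S - d \<le> exp (\<kappa> * (s - \<sigma>)) * Z (t - s)" using growth[of "t - s" "t - \<sigma>"] \<sigma> by simp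
          also have "\<dots> \<le> exp (3 * \<kappa> * d) * Z (t - s)"
            using \<sigma> kappa_nonneg Z_nonneg mult_left_mono[of "s - \<sigma>" "3 * d" \<kappa>]
            by (intro mult_right_mono) auto
          finally have "exp (- (3 * \<kappa> * d)) * (S - d) \<le> exp (- (3 * \<kappa> * d)) * (exp (3 * \<kappa> * d) * Z (t - s))"
            by (intro mult_left_mono) auto
          then show ?thesis by (simp add: mult.assoc[symmetric] exp_add[symmetric])
        qed
        have "exp (- (3 * \<kappa> * d)) * (S - d) * a i \<le> integral {t - c - a i..t - c} Z" if "i \<in> I" for i
        proof -
          have "exp (- (3 * \<kappa> * d)) * (S - d) \<le> Z r" if "t - c - a i \<le> r" "r \<le> t - c" for r
            using Zlow[of "t - r"] that M[OF \<open>i \<in> I\<close>] by simp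
          then show ?thesis
            using integral_Z_ge[of "t - c - a i" "t - c" "exp (- (3 * \<kappa> * d)) * (S - d)"] a_pos[OF that] by simp
        qed
        then have "(\<Sum>i\<in>I. p i * (exp (- (3 * \<kappa> * d)) * (S - d) * a i)) \<le> D (t - c)"
          unfolding D_def using p_pos by (intro sum_mono mult_left_mono) (auto intro: less_imp_le)
        then show ?case by (simp only: sum_mu)
      qed
      then show ?thesis using tendsto_lowerbound[OF D_lim[OF F(1)] _ F(2)] by blast
    qed
    have "((\<lambda>d. exp (- (3 * \<kappa> * d)) * (S - d) * \<mu>) \<longlongrightarrow> exp (- (3 * \<kappa> * 0)) * (S - 0) * \<mu>) (at_right 0)"
      by (intro tendsto_intros)
    then have "S * \<mu> \<le> L"
      using main eventually_at_right_less[of "0::real"]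
      by (intro tendsto_upperbound[of "\<lambda>d. exp (- (3 * \<kappa> * d)) * (S - d) * \<mu>" _ "at_right 0"])
        (auto elim!: eventually_mono)
    then show "S \<le> L / \<mu>" using mu_pos by (simp add: field_simps)
  next
    fix S F assume F: "F \<le> at_top" "F \<noteq> bot" "(Z \<longlongrightarrow> S) F"
      and low: "\<And>\<eta>. 0 < \<eta> \<Longrightarrow> \<forall>\<^sub>F t in at_top. S - \<eta> < Z t"
    have lim: "((\<lambda>t. Z (t - \<sigma>)) \<longlongrightarrow> S) F" if "\<sigma> \<in> \<Sigma>" for \<sigma>
      using liminf_propagates[OF order_refl at_top_shift low F(1,3) that] by simp
    have main: "L \<le> exp (3 * \<kappa> * d) * (S + d) * \<mu>" if "0 < d" for d
    proof -
      have "\<forall>\<^sub>F t in F. Z (t - \<sigma>) < S + d" if "\<sigma> \<in> \<Sigma>" for \<sigma>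
        using order_tendstoD(2)[OF lim[OF that], of "S + d"] \<open>0 < d\<close> by simp
      then have "\<exists>c. \<forall>\<^sub>F t in F. \<forall>s\<in>{c..c + M}. \<exists>\<sigma> \<sigma>'.
        s - 3 * d \<le> \<sigma> \<and> \<sigma> \<le> s \<and> s \<le> \<sigma>' \<and> \<sigma>' \<le> s + 3 * d \<and> Z (t - \<sigma>) < S + d \<and> Z (t - \<sigma>') < S + d"
        by (intro window[where P="\<lambda>t \<sigma>. Z (t - \<sigma>) < S + d", OF that])
      then obtain c where c: "\<forall>\<^sub>F t in F. \<forall>s\<in>{c..c + M}. \<exists>\<sigma> \<sigma>'.
        s - 3 * d \<le> \<sigma> \<and> \<sigma> \<le> s \<and> s \<le> \<sigma>' \<and> \<sigma>' \<le> s + 3 * d \<and> Z (t - \<sigma>) < S + d \<and> Z (t - \<sigma>') < S + d" ..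
      have "\<forall>\<^sub>F t in F. D (t - c) \<le> exp (3 * \<kappa> * d) * (S + d) * \<mu>"
        using c
      proof eventually_elim
        case (elim t)
        have Zup: "Z (t - s) \<le> exp (3 * \<kappa> * d) * (S + d)" if "s \<in> {c..c + M}" for s
        proof -
          from bspec[OF elim that] obtain \<sigma>' \<sigma> where
            "s - 3 * d \<le> \<sigma>' \<and> \<sigma>' \<le> s \<and> s \<le> \<sigma> \<and> \<sigma> \<le> s + 3 * d \<and> Z (t - \<sigma>') < S + d \<and> Z (t - \<sigma>) < S + d"
            by (elim exE)
          then have \<sigma>: "s \<le> \<sigma>" "\<sigma> \<le> s + 3 * d" "Z (t - \<sigma>) < S + d" by simp_all
          have "Z (t - s) \<le> exp (\<kappa> * (\<sigma> - s)) * Z (t - \<sigma>)" using growth[of "t - \<sigma>" "t - s"] \<sigma> by simp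
          also have "\<dots> \<le> exp (3 * \<kappa> * d) * (S + d)"
            using \<sigma> kappa_nonneg Z_nonneg mult_left_mono[of "\<sigma> - s" "3 * d" \<kappa>]
            by (intro mult_mono) (auto intro: less_imp_le)
          finally show ?thesis .
        qed
        have "integral {t - c - a i..t - c} Z \<le> exp (3 * \<kappa> * d) * (S + d) * a i" if "i \<in> I" for i
        proof -
          have "Z r \<le> exp (3 * \<kappa> * d) * (S + d)" if "t - c - a i \<le> r" "r \<le> t - c" for r
            using Zup[of "t - r"] that M[OF \<open>i \<in> I\<close>] by simp
          then show ?thesis
            using integral_Z_le[of "t - c - a i" "t - c" "exp (3 * \<kappa> * d) * (S + d)"] a_pos[OF that] by simp
        qed
        then have "D (t - c) \<le> (\<Sum>i\<in>I. p i * (exp (3 * \<kappa> * d) * (S + d) * a i))"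
          unfolding D_def using p_pos by (intro sum_mono mult_left_mono) (auto intro: less_imp_le)
        then show ?case by (simp only: sum_mu)
      qed
      then show ?thesis using tendsto_upperbound[OF D_lim[OF F(1)] _ F(2)] by blast
    qed
    have "((\<lambda>d. exp (3 * \<kappa> * d) * (S + d) * \<mu>) \<longlongrightarrow> exp (3 * \<kappa> * 0) * (S + 0) * \<mu>) (at_right 0)"
      by (intro tendsto_intros)
    then have "L \<le> S * \<mu>"
      using main eventually_at_right_less[of "0::real"]
      by (intro tendsto_lowerbound[of "\<lambda>d. exp (3 * \<kappa> * d) * (S + d) * \<mu>" _ "at_right 0"])
        (auto elim!: eventually_mono)
    then show "L / \<mu> \<le> S" using mu_pos by (simp add: field_simps)
  qed simp
qed

text \<open>On a coset of the lattice the windows of \<open>D\<close> become finite sums over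
  lattice points, and \<open>E\<close> does not increase from one lattice point to the next, by
  telescoping. As all multiples from \<open>k0\<close> on lie in the semigroup, the window ending at
  \<open>t - k0 * \<alpha>\<close> sees only the extreme value, which \<open>E\<close> then
  determines. The limit may depend on the coset.\<close>

lemma convergent_lattice:
  fixes m :: "'i \<Rightarrow> nat"
  assumes "0 < \<alpha>" and m: "\<And>i. i \<in> I \<Longrightarrow> a i = real (m i) * \<alpha>"
    and \<Sigma>: "\<And>k. k0 \<le> k \<Longrightarrow> real k * \<alpha> \<in> \<Sigma>"
  shows "\<exists>l. (\<lambda>k. Z (t0 + real k * \<alpha>)) \<longlonglongrightarrow> l"
proof -
  define G where "G = filtermap (\<lambda>k. t0 + real k * \<alpha>) sequentially"
  have G_top: "G \<le> at_top"
    unfolding G_def filterlim_def[symmetric]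
    by (rule filterlim_tendsto_add_at_top[OF tendsto_const])
      (rule filterlim_at_top_mult_tendsto_pos[OF tendsto_const \<open>0 < \<alpha>\<close> filterlim_real_sequentially])
  have G_shift: "filtermap (\<lambda>t. t - real n * \<alpha>) G \<le> G" for n
  proof (rule filter_leI)
    fix P assume "eventually P G"
    then obtain K where K: "\<And>k. K \<le> k \<Longrightarrow> P (t0 + real k * \<alpha>)"
      unfolding G_def eventually_filtermap eventually_sequentially by blast
    have "P (t0 + real k * \<alpha> - real n * \<alpha>)" if "K + n \<le> k" for k
      using K[of "k - n"] that by (simp add: of_nat_diff algebra_simps)
    then show "eventually P (filtermap (\<lambda>t. t - real n * \<alpha>) G)"
      unfolding G_def eventually_filtermap eventually_sequentially by blast
  qed
  define E where "E T = (\<Sum>i\<in>I. p i * (\<Sum>j<m i. Z (T - real j * \<alpha>)))" for T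
  have "E T \<le> E (T - \<alpha>)" for T
  proof -
    have "E T - E (T - \<alpha>) = (\<Sum>i\<in>I. p i * (Z T - Z (T - a i)))"
    proof -
      have "(\<Sum>j<m i. Z (T - real j * \<alpha>)) - (\<Sum>j<m i. Z (T - \<alpha> - real j * \<alpha>)) = Z T - Z (T - a i)"
        if "i \<in> I" for i
      proof -
        have "(\<Sum>j<m i. Z (T - \<alpha> - real j * \<alpha>)) = (\<Sum>j<m i. Z (T - real (Suc j) * \<alpha>))"
          by (simp add: algebra_simps)
        then have "(\<Sum>j<m i. Z (T - real j * \<alpha>)) - (\<Sum>j<m i. Z (T - \<alpha> - real j * \<alpha>))
          = (\<Sum>j<m i. Z (T - real j * \<alpha>) - Z (T - real (Suc j) * \<alpha>))"
          by (simp only: sum_subtractf)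
        also have "\<dots> = Z (T - real 0 * \<alpha>) - Z (T - real (m i) * \<alpha>)"
          by (rule sum_lessThan_telescope')
        finally show ?thesis using m[OF that] by simp
      qed
      then show ?thesis
        unfolding E_def sum_subtractf[symmetric] right_diff_distrib[symmetric]
        by (intro sum.cong refl) (simp add: right_diff_distrib[symmetric])
    qed
    also have "\<dots> = Z T - (\<Sum>i\<in>I. p i * Z (T - a i))"
      using p_sum by (simp add: right_diff_distrib sum_subtractf sum_distrib_right[symmetric])
    also have "\<dots> \<le> 0" using sub by simp
    finally show ?thesis by simp
  qed
  from this[of "t0 + real (Suc k) * \<alpha>" for k]
  have "decseq (\<lambda>k. E (t0 + real k * \<alpha>))"
    by (intro decseq_SucI) (simp add: algebra_simps)
  moreover have "0 \<le> E T" for T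
    unfolding E_def using p_pos Z_nonneg
    by (intro sum_nonneg mult_nonneg_nonneg) (auto intro: less_imp_le)
  ultimately obtain l where "(\<lambda>k. E (t0 + real k * \<alpha>)) \<longlonglongrightarrow> l"
    using decseq_convergent[of "\<lambda>k. E (t0 + real k * \<alpha>)" 0] by blast
  then have E_lim: "(E \<longlongrightarrow> l) G" unfolding G_def filterlim_filtermap .
  \<comment> \<open>On a constant \<open>S\<close> the functional \<open>E\<close> takes the value
    \<open>q * S\<close>, and \<open>q * \<alpha> = \<mu>\<close>.\<close>
  define q where "q = (\<Sum>i\<in>I. p i * real (m i))"
  have "0 < q"
  proof -
    have "\<mu> = q * \<alpha>" unfolding \<mu>_def q_def sum_distrib_right using m by (intro sum.cong) auto
    then show ?thesis using mu_pos \<open>0 < \<alpha>\<close> by (simp add: zero_less_mult_iff)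
  qed
  have val: "S = l / q" if "F \<le> G" "F \<noteq> bot"
    and lim: "\<And>k. k0 \<le> k \<Longrightarrow> ((\<lambda>t. Z (t - real k * \<alpha>)) \<longlongrightarrow> S) F" for S F
  proof -
    have "((\<lambda>t. E (t - real k0 * \<alpha>)) \<longlongrightarrow> (\<Sum>i\<in>I. p i * (\<Sum>j<m i. S))) F"
      unfolding E_def
    proof (intro tendsto_sum tendsto_mult tendsto_const)
      fix j
      show "((\<lambda>t. Z (t - real k0 * \<alpha> - real j * \<alpha>)) \<longlongrightarrow> S) F"
        using lim[of "k0 + j"] by (simp add: algebra_simps)
    qed
    moreover have "filtermap (\<lambda>t. t - real k0 * \<alpha>) F \<le> G"
      using filtermap_mono[OF that(1)] G_shift order_trans by blast
    then have "((\<lambda>t. E (t - real k0 * \<alpha>)) \<longlongrightarrow> l) F"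
      using filterlim_mono[OF E_lim order_refl, of "filtermap (\<lambda>t. t - real k0 * \<alpha>) F"]
      by (simp add: filterlim_filtermap)
    ultimately have "(\<Sum>i\<in>I. p i * (\<Sum>j<m i. S)) = l" using tendsto_unique that(2) by blast
    moreover have "(\<Sum>i\<in>I. p i * (\<Sum>j<m i. S)) = q * S"
      by (simp add: q_def sum_distrib_right mult.assoc)
    ultimately show ?thesis using \<open>0 < q\<close> by (simp add: field_simps)
  qed
  have G_shift': "filtermap (\<lambda>t. t - a i) G \<le> G" if "i \<in> I" for i
    using G_shift[of "m i"] m[OF that] by simp
  obtain B where B: "\<And>t. 0 \<le> t \<Longrightarrow> Z t \<le> B" using Z_bounded[of 0] by auto
  have "(Z \<longlongrightarrow> l / q) G"
  proof (rule tendsto_if_extreme_clusters[where B=B])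
    show "G \<noteq> bot" by (simp add: G_def filtermap_bot_iff)
    show "\<forall>\<^sub>F t in G. \<bar>Z t\<bar> \<le> B"
      using filter_leD[OF G_top eventually_ge_at_top[of 0]] by eventually_elim (use B Z_nonneg in auto)
  next
    fix S F assume F: "F \<le> G" "F \<noteq> bot" "(Z \<longlongrightarrow> S) F"
      and up: "\<And>\<eta>. 0 < \<eta> \<Longrightarrow> \<forall>\<^sub>F t in G. Z t < S + \<eta>"
    show "S \<le> l / q"
      using val[OF F(1,2) conjunct1[OF limsup_propagates[OF defect G_top G_shift' up F(1,3) \<Sigma>]]] by simp
  next
    fix S F assume F: "F \<le> G" "F \<noteq> bot" "(Z \<longlongrightarrow> S) F"
      and low: "\<And>\<eta>. 0 < \<eta> \<Longrightarrow> \<forall>\<^sub>F t in G. S - \<eta> < Z t"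
    show "l / q \<le> S"
      using val[OF F(1,2) conjunct1[OF liminf_propagates[OF G_top G_shift' low F(1,3) \<Sigma>]]] by simp
  qed
  then show ?thesis unfolding G_def filterlim_filtermap by blast
qed

end

section \<open>Semigroups of translations and the lattice property\<close>

lemma real_subgroup_cyclic:
  fixes G :: "real set"
  assumes diff: "\<And>x y. x \<in> G \<Longrightarrow> y \<in> G \<Longrightarrow> x - y \<in> G"
    and gap: "0 < \<eta>" "\<And>x. x \<in> G \<Longrightarrow> 0 < x \<Longrightarrow> \<eta> \<le> x"
    and g: "g \<in> G" "0 < g"
  obtains b where "b \<in> G" "0 < b" "\<And>x. x \<in> G \<Longrightarrow> \<exists>k::int. x = of_int k * b"
proof -
  define P where "P = {x\<in>G. 0 < x}"
  define b where "b = Inf P"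
  have P: "P \<noteq> {}" "bdd_below P" using g by (auto simp: P_def bdd_below_def intro: less_imp_le)
  have b_le: "b \<le> x" if "x \<in> P" for x unfolding b_def using that P(2) by (rule cInf_lower)
  \<comment> \<open>An infimum that is not attained has two elements of \<open>P\<close> less than
    \<open>\<eta>\<close> above it, whose difference is a positive element of \<open>G\<close> below
    \<open>\<eta>\<close>.\<close>
  have "b \<in> P"
  proof (rule ccontr)
    assume "b \<notin> P"
    obtain x where x: "x \<in> P" "x < b + \<eta>"
      using cInf_lessD[of P "b + \<eta>"] P(1) gap(1) b_def by auto
    then have "b < x" using b_le \<open>b \<notin> P\<close> by (force simp: less_le)
    then obtain y where y: "y \<in> P" "y < x" using cInf_lessD[of P x] P(1) b_def by auto
    have "x - y \<in> G" "0 < x - y" "x - y < \<eta>"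
      using x y b_le[OF y(1)] diff by (auto simp: P_def)
    then show False using gap(2) by force
  qed
  then have b: "b \<in> G" "0 < b" by (auto simp: P_def)
  have zero: "0 \<in> G" using diff[OF b(1) b(1)] by simp
  have minus: "- x \<in> G" if "x \<in> G" for x using diff[OF zero that] by simp
  have add: "x + y \<in> G" if "x \<in> G" "y \<in> G" for x y using diff[OF that(1) minus[OF that(2)]] by simp
  have nat_mult: "real n * b \<in> G" for n
    by (induction n) (use zero add b in \<open>auto simp: algebra_simps\<close>)
  have int_mult: "of_int k * b \<in> G" for k :: int
  proof (cases "0 \<le> k")
    case True
    then show ?thesis using nat_mult[of "nat k"] by simp
  next
    case False
    then show ?thesis using minus[OF nat_mult[of "nat (- k)"]] by simp
  qed
  have "\<exists>k::int. x = of_int k * b" if "x \<in> G" for x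
  proof -
    define k where "k = \<lfloor>x / b\<rfloor>"
    have "of_int k \<le> x / b" "x / b < of_int k + 1" unfolding k_def by linarith+
    then have "0 \<le> x - of_int k * b" "x - of_int k * b < b" using b by (auto simp: field_simps)
    moreover have "x - of_int k * b \<in> G" using diff that int_mult by blast
    ultimately have "x - of_int k * b = 0" using b_le[of "x - of_int k * b"] by (force simp: P_def)
    then show ?thesis by auto
  qed
  then show ?thesis using that b by blast
qed

lemma shift_semigroup_add:
  assumes "x \<in> shift_semigroup I a" "y \<in> shift_semigroup I a"
  shows "x + y \<in> shift_semigroup I a"
  using assms(2)
  by induction (use assms(1) in \<open>auto simp: add.assoc[symmetric] intro: shift_semigroup.step\<close>)

lemma shift_semigroup_mult:
  assumes "x \<in> shift_semigroup I a"
  shows "real n * x \<in> shift_semigroup I a"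
  by (induction n) (use assms in \<open>auto simp: algebra_simps intro: shift_semigroup.zero shift_semigroup_add\<close>)

lemma shift_semigroup_generator: "i \<in> I \<Longrightarrow> a i \<in> shift_semigroup I a"
  using shift_semigroup.step[OF shift_semigroup.zero, of i I a] by simp

lemma shift_semigroup_multiples:
  assumes "\<And>i. i \<in> I \<Longrightarrow> \<exists>k::int. a i = of_int k * b" "x \<in> shift_semigroup I a"
  shows "\<exists>k::int. x = of_int k * b"
  using assms(2)
proof induction
  case zero
  then show ?case by (intro exI[of _ 0]) simp
next
  case (step x i)
  then obtain j k :: int where "x = of_int j * b" "a i = of_int k * b" using assms(1) by blast
  then have "x + a i = of_int (j + k) * b" by (simp add: algebra_simps)
  then show ?case by blast
qed

text \<open>
  If \<open>x\<close> and \<open>y\<close> differ by \<open>d\<close>, then \<open>q y + j d = (q - j) y + j x\<close> belongs to the semigroup for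
  all \<open>j \<le> q\<close>; once \<open>q d \<ge> y\<close> these points leave no gap of length \<open>d\<close>.
\<close>

lemma shift_semigroup_dense:
  assumes xy: "x \<in> shift_semigroup I a" "y \<in> shift_semigroup I a" "x - y = d"
    and "0 < d" "0 < y"
  shows "\<exists>x0. \<forall>u\<ge>x0. \<exists>\<sigma>\<in>shift_semigroup I a. u \<le> \<sigma> \<and> \<sigma> < u + d"
proof (intro exI allI impI)
  fix u assume u: "(y / d + 2) * y \<le> u"
  define q where "q = nat \<lfloor>u / y\<rfloor>"
  have "y / d + 2 \<le> u / y" using u assms by (simp add: field_simps)
  moreover have "0 < y / d" using assms by simp
  ultimately have q: "real q \<le> u / y" "u / y < real q + 1" "y / d + 1 \<le> real q"
    unfolding q_def by linarith+
  then have qu: "real q * y \<le> u" "u < real q * y + y" using assms by (auto simp: field_simps)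
  define j where "j = nat \<lceil>(u - real q * y) / d\<rceil>"
  have "0 \<le> (u - real q * y) / d" "(u - real q * y) / d \<le> y / d"
    using qu assms by (auto intro: divide_right_mono)
  then have j: "(u - real q * y) / d \<le> real j" "real j < (u - real q * y) / d + 1" "real j \<le> real q"
    unfolding j_def using q by linarith+
  then have "u \<le> real q * y + real j * d" "real q * y + real j * d < u + d"
    using assms by (auto simp: field_simps)
  moreover have "real q * y + real j * d = real (q - j) * y + real j * x"
    using j(3) xy(3) by (simp add: of_nat_diff algebra_simps flip: xy(3))
  moreover have "real (q - j) * y + real j * x \<in> shift_semigroup I a"
    by (intro shift_semigroup_add shift_semigroup_mult xy)
  ultimately show "\<exists>\<sigma>\<in>shift_semigroup I a. u \<le> \<sigma> \<and> \<sigma> < u + d" by metis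
qed

text \<open>The differences of semigroup elements form a group, which either has arbitrarily small
  positive elements or is cyclic. In the second case the generator is returned as a difference
  \<open>x - y\<close> with \<open>0 < y\<close>, the form in which the gaps of the semigroup itself
  can be bounded.\<close>

lemma shift_semigroup_dichotomy:
  assumes "I \<noteq> {}" "\<And>i. i \<in> I \<Longrightarrow> 0 < a i"
  shows "(\<forall>d>0. \<exists>x0. \<forall>u\<ge>x0. \<exists>\<sigma>\<in>shift_semigroup I a. u \<le> \<sigma> \<and> \<sigma> < u + d) \<or>
    (\<exists>b>0. (\<forall>i\<in>I. \<exists>k::int. a i = of_int k * b) \<and>
      (\<exists>x\<in>shift_semigroup I a. \<exists>y\<in>shift_semigroup I a. 0 < y \<and> x - y = b))"
proof -
  define G where "G = {x - y | x y. x \<in> shift_semigroup I a \<and> y \<in> shift_semigroup I a}"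
  obtain i0 where i0: "i0 \<in> I" using assms(1) by blast
  have nonneg: "0 \<le> x" if "x \<in> shift_semigroup I a" for x
    using that by induction (use assms(2) in \<open>force intro: less_imp_le add_nonneg_pos\<close>)+
  \<comment> \<open>Adding \<open>a i0\<close> to both terms leaves the difference unchanged and
    makes \<open>y\<close> positive.\<close>
  have G_pos: "\<exists>x\<in>shift_semigroup I a. \<exists>y\<in>shift_semigroup I a. 0 < y \<and> x - y = g" if g: "g \<in> G" for g
  proof -
    obtain x y where "x \<in> shift_semigroup I a" "y \<in> shift_semigroup I a" "g = x - y"
      using g unfolding G_def by blast
    then show ?thesis using i0 assms(2)[OF i0] nonneg
      by (intro bexI[of _ "x + a i0"] bexI[of _ "y + a i0"])
        (auto intro: shift_semigroup.step add_nonneg_pos)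
  qed
  show ?thesis
  proof (cases "\<forall>\<eta>>0. \<exists>g\<in>G. 0 < g \<and> g < \<eta>")
    case True
    have "\<exists>x0. \<forall>u\<ge>x0. \<exists>\<sigma>\<in>shift_semigroup I a. u \<le> \<sigma> \<and> \<sigma> < u + d" if d: "0 < d" for d
    proof -
      obtain g where g: "g \<in> G" "0 < g" "g < d" using True d by blast
      obtain x y where "x \<in> shift_semigroup I a" "y \<in> shift_semigroup I a" "0 < y" "x - y = g"
        using G_pos[OF g(1)] by blast
      then obtain x0 where "\<forall>u\<ge>x0. \<exists>\<sigma>\<in>shift_semigroup I a. u \<le> \<sigma> \<and> \<sigma> < u + g"
        using shift_semigroup_dense g(2) by metis
      then show ?thesis using g(3) by (intro exI[of _ x0]) force
    qed
    then show ?thesis by blast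
  next
    case False
    then obtain \<eta> where \<eta>: "0 < \<eta>" "\<And>g. g \<in> G \<Longrightarrow> 0 < g \<Longrightarrow> \<eta> \<le> g" by force
    have gen: "a i \<in> G" if "i \<in> I" for i
      unfolding G_def using that
      by (intro CollectI exI[of _ "a i"] exI[of _ 0])
        (simp add: shift_semigroup_generator shift_semigroup.zero)
    have "g - h \<in> G" if gh: "g \<in> G" "h \<in> G" for g h
    proof -
      obtain x y x' y' where *: "x \<in> shift_semigroup I a" "y \<in> shift_semigroup I a"
        "x' \<in> shift_semigroup I a" "y' \<in> shift_semigroup I a" "g = x - y" "h = x' - y'"
        using gh unfolding G_def by blast
      then have "g - h = (x + y') - (y + x')" by simp
      moreover have "x + y' \<in> shift_semigroup I a" "y + x' \<in> shift_semigroup I a"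
        using * by (auto intro: shift_semigroup_add)
      ultimately show ?thesis unfolding G_def by blast
    qed
    from real_subgroup_cyclic[OF this \<eta> gen[OF i0] assms(2)[OF i0]]
    obtain b where "b \<in> G" "0 < b" "\<And>x. x \<in> G \<Longrightarrow> \<exists>k::int. x = of_int k * b" by metis
    then show ?thesis using gen G_pos by (intro disjI2 exI[of _ b]) blast
  qed
qed

section \<open>The lattice property in terms of the similarity ratios\<close>

lemma potential_range_iff:
  assumes "1 \<le> N"
  shows "potential_range_in N r b \<longleftrightarrow> (\<forall>i\<in>{1..N}. \<exists>k::int. - ln (r i) = of_int k * b)"
proof
  assume L: "potential_range_in N r b"
  show "\<forall>i\<in>{1..N}. \<exists>k::int. - ln (r i) = of_int k * b"
  proof
    fix i assume "i \<in> {1..N}"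
    then have "(\<lambda>_. i) \<in> words N" by (simp add: words_def)
    then have "geometric_potential r (\<lambda>_. i) \<in> range (\<lambda>k::int. b * of_int k)"
      using L by (auto simp: potential_range_in_def)
    then show "\<exists>k::int. - ln (r i) = of_int k * b"
      by (auto simp: geometric_potential_def mult.commute)
  qed
next
  assume R: "\<forall>i\<in>{1..N}. \<exists>k::int. - ln (r i) = of_int k * b"
  show "potential_range_in N r b"
    unfolding potential_range_in_def
  proof
    fix x assume "x \<in> geometric_potential r ` words N"
    then obtain \<omega> where "\<omega> \<in> words N" "x = - ln (r (\<omega> 0))" by (auto simp: geometric_potential_def)
    moreover from \<open>\<omega> \<in> words N\<close> have "\<omega> 0 \<in> {1..N}" by (auto simp: words_def)
    then obtain k :: int where "- ln (r (\<omega> 0)) = of_int k * b" using R by blast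
    ultimately show "x \<in> range (\<lambda>k::int. b * of_int k)" by (auto simp: mult.commute)
  qed
qed

text \<open>The potential serves as its own \<open>\<zeta>\<close>, with \<open>\<psi> = 0\<close>;
  it is continuous because it depends on the first letter alone.\<close>

lemma lattice_IFS_if_range_in:
  assumes "0 < b" "potential_range_in N r b"
  shows "lattice_IFS N r"
proof -
  define G where "G = range (\<lambda>k::int. b * of_int k)"
  have "discrete_subgroup G"
    unfolding discrete_subgroup_def
  proof (intro conjI ballI)
    show "0 \<in> G" unfolding G_def by (rule image_eqI[of _ _ 0]) auto
    fix x assume "x \<in> G"
    then obtain k :: int where k: "x = b * of_int k" by (auto simp: G_def)
    show "- x \<in> G" unfolding G_def k by (rule image_eqI[of _ _ "- k"]) auto
    show "x isolated_in G"
      unfolding isolated_in_dist_Ex_iff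
    proof (intro conjI exI ballI impI)
      fix y assume "y \<in> G" "dist x y < b"
      then obtain j :: int where j: "y = b * of_int j" by (auto simp: G_def)
      have "\<bar>b * of_int (k - j)\<bar> < b"
        using \<open>dist x y < b\<close> by (simp add: j k dist_real_def right_diff_distrib)
      then have "\<bar>of_int (k - j)\<bar> < (1::real)" using assms(1) by (simp add: abs_mult)
      then have "k = j" by linarith
      then show "y = x" by (simp add: j k)
    qed (use \<open>x \<in> G\<close> assms(1) in auto)
    fix y assume "y \<in> G"
    then obtain j :: int where j: "y = b * of_int j" by (auto simp: G_def)
    show "x + y \<in> G" unfolding G_def k j by (rule image_eqI[of _ _ "k + j"]) (auto simp: algebra_simps)
  qed
  moreover have "continuous_on (words N) (geometric_potential r)"
  proof -
    have "continuous_on UNIV (\<lambda>\<omega>::nat \<Rightarrow> nat. \<omega> 0)" by (rule continuous_on_product_coordinates)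
    moreover have "continuous_on UNIV (\<lambda>i. - ln (r i))" by simp
    ultimately have "continuous_on UNIV (\<lambda>\<omega>::nat \<Rightarrow> nat. - ln (r (\<omega> 0)))"
      using continuous_on_compose2 by blast
    then show ?thesis
      unfolding geometric_potential_def by (rule continuous_on_subset) auto
  qed
  moreover have "continuous_on (words N) (\<lambda>_. 0::real)" by simp
  ultimately show ?thesis
    unfolding lattice_IFS_def using assms(2) unfolding potential_range_in_def G_def by fastforce
qed

text \<open>Evaluating the coboundary equation at the constant words shows that \<open>- ln (r i)\<close> itself lies in the subgroup.\<close>

lemma lattice_IFS_imp_range_in:
  assumes "lattice_IFS N r" "1 \<le> N" "\<And>i. i \<in> {1..N} \<Longrightarrow> r i < 1 \<and> 0 < r i"
  obtains b where "0 < b" "potential_range_in N r b"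
proof -
  obtain \<zeta> \<psi> :: "(nat \<Rightarrow> nat) \<Rightarrow> real" and G where *:
    "\<And>\<omega>. \<omega> \<in> words N \<Longrightarrow> geometric_potential r \<omega> - \<zeta> \<omega> = \<psi> \<omega> - \<psi> (left_shift \<omega>)"
    "discrete_subgroup G" "\<zeta> ` words N \<subseteq> G"
    using assms(1) unfolding lattice_IFS_def by blast
  have in_G: "- ln (r i) \<in> G" if "i \<in> {1..N}" for i
  proof -
    have w: "(\<lambda>_. i) \<in> words N" using that by (simp add: words_def)
    then have "- ln (r i) = \<zeta> (\<lambda>_. i)"
      using *(1)[OF w] by (simp add: geometric_potential_def left_shift_def)
    then show ?thesis using *(3) w by auto
  qed
  have "0 isolated_in G" "0 \<in> G" using *(2) by (auto simp: discrete_subgroup_def)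
  then obtain \<eta> where \<eta>: "0 < \<eta>" "\<And>y. y \<in> G \<Longrightarrow> dist 0 y < \<eta> \<Longrightarrow> y = 0"
    unfolding isolated_in_dist_Ex_iff by blast
  have "x - y \<in> G" if "x \<in> G" "y \<in> G" for x y
    using *(2) that unfolding discrete_subgroup_def by (metis diff_conv_add_uminus)
  moreover have "\<eta> \<le> x" if "x \<in> G" "0 < x" for x using \<eta>(2)[OF that(1)] that by (force simp: dist_real_def)
  moreover have "- ln (r 1) \<in> G" "0 < - ln (r 1)" using in_G[of 1] assms(2) assms(3)[of 1] by auto
  ultimately obtain b where "0 < b" "\<And>x. x \<in> G \<Longrightarrow> \<exists>k::int. x = of_int k * b"
    using real_subgroup_cyclic[of G \<eta> "- ln (r 1)"] \<eta>(1) by metis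
  then show ?thesis using that in_G assms(2) by (simp add: potential_range_iff)
qed

lemma nonlattice_dense:
  assumes "\<not> lattice_IFS N r" "1 \<le> N" "\<And>i. i \<in> {1..N} \<Longrightarrow> r i < 1 \<and> 0 < r i" "0 < d"
  shows "\<exists>x0. \<forall>u\<ge>x0. \<exists>\<sigma>\<in>shift_semigroup {1..N} (\<lambda>i. - ln (r i)). u \<le> \<sigma> \<and> \<sigma> \<le> u + d"
proof -
  let ?S = "shift_semigroup {1..N} (\<lambda>i. - ln (r i))"
  have nl: "\<not> (\<exists>b>0. (\<forall>i\<in>{1..N}. \<exists>k::int. - ln (r i) = of_int k * b) \<and>
      (\<exists>x\<in>?S. \<exists>y\<in>?S. 0 < y \<and> x - y = b))"
    using assms(1) lattice_IFS_if_range_in potential_range_iff[OF assms(2)] by blast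
  have "{1..N} \<noteq> {}" "\<And>i. i \<in> {1..N} \<Longrightarrow> 0 < - ln (r i)" using assms(2,3) by auto
  from shift_semigroup_dichotomy[where a="\<lambda>i. - ln (r i)", OF this]
  have "\<forall>d>0. \<exists>x0. \<forall>u\<ge>x0. \<exists>\<sigma>\<in>?S. u \<le> \<sigma> \<and> \<sigma> < u + d"
    by (rule mp[OF iffD1[OF disj_imp iffD1[OF disj_commute]] nl])
  then obtain x0 where "\<forall>u\<ge>x0. \<exists>\<sigma>\<in>?S. u \<le> \<sigma> \<and> \<sigma> < u + d" using assms(4) by blast
  then show ?thesis by (intro exI[of _ x0]) force
qed

text \<open>A semigroup inside the multiples of \<open>b\<close> leaves the interior of each cell
  empty, so the dense alternative is excluded and the group of differences is cyclic.\<close>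

lemma lattice_group_generator:
  assumes "0 < b" "potential_range_in N r b" "1 \<le> N" "\<And>i. i \<in> {1..N} \<Longrightarrow> r i < 1 \<and> 0 < r i"
  obtains c x y where "0 < c" "potential_range_in N r c" "0 < y" "x - y = c"
    "x \<in> shift_semigroup {1..N} (\<lambda>i. - ln (r i))" "y \<in> shift_semigroup {1..N} (\<lambda>i. - ln (r i))"
proof -
  let ?S = "shift_semigroup {1..N} (\<lambda>i. - ln (r i))"
  have mult: "\<exists>k::int. x = of_int k * b" if "x \<in> ?S" for x
    using shift_semigroup_multiples[OF _ that, of b] assms(2,3) by (simp add: potential_range_iff)
  have nd: "\<not> (\<forall>d>0. \<exists>x0. \<forall>u\<ge>x0. \<exists>\<sigma>\<in>?S. u \<le> \<sigma> \<and> \<sigma> < u + d)"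
  proof
    assume "\<forall>d>0. \<exists>x0. \<forall>u\<ge>x0. \<exists>\<sigma>\<in>?S. u \<le> \<sigma> \<and> \<sigma> < u + d"
    then obtain x0 where x0: "\<forall>u\<ge>x0. \<exists>\<sigma>\<in>?S. u \<le> \<sigma> \<and> \<sigma> < u + b / 2"
      using assms(1) by (meson half_gt_zero)
    \<comment> \<open>Starting a quarter of a cell after a multiple of \<open>b\<close>, the window
      of length \<open>b / 2\<close> contains no multiple of \<open>b\<close>.\<close>
    define u where "u = (of_int \<lceil>x0 / b\<rceil> + 1 / 4) * b"
    have "x0 / b \<le> of_int \<lceil>x0 / b\<rceil> + 1 / 4" by linarith
    then have "x0 \<le> u" using assms(1) by (simp add: u_def field_simps)
    then obtain \<sigma> where "\<sigma> \<in> ?S" "u \<le> \<sigma>" "\<sigma> < u + b / 2" using x0 by blast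
    moreover from this obtain k :: int where "\<sigma> = of_int k * b" using mult by blast
    moreover have "u + b / 2 = (of_int \<lceil>x0 / b\<rceil> + 3 / 4) * b" by (simp add: u_def algebra_simps)
    ultimately have "(of_int \<lceil>x0 / b\<rceil> + 1 / 4) * b \<le> real_of_int k * b"
      "real_of_int k * b < (of_int \<lceil>x0 / b\<rceil> + 3 / 4) * b"
      by (simp_all only: u_def)
    then have "of_int \<lceil>x0 / b\<rceil> + 1 / 4 \<le> real_of_int k" "real_of_int k < of_int \<lceil>x0 / b\<rceil> + 3 / 4"
      using assms(1) by (simp_all only: mult_le_cancel_right_pos mult_less_cancel_right_pos)
    then have "\<lceil>x0 / b\<rceil> < k" "k < \<lceil>x0 / b\<rceil> + 1" by linarith+
    then show False by simp
  qed
  have "{1..N} \<noteq> {}" "\<And>i. i \<in> {1..N} \<Longrightarrow> 0 < - ln (r i)" using assms(3,4) by auto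
  from mp[OF iffD1[OF disj_imp shift_semigroup_dichotomy[where a="\<lambda>i. - ln (r i)", OF this]] nd]
  have "\<exists>c>0. (\<forall>i\<in>{1..N}. \<exists>k::int. - ln (r i) = of_int k * c) \<and>
    (\<exists>x\<in>?S. \<exists>y\<in>?S. 0 < y \<and> x - y = c)"
    .
  then obtain c where "0 < c" "\<forall>i\<in>{1..N}. \<exists>k::int. - ln (r i) = of_int k * c"
    "\<exists>x\<in>?S. \<exists>y\<in>?S. 0 < y \<and> x - y = c"
    by blast
  then show ?thesis using that potential_range_iff[OF assms(3)] by blast
qed

text \<open>A difference of two semigroup elements is an integer multiple of every constant that
  divides all steps. So a dividing constant that is itself such a difference is the largest
  one.\<close>

lemma generator_ge_if_range_in:
  assumes "0 < b" "potential_range_in N r b" "1 \<le> N" "0 < c" "x - y = c"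
    "x \<in> shift_semigroup {1..N} (\<lambda>i. - ln (r i))" "y \<in> shift_semigroup {1..N} (\<lambda>i. - ln (r i))"
  shows "b \<le> c"
proof -
  obtain j k :: int where jk: "x = of_int j * b" "y = of_int k * b"
    using shift_semigroup_multiples[of "{1..N}" "\<lambda>i. - ln (r i)" b] assms
    by (metis potential_range_iff)
  then have c: "c = of_int (j - k) * b" using assms(5) by (simp add: algebra_simps)
  then have "0 < j - k" using assms(1,4) by (simp add: zero_less_mult_iff)
  then have "1 * b \<le> of_int (j - k) * b" using assms(1) by (intro mult_right_mono) auto
  then show ?thesis using c by simp
qed

lemma maximal_lattice_const_exists:
  assumes "lattice_IFS N r" "1 \<le> N" "\<And>i. i \<in> {1..N} \<Longrightarrow> r i < 1 \<and> 0 < r i"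
  shows "\<exists>a. maximal_lattice_const N r a"
proof -
  obtain b where "0 < b" "potential_range_in N r b" using lattice_IFS_imp_range_in[OF assms] .
  from lattice_group_generator[OF this assms(2,3)] obtain c x y where
    "0 < c" "potential_range_in N r c" "x - y = c"
    "x \<in> shift_semigroup {1..N} (\<lambda>i. - ln (r i))" "y \<in> shift_semigroup {1..N} (\<lambda>i. - ln (r i))"
    by metis
  then show ?thesis
    unfolding maximal_lattice_const_def using generator_ge_if_range_in assms(2) by blast
qed

text \<open>Maximality identifies \<open>a\<close> with the generator of the group of differences.
  From some point on every half-open interval from \<open>k * a\<close> to
  \<open>(k + 1) * a\<close> contains an element of the semigroup, and the only candidate is
  \<open>k * a\<close>.\<close>

lemma maximal_lattice_const_semigroup:
  assumes a: "maximal_lattice_const N r a"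
    and "1 \<le> N" "\<And>i. i \<in> {1..N} \<Longrightarrow> r i < 1 \<and> 0 < r i"
  obtains m k0 where "\<And>i. i \<in> {1..N} \<Longrightarrow> - ln (r i) = real (m i) * a"
    "\<And>k. k0 \<le> k \<Longrightarrow> real k * a \<in> shift_semigroup {1..N} (\<lambda>i. - ln (r i))"
proof -
  let ?S = "shift_semigroup {1..N} (\<lambda>i. - ln (r i))"
  have a0: "0 < a" and ra: "potential_range_in N r a" using a by (auto simp: maximal_lattice_const_def)
  obtain c x y where c: "0 < c" "potential_range_in N r c" "0 < y" "x - y = c" "x \<in> ?S" "y \<in> ?S"
    by (rule lattice_group_generator[OF a0 ra assms(2,3)])
  have "c = a"
    using generator_ge_if_range_in[OF a0 ra assms(2) c(1,4,5,6)] a c(1,2)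
    by (auto simp: maximal_lattice_const_def intro: antisym)
  then obtain x0 where x0: "\<forall>u\<ge>x0. \<exists>\<sigma>\<in>?S. u \<le> \<sigma> \<and> \<sigma> < u + a"
    using shift_semigroup_dense[OF c(5,6,4,1,3)] by blast
  have mult: "\<exists>k::int. x = of_int k * a" if "x \<in> ?S" for x
    using shift_semigroup_multiples[OF _ that, of a] ra assms(2) by (simp add: potential_range_iff)
  have "real k * a \<in> ?S" if k: "nat \<lceil>x0 / a\<rceil> \<le> k" for k
  proof -
    have "x0 / a \<le> real k" using k by linarith
    then have "x0 \<le> real k * a" using a0 by (simp add: field_simps)
    then obtain \<sigma> where \<sigma>: "\<sigma> \<in> ?S" "real k * a \<le> \<sigma>" "\<sigma> < real k * a + a" using x0 by blast
    obtain l :: int where l: "\<sigma> = of_int l * a" using mult[OF \<sigma>(1)] by blast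
    have "real k \<le> of_int l" using \<sigma>(2) l a0 by simp
    moreover have "of_int l * a < (real k + 1) * a" using \<sigma>(3) l by (simp add: algebra_simps)
    then have "of_int l < real k + 1" using a0 by (simp only: mult_less_cancel_right_pos)
    ultimately have "l = int k" by linarith
    then show ?thesis using \<sigma>(1) l by simp
  qed
  moreover have "\<exists>n::nat. - ln (r i) = real n * a" if i: "i \<in> {1..N}" for i
  proof -
    obtain k :: int where k: "- ln (r i) = of_int k * a"
      using ra i potential_range_iff[OF assms(2)] by blast
    have "0 < of_int k * a" using k assms(3)[OF i] by (metis ln_less_zero neg_0_less_iff_less)
    then have "0 < k" using a0 by (simp add: zero_less_mult_iff)
    then show ?thesis using k by (intro exI[of _ "nat k"]) simp
  qed
  then obtain m where "\<And>i. i \<in> {1..N} \<Longrightarrow> - ln (r i) = real (m i) * a" by metis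
  ultimately show ?thesis using that by blast
qed

section \<open>Self-similar sets given by affine maps\<close>

text \<open>The interval is the convex hull of \<open>K\<close>, with both ends in \<open>K\<close>,
  and the similarities are written as affine maps on the whole line. Conformality is recorded for
  compact sets, a class that these maps preserve, so that images of pieces are measurable at
  once.\<close>

locale affine_ifs =
  fixes N :: nat and s b :: "nat \<Rightarrow> real" and K :: "real set" and A B \<delta> :: real and \<nu> :: "real measure"
  assumes N_ge: "2 \<le> N"
    and s_nz: "i \<in> {1..N} \<Longrightarrow> s i \<noteq> 0"
    and s_lt: "i \<in> {1..N} \<Longrightarrow> \<bar>s i\<bar> < 1"
    and AB: "A < B" "A \<in> K" "B \<in> K" "K \<subseteq> {A..B}" "compact K"
    and K_eq: "K = (\<Union>i\<in>{1..N}. (\<lambda>x. s i * x + b i) ` K)"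
    and open_disj: "i \<in> {1..N} \<Longrightarrow> j \<in> {1..N} \<Longrightarrow> i \<noteq> j \<Longrightarrow>
      (\<lambda>x. s i * x + b i) ` {A<..<B} \<inter> (\<lambda>x. s j * x + b j) ` {A<..<B} = {}"
    and prob: "prob_space \<nu>"
    and sets_nu: "sets \<nu> = sets borel"
    and nu_K: "measure \<nu> K = 1"
    and nu_overlap: "i \<in> {1..N} \<Longrightarrow> j \<in> {1..N} \<Longrightarrow> i \<noteq> j \<Longrightarrow>
      measure \<nu> ((\<lambda>x. s i * x + b i) ` {A..B} \<inter> (\<lambda>x. s j * x + b j) ` {A..B}) = 0"
    and nu_conf: "i \<in> {1..N} \<Longrightarrow> compact C \<Longrightarrow> C \<subseteq> {A..B} \<Longrightarrow>
      measure \<nu> ((\<lambda>x. s i * x + b i) ` C) = \<bar>s i\<bar> powr \<delta> * measure \<nu> C"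
    and null_K: "emeasure lborel K = 0"
begin

sublocale prob_space \<nu> by (rule prob)

section \<open>Words, pieces and their order on the line\<close>

definition S :: "nat \<Rightarrow> real \<Rightarrow> real" where "S i x = s i * x + b i"

primrec sw :: "nat list \<Rightarrow> real" where
  "sw [] = 1"
| "sw (i # w) = s i * sw w"

primrec Sw :: "nat list \<Rightarrow> real \<Rightarrow> real" where
  "Sw [] = (\<lambda>x. x)"
| "Sw (i # w) = (\<lambda>x. S i (Sw w x))"

definition W :: "nat \<Rightarrow> nat list set" where "W m = {w. set w \<subseteq> {1..N} \<and> length w = m}"

definition lw :: "nat list \<Rightarrow> real" where "lw w = min (Sw w A) (Sw w B)"
definition uw :: "nat list \<Rightarrow> real" where "uw w = max (Sw w A) (Sw w B)"

lemma K_ne: "K \<noteq> {}"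
  using AB by auto

lemma finite_W: "finite (W m)" and card_W: "card (W m) = N ^ m"
  unfolding W_def using finite_lists_length_eq[of "{1..N}" m] card_lists_length_eq[of "{1..N}" m] by auto

lemma W_ne: "W m \<noteq> {}"
  using card_W[of m] N_ge by auto

lemma Sw_affine: "Sw w x = sw w * x + Sw w 0"
proof (induction w arbitrary: x)
  case (Cons i w)
  show ?case by (simp only: Sw.simps sw.simps S_def Cons[of x]) (simp add: algebra_simps)
qed simp

lemma sw_nz: "set w \<subseteq> {1..N} \<Longrightarrow> sw w \<noteq> 0"
  by (induction w) (auto simp: s_nz)

lemma Sw_diff: "Sw w x - Sw w y = sw w * (x - y)"
  using Sw_affine[of w x] Sw_affine[of w y] by (simp add: algebra_simps)

lemma Sw_continuous: "continuous_on X (Sw w)"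
proof -
  have "continuous_on X (\<lambda>x. sw w * x + Sw w 0)" by (intro continuous_intros)
  then show ?thesis by (simp flip: Sw_affine)
qed

lemma Sw_inj: "set w \<subseteq> {1..N} \<Longrightarrow> Sw w x = Sw w y \<Longrightarrow> x = y"
  using Sw_diff[of w x y] sw_nz[of w] by simp

lemma compact_Sw: "compact C \<Longrightarrow> compact (Sw w ` C)"
  by (intro compact_continuous_image Sw_continuous)

lemma lw_le: "x \<in> {A..B} \<Longrightarrow> Sw w x \<in> {lw w..uw w}"
proof -
  assume x: "x \<in> {A..B}"
  then have "0 \<le> (x - A) * (B - x)" by (intro mult_nonneg_nonneg) auto
  show ?thesis
  proof (cases "0 \<le> sw w")
    case True
    then have "0 \<le> sw w * (x - A)" "0 \<le> sw w * (B - x)" using x by auto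
    then show ?thesis using Sw_diff[of w x A] Sw_diff[of w B x] by (auto simp: lw_def uw_def)
  next
    case False
    then have "sw w * (x - A) \<le> 0" "sw w * (B - x) \<le> 0" using x by (auto simp: mult_nonpos_nonneg)
    then show ?thesis using Sw_diff[of w x A] Sw_diff[of w B x] by (auto simp: lw_def uw_def)
  qed
qed

lemma lw_in: "lw w \<in> Sw w ` K" "uw w \<in> Sw w ` K"
  using AB by (auto simp: lw_def uw_def min_def max_def)

lemma Sw_Icc:
  assumes "set w \<subseteq> {1..N}"
  shows "Sw w ` {A..B} = {lw w..uw w}" "Sw w ` {A<..<B} = {lw w<..<uw w}"
    "uw w - lw w = \<bar>sw w\<bar> * (B - A)" "lw w < uw w"
proof -
  have nz: "sw w \<noteq> 0" using sw_nz[OF assms] .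
  have pre: "\<exists>x. y = Sw w x" for y
    using nz Sw_affine[of w "(y - Sw w 0) / sw w"] by (intro exI[of _ "(y - Sw w 0) / sw w"]) simp
  show len: "uw w - lw w = \<bar>sw w\<bar> * (B - A)"
  proof -
    have "uw w - lw w = \<bar>Sw w B - Sw w A\<bar>" by (auto simp: uw_def lw_def)
    then show ?thesis using AB(1) by (simp add: Sw_diff abs_mult)
  qed
  have "0 < \<bar>sw w\<bar> * (B - A)" using nz AB(1) by simp
  then show "lw w < uw w" using len by linarith
  have iff: "Sw w x \<in> {lw w..uw w} \<longleftrightarrow> x \<in> {A..B}" "Sw w x \<in> {lw w<..<uw w} \<longleftrightarrow> x \<in> {A<..<B}" for x
  proof -
    have d: "Sw w x - Sw w A = sw w * (x - A)" "Sw w B - Sw w x = sw w * (B - x)"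
      "Sw w B - Sw w A = sw w * (B - A)" by (rule Sw_diff)+
    have "(Sw w x \<in> {lw w..uw w} \<longleftrightarrow> x \<in> {A..B}) \<and> (Sw w x \<in> {lw w<..<uw w} \<longleftrightarrow> x \<in> {A<..<B})"
    proof (cases "0 < sw w")
      case True
      then have "lw w = Sw w A" "uw w = Sw w B"
        using d(3) mult_pos_pos[OF True, of "B - A"] AB(1) unfolding lw_def uw_def by linarith+
      moreover have "0 \<le> Sw w x - Sw w A \<longleftrightarrow> 0 \<le> x - A" "0 \<le> Sw w B - Sw w x \<longleftrightarrow> 0 \<le> B - x"
        "0 < Sw w x - Sw w A \<longleftrightarrow> 0 < x - A" "0 < Sw w B - Sw w x \<longleftrightarrow> 0 < B - x"
        unfolding d using True by (simp_all add: zero_le_mult_iff zero_less_mult_iff)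
      ultimately show ?thesis by auto
    next
      case False
      then have neg: "sw w < 0" using nz by simp
      then have "lw w = Sw w B" "uw w = Sw w A"
        using d(3) mult_neg_pos[OF neg, of "B - A"] AB(1) unfolding lw_def uw_def by linarith+
      moreover have "0 \<le> Sw w x - Sw w A \<longleftrightarrow> x - A \<le> 0" "0 \<le> Sw w B - Sw w x \<longleftrightarrow> B - x \<le> 0"
        "0 < Sw w x - Sw w A \<longleftrightarrow> x - A < 0" "0 < Sw w B - Sw w x \<longleftrightarrow> B - x < 0"
        "Sw w x - Sw w A \<le> 0 \<longleftrightarrow> 0 \<le> x - A" "Sw w B - Sw w x \<le> 0 \<longleftrightarrow> 0 \<le> B - x"
        "Sw w x - Sw w A < 0 \<longleftrightarrow> 0 < x - A" "Sw w B - Sw w x < 0 \<longleftrightarrow> 0 < B - x"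
        unfolding d using neg
        by (simp_all add: zero_le_mult_iff zero_less_mult_iff mult_le_0_iff mult_less_0_iff not_less not_le)
      ultimately show ?thesis by auto
    qed
    then show "Sw w x \<in> {lw w..uw w} \<longleftrightarrow> x \<in> {A..B}" "Sw w x \<in> {lw w<..<uw w} \<longleftrightarrow> x \<in> {A<..<B}" by auto
  qed
  have surj: "surj (Sw w)" using pre by (simp add: surj_def)
  have "Sw w -` {lw w..uw w} = {A..B}" "Sw w -` {lw w<..<uw w} = {A<..<B}"
    using iff by (intro set_eqI; simp only: vimage_eq)+
  then show "Sw w ` {A..B} = {lw w..uw w}" "Sw w ` {A<..<B} = {lw w<..<uw w}"
    using surj_image_vimage_eq[OF surj] by metis+
qed

lemma W_Suc: "W (Suc m) = (\<lambda>(i, w). i # w) ` ({1..N} \<times> W m)"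
  by (auto simp: W_def image_iff length_Suc_conv) 

lemma K_words: "K = (\<Union>w\<in>W m. Sw w ` K)"
proof (induction m)
  case 0
  then show ?case by (simp add: W_def)
next
  case (Suc m)
  have "K = (\<Union>i\<in>{1..N}. S i ` K)" using K_eq by (simp add: S_def)
  also have "\<dots> = (\<Union>i\<in>{1..N}. S i ` (\<Union>w\<in>W m. Sw w ` K))" using Suc by simp
  also have "\<dots> = (\<Union>i\<in>{1..N}. \<Union>w\<in>W m. S i ` Sw w ` K)" by (simp only: image_UN)
  also have "\<dots> = (\<Union>p\<in>{1..N} \<times> W m. S (fst p) ` Sw (snd p) ` K)"
  proof -
    have "(\<Union>i\<in>X. \<Union>w\<in>Y. T i w) = (\<Union>p\<in>X \<times> Y. T (fst p) (snd p))"
      for X :: "nat set" and Y :: "nat list set" and T :: "nat \<Rightarrow> nat list \<Rightarrow> real set"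
      by fastforce
    then show ?thesis .
  qed
  also have "\<dots> = (\<Union>w\<in>W (Suc m). Sw w ` K)"
    by (simp add: W_Suc image_image split_beta)
  finally show ?case .
qed

lemma S_maps: "i \<in> {1..N} \<Longrightarrow> S i ` {A..B} \<subseteq> {A..B}"
proof -
  assume i: "i \<in> {1..N}"
  have "S i = Sw [i]" by (simp add: fun_eq_iff)
  moreover have "Sw [i] ` K \<subseteq> K" by (subst (2) K_eq) (use i in \<open>auto simp: S_def\<close>)
  then have "lw [i] \<in> {A..B}" "uw [i] \<in> {A..B}" using lw_in[of "[i]"] AB(4) by blast+
  ultimately show ?thesis using lw_le[of _ "[i]"] by fastforce
qed

lemma S_maps_open: "i \<in> {1..N} \<Longrightarrow> S i ` {A<..<B} \<subseteq> {A<..<B}"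
proof -
  assume i: "i \<in> {1..N}"
  have eq: "S i = Sw [i]" by (simp add: fun_eq_iff)
  have "{lw [i]..uw [i]} \<subseteq> {A..B}" using S_maps[OF i] Sw_Icc(1)[of "[i]"] i
    by (simp del: Sw.simps add: eq)
  then show ?thesis using Sw_Icc(2,4)[of "[i]"] i
    by (simp del: Sw.simps add: eq greaterThanLessThan_subseteq_greaterThanLessThan)
qed

lemma Sw_maps:
  assumes "set w \<subseteq> {1..N}"
  shows "Sw w ` {A..B} \<subseteq> {A..B}" "Sw w ` {A<..<B} \<subseteq> {A<..<B}" "Sw w ` K \<subseteq> K"
proof -
  have "Sw w ` {A..B} \<subseteq> {A..B} \<and> Sw w ` {A<..<B} \<subseteq> {A<..<B} \<and> Sw w ` K \<subseteq> K"
    using assms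
  proof (induction w)
    case (Cons i w)
    have "S i ` K \<subseteq> K" by (subst (2) K_eq) (use Cons in \<open>auto simp: S_def\<close>)
    then show ?case using Cons S_maps[of i] S_maps_open[of i] by (simp add: image_subset_iff)
  qed simp
  then show "Sw w ` {A..B} \<subseteq> {A..B}" "Sw w ` {A<..<B} \<subseteq> {A<..<B}" "Sw w ` K \<subseteq> K" by auto
qed

lemma Sw_open_disj:
  assumes "set w \<subseteq> {1..N}" "set v \<subseteq> {1..N}" "length w = length v" "w \<noteq> v"
  shows "Sw w ` {A<..<B} \<inter> Sw v ` {A<..<B} = {}"
  using assms
proof (induction w arbitrary: v)
  case (Cons i w)
  then obtain j u where v: "v = j # u" by (cases v) auto
  show ?case
  proof (cases "i = j")
    case True
    then have "Sw w ` {A<..<B} \<inter> Sw u ` {A<..<B} = {}" using Cons v by auto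
    moreover have "S i x = S i y \<Longrightarrow> x = y" for x y
      using Sw_inj[of "[i]" x y] Cons.prems(1) by simp
    ultimately show ?thesis using v True by (fastforce simp: image_iff)
  next
    case False
    then have "S i ` {A<..<B} \<inter> S j ` {A<..<B} = {}"
      using open_disj[of i j] Cons.prems v by (simp add: S_def[abs_def])
    moreover have "Sw (i # w) ` {A<..<B} \<subseteq> S i ` {A<..<B}" "Sw (j # u) ` {A<..<B} \<subseteq> S j ` {A<..<B}"
      using Sw_maps(2)[of w] Sw_maps(2)[of u] Cons.prems v by (auto simp: image_subset_iff)
    ultimately show ?thesis unfolding v by blast
  qed
qed simp

lemma W_ordered:
  assumes "w \<in> W m" "v \<in> W m" "w \<noteq> v"
  shows "uw w \<le> lw v \<or> uw v \<le> lw w"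
proof (rule ccontr)
  assume "\<not> ?thesis"
  then have "max (lw w) (lw v) < min (uw w) (uw v)"
    using Sw_Icc(4)[of w] Sw_Icc(4)[of v] assms by (auto simp: W_def)
  then obtain z where "max (lw w) (lw v) < z" "z < min (uw w) (uw v)" using dense by blast
  then have "z \<in> {lw w<..<uw w} \<inter> {lw v<..<uw v}" by auto
  then show False
    using Sw_open_disj[of w v] Sw_Icc(2)[of w] Sw_Icc(2)[of v] assms by (auto simp: W_def)
qed

section \<open>Masses of the pieces\<close>

lemma nu_Sw:
  assumes "set w \<subseteq> {1..N}" "compact C" "C \<subseteq> {A..B}"
  shows "measure \<nu> (Sw w ` C) = \<bar>sw w\<bar> powr \<delta> * measure \<nu> C"
  using assms(1)
proof (induction w)
  case (Cons i w)
  have "measure \<nu> (S i ` (Sw w ` C)) = \<bar>s i\<bar> powr \<delta> * measure \<nu> (Sw w ` C)"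
    unfolding S_def[abs_def]
    using Cons assms Sw_maps(1)[of w] by (intro nu_conf compact_Sw) auto
  then show ?case using Cons by (simp add: image_image abs_mult powr_mult)
qed simp

text \<open>A common first letter is stripped by conformality; where the words first differ, the
  overlap lies in that of two first-level intervals.\<close>

lemma nu_Sw_overlap:
  assumes "set w \<subseteq> {1..N}" "set v \<subseteq> {1..N}" "length w = length v" "w \<noteq> v"
  shows "measure \<nu> (Sw w ` {A..B} \<inter> Sw v ` {A..B}) = 0"
  using assms
proof (induction w arbitrary: v)
  case (Cons i w)
  then obtain j u where v: "v = j # u" by (cases v) auto
  show ?case
  proof (cases "i = j")
    case True
    let ?C = "Sw w ` {A..B} \<inter> Sw u ` {A..B}"
    have "inj (S i)"
      using Sw_inj[of "[i]"] Cons.prems(1) by (auto intro: injI)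
    then have "Sw (i # w) ` {A..B} \<inter> Sw v ` {A..B} = S i ` ?C"
      using v True by (simp add: image_Int image_image)
    moreover have "measure \<nu> (S i ` ?C) = \<bar>s i\<bar> powr \<delta> * measure \<nu> ?C"
      unfolding S_def[abs_def]
      using Cons.prems Sw_maps(1)[of w] by (intro nu_conf compact_Int compact_Sw) auto
    moreover have "measure \<nu> ?C = 0" using Cons v True by auto
    ultimately show ?thesis by simp
  next
    case False
    have "measure \<nu> (Sw (i # w) ` {A..B} \<inter> Sw v ` {A..B}) \<le> measure \<nu> (S i ` {A..B} \<inter> S j ` {A..B})"
    proof (rule finite_measure_mono)
      show "Sw (i # w) ` {A..B} \<inter> Sw v ` {A..B} \<subseteq> S i ` {A..B} \<inter> S j ` {A..B}"
        using Sw_maps(1)[of w] Sw_maps(1)[of u] Cons.prems v by (auto simp: image_subset_iff)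
      have "compact (S k ` {A..B})" for k
        using compact_Sw[of "{A..B}" "[k]"] by simp
      then show "S i ` {A..B} \<inter> S j ` {A..B} \<in> sets \<nu>"
        by (simp add: sets_nu borel_compact compact_Int)
    qed
    also have "\<dots> = 0" using nu_overlap[of i j] Cons.prems v False by (simp add: S_def[abs_def])
    finally show ?thesis by (simp add: measure_le_0_iff)
  qed
qed simp

definition pw :: "nat list \<Rightarrow> real" where "pw w = \<bar>sw w\<bar> powr \<delta>"

lemma nu_piece: "w \<in> W m \<Longrightarrow> measure \<nu> (Sw w ` K) = pw w"
  using nu_Sw[of w K] AB nu_K by (simp add: W_def pw_def)

lemma sets_compact: "compact C \<Longrightarrow> C \<in> sets \<nu>"
  by (simp add: sets_nu borel_compact)

lemma integral_pieces:
  fixes f :: "real \<Rightarrow> real"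
  assumes "set_integrable \<nu> K f"
  shows "(LINT x:K|\<nu>. f x) = (\<Sum>w\<in>W m. LINT x:(Sw w ` K)|\<nu>. f x)"
    "w \<in> W m \<Longrightarrow> set_integrable \<nu> (Sw w ` K) f"
proof -
  show int: "set_integrable \<nu> (Sw w ` K) f" if "w \<in> W m" for w
    using assms Sw_maps(3)[of w] that compact_Sw[OF AB(5)]
    by (intro set_integrable_subset[OF assms]) (auto simp: W_def sets_compact)
  have "(LINT x:(\<Union>w\<in>W m. Sw w ` K)|\<nu>. f x) = (\<Sum>w\<in>W m. LINT x:(Sw w ` K)|\<nu>. f x)"
  proof (rule set_integral_finite_UN_AE)
    fix w v assume wv: "w \<in> W m" "v \<in> W m"
    show "AE x in \<nu>. x \<in> Sw w ` K \<and> x \<in> Sw v ` K \<longrightarrow> w = v"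
    proof (cases "w = v")
      case False
      let ?C = "Sw w ` {A..B} \<inter> Sw v ` {A..B}"
      have "measure \<nu> ?C = 0" using nu_Sw_overlap[of w v] wv False by (auto simp: W_def)
      moreover have "?C \<in> sets \<nu>" by (intro sets_compact compact_Int compact_Sw) auto
      ultimately have "?C \<in> null_sets \<nu>" by (auto simp: null_sets_def emeasure_eq_measure)
      then have "AE x in \<nu>. x \<notin> ?C" by (rule AE_not_in)
      then show ?thesis by eventually_elim (use AB(4) in auto)
    qed simp
  qed (use int finite_W compact_Sw AB sets_compact in auto)
  then show "(LINT x:K|\<nu>. f x) = (\<Sum>w\<in>W m. LINT x:(Sw w ` K)|\<nu>. f x)"
    using K_words by metis
qed


lemma integrable_const_piece: "compact C \<Longrightarrow> set_integrable \<nu> C (\<lambda>_. c::real)"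
  unfolding set_integrable_def using sets_compact[of C]
  by (intro integrable_scaleR_left) (simp add: integrable_real_indicator emeasure_eq_measure)

text \<open>The pieces of level \<open>m\<close> overlap in null sets and the piece of
  \<open>w\<close> has mass \<open>pw w\<close>, so weighted sums over words act as lower sums for
  the integral.\<close>

lemma sum_pw_le_integral:
  fixes f :: "real \<Rightarrow> real"
  assumes f: "set_integrable \<nu> K f" and q: "\<And>w y. w \<in> W m \<Longrightarrow> y \<in> Sw w ` K \<Longrightarrow> q w \<le> f y"
  shows "(\<Sum>w\<in>W m. pw w * q w) \<le> (LINT x:K|\<nu>. f x)"
  unfolding integral_pieces(1)[OF f, of m]
proof (rule sum_mono)
  fix w assume w: "w \<in> W m"
  have c: "compact (Sw w ` K)" using compact_Sw AB by blast
  have "pw w * q w = (LINT x:(Sw w ` K)|\<nu>. q w)"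
    unfolding set_lebesgue_integral_def using sets_compact[OF c] nu_piece[OF w] by simp
  also have "\<dots> \<le> (LINT x:(Sw w ` K)|\<nu>. f x)"
    by (intro set_integral_mono integrable_const_piece c integral_pieces(2)[OF f w] q[OF w])
  finally show "pw w * q w \<le> (LINT x:(Sw w ` K)|\<nu>. f x)" .
qed

lemma integral_le_sum_pw:
  fixes f :: "real \<Rightarrow> real"
  assumes f: "set_integrable \<nu> K f" and q: "\<And>w y. w \<in> W m \<Longrightarrow> y \<in> Sw w ` K \<Longrightarrow> f y \<le> q w"
  shows "(LINT x:K|\<nu>. f x) \<le> (\<Sum>w\<in>W m. pw w * q w)"
proof -
  have "set_integrable \<nu> K (\<lambda>x. - f x)" using f by (simp add: set_integrable_def)
  from sum_pw_le_integral[OF this, of m "\<lambda>w. - q w"] q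
  have "(\<Sum>w\<in>W m. pw w * - q w) \<le> (LINT x:K|\<nu>. - f x)" by simp
  then show ?thesis using f by (simp add: set_lebesgue_integral_def sum_negf)
qed

lemma sum_pw: "(\<Sum>w\<in>W m. pw w) = 1"
proof -
  have "set_integrable \<nu> K (\<lambda>_. 1::real)" using integrable_const_piece AB by blast
  moreover have "(LINT x:K|\<nu>. 1) = (1::real)"
    unfolding set_lebesgue_integral_def using sets_compact[OF AB(5)] nu_K by simp
  ultimately show ?thesis
    using sum_pw_le_integral[of "\<lambda>_. 1" m "\<lambda>_. 1"] integral_le_sum_pw[of "\<lambda>_. 1" m "\<lambda>_. 1"] by simp
qed

definition p :: "nat \<Rightarrow> real" where "p i = \<bar>s i\<bar> powr \<delta>"

lemma p_pos: "i \<in> {1..N} \<Longrightarrow> 0 < p i"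
  using s_nz by (simp add: p_def)

text \<open>Moran's equation, from the masses of the words of length 1. It ties
  \<open>\<delta>\<close> to the ratios and makes the renewal weights a probability vector.\<close>

lemma sum_p: "sum p {1..N} = 1"
proof -
  have "W 1 = (\<lambda>i. [i]) ` {1..N}" by (auto simp: W_def length_Suc_conv)
  then have "(\<Sum>w\<in>W 1. pw w) = (\<Sum>i\<in>{1..N}. pw [i])"
    by (simp add: sum.reindex inj_on_def)
  then show ?thesis using sum_pw[of 1] by (simp add: pw_def p_def)
qed

lemma delta_pos: "0 < \<delta>"
proof (rule ccontr)
  assume "\<not> 0 < \<delta>"
  then have "1 \<le> p i" if "i \<in> {1..N}" for i
    using s_lt[OF that] s_nz[OF that] powr_mono'[of \<delta> 0 "\<bar>s i\<bar>"] by (simp add: p_def)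
  then have "(\<Sum>i\<in>{1..N}. 1) \<le> sum p {1..N}" by (intro sum_mono) auto
  then show False using sum_p N_ge by simp
qed

section \<open>The renewal equation of the volume\<close>

abbreviation V :: "real \<Rightarrow> real" where "V \<equiv> tube K"

lemma tube_affine_Sw:
  assumes "set w \<subseteq> {1..N}"
  shows "tube (Sw w ` K) \<epsilon> = \<bar>sw w\<bar> * V (\<epsilon> / \<bar>sw w\<bar>)"
proof -
  have "Sw w = (\<lambda>x. sw w * x + Sw w 0)" by (rule ext) (rule Sw_affine)
  then have "tube (Sw w ` K) \<epsilon> = tube ((\<lambda>x. sw w * x + Sw w 0) ` K) \<epsilon>" by metis
  then show ?thesis using tube_affine_image[OF AB(5) K_ne sw_nz[OF assms]] by simp
qed

text \<open>The equation is kept exact, with the gaps between the first-level pieces as data: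
  besides the inequalities drawn from it, the lattice case uses that the gap terms are piecewise
  affine with kinks at half the gaps.\<close>

lemma V_renewal:
  obtains ds where "length ds = N - 1" "\<And>d. d \<in> set ds \<Longrightarrow> 0 \<le> d"
    "\<And>\<epsilon>. 0 \<le> \<epsilon> \<Longrightarrow> V \<epsilon> = (\<Sum>i\<in>{1..N}. \<bar>s i\<bar> * V (\<epsilon> / \<bar>s i\<bar>)) - 2 * (real N - 1) * \<epsilon>
       + (\<Sum>d\<leftarrow>ds. min (2 * \<epsilon>) d)"
proof -
  have *: "\<exists>ds. length ds = card {1..N} - 1 \<and> (\<forall>d\<in>set ds. 0 \<le> d) \<and>
    (\<forall>\<epsilon>\<ge>0. tube (\<Union>i\<in>{1..N}. Sw [i] ` K) \<epsilon> =
       (\<Sum>i\<in>{1..N}. tube (Sw [i] ` K) \<epsilon>) - 2 * (real (card {1..N}) - 1) * \<epsilon> + (\<Sum>d\<leftarrow>ds. min (2 * \<epsilon>) d))"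
  proof (rule tube_UN_ordered[where l="\<lambda>i. lw [i]" and u="\<lambda>i. uw [i]"])
    fix i assume i: "i \<in> {1..N}"
    then show "compact (Sw [i] ` K) \<and> Sw [i] ` K \<subseteq> {lw [i]..uw [i]} \<and> lw [i] \<in> Sw [i] ` K \<and>
      uw [i] \<in> Sw [i] ` K \<and> lw [i] < uw [i]"
      using compact_Sw[OF AB(5)] lw_in[of "[i]"] Sw_Icc(1,4)[of "[i]"] AB(4) by (auto simp del: Sw.simps)
    fix j assume "j \<in> {1..N}" "i \<noteq> j"
    then show "uw [i] \<le> lw [j] \<or> uw [j] \<le> lw [i]" using W_ordered[of "[i]" 1 "[j]"] i by (simp add: W_def)
  qed (use N_ge in auto)
  have U: "(\<Union>i\<in>{1..N}. Sw [i] ` K) = K" using K_eq by (simp add: S_def)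
  have T: "tube (Sw [i] ` K) \<epsilon> = \<bar>s i\<bar> * V (\<epsilon> / \<bar>s i\<bar>)" if "i \<in> {1..N}" for i \<epsilon>
    using tube_affine_Sw[of "[i]"] that by simp
  from * obtain ds where ds: "length ds = card {1..N} - 1 \<and> (\<forall>d\<in>set ds. 0 \<le> d) \<and>
    (\<forall>\<epsilon>\<ge>0. tube (\<Union>i\<in>{1..N}. Sw [i] ` K) \<epsilon> =
       (\<Sum>i\<in>{1..N}. tube (Sw [i] ` K) \<epsilon>) - 2 * (real (card {1..N}) - 1) * \<epsilon> + (\<Sum>d\<leftarrow>ds. min (2 * \<epsilon>) d))" ..
  show ?thesis
  proof
    show "length ds = N - 1" using ds by simp
    show "0 \<le> d" if "d \<in> set ds" for d using ds that by blast
    fix \<epsilon> :: real assume "0 \<le> \<epsilon>"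
    have "(\<Sum>i\<in>{1..N}. tube (Sw [i] ` K) \<epsilon>) = (\<Sum>i\<in>{1..N}. \<bar>s i\<bar> * V (\<epsilon> / \<bar>s i\<bar>))"
      by (intro sum.cong refl T)
    then show "V \<epsilon> = (\<Sum>i\<in>{1..N}. \<bar>s i\<bar> * V (\<epsilon> / \<bar>s i\<bar>)) - 2 * (real N - 1) * \<epsilon>
       + (\<Sum>d\<leftarrow>ds. min (2 * \<epsilon>) d)"
      using ds \<open>0 \<le> \<epsilon>\<close> unfolding U by simp
  qed
qed

end

section \<open>Minkowski contents as limits\<close>

text \<open>The density of the Minkowski content at radius \<open>exp (- t)\<close>. In this
  logarithmic scale similarities act as translations.\<close>

definition scaled_tube :: "real \<Rightarrow> real set \<Rightarrow> real \<Rightarrow> real" where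
  "scaled_tube \<delta> Y t = exp ((1 - \<delta>) * t) * tube Y (exp (- t))"

lemma scaled_tube_nonneg: "0 \<le> scaled_tube \<delta> Y t"
  by (simp add: scaled_tube_def tube_nonneg)

text \<open>\<open>c * tube Y (\<epsilon> / c)\<close> is the volume of an affine copy of
  \<open>Y\<close> with ratio \<open>c\<close>, so this is the rule by which copies enter the
  renewal equation and the sums over words.\<close>

lemma exp_mult_tube:
  assumes "0 < c"
  shows "exp ((1 - \<delta>) * t) * (c * tube Y (exp (- t) / c)) = c powr \<delta> * scaled_tube \<delta> Y (t + ln c)"
proof -
  have "exp (- (t + ln c)) = exp (- t) / c"
    using assms by (simp add: exp_diff)
  moreover have "exp ((1 - \<delta>) * (t + ln c)) = exp ((1 - \<delta>) * t) * c powr (1 - \<delta>)"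
    using assms by (simp add: powr_def exp_add[symmetric] algebra_simps)
  moreover have "c powr \<delta> * c powr (1 - \<delta>) = c"
    using assms by (simp add: powr_add[symmetric])
  ultimately show ?thesis by (simp add: scaled_tube_def algebra_simps)
qed

lemma scaled_tube_growth:
  assumes "compact Y" "Y \<noteq> {}" "s \<le> t"
  shows "scaled_tube \<delta> Y t \<le> exp ((1 - \<delta>) * (t - s)) * scaled_tube \<delta> Y s"
proof -
  have "tube Y (exp (- t)) \<le> tube Y (exp (- s))" using assms by (intro tube_mono) auto
  then have "exp ((1 - \<delta>) * t) * tube Y (exp (- t)) \<le> exp ((1 - \<delta>) * t) * tube Y (exp (- s))"
    by (intro mult_left_mono) auto
  also have "\<dots> = exp ((1 - \<delta>) * (t - s)) * scaled_tube \<delta> Y s"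
    by (simp add: scaled_tube_def mult.assoc[symmetric] exp_add[symmetric] algebra_simps)
  finally show ?thesis by (simp add: scaled_tube_def)
qed

lemma continuous_on_min_sum_list:
  fixes ds :: "real list"
  shows "continuous_on X (\<lambda>x. \<Sum>d\<leftarrow>ds. min (2 * x) d)"
  by (induction ds) (auto intro!: continuous_intros)

lemma continuous_on_tube:
  assumes "compact Y" "Y \<noteq> {}"
  shows "continuous_on {0<..} (tube Y)"
proof -
  have "continuous (at x) (tube Y)" if "0 < x" for x
  proof -
    have "0 < x / 2" using that by simp
    from tube_gaps[OF assms this] obtain ds where
      ds: "\<And>\<epsilon>. x / 2 \<le> \<epsilon> \<Longrightarrow> tube Y \<epsilon> = 2 * \<epsilon> + (\<Sum>d\<leftarrow>ds. min (2 * \<epsilon>) d)" by metis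
    have "continuous_on {x / 2..} (\<lambda>\<epsilon>. 2 * \<epsilon> + (\<Sum>d\<leftarrow>ds. min (2 * \<epsilon>) d))"
      by (intro continuous_intros continuous_on_min_sum_list)
    then have "continuous_on {x / 2..} (tube Y)"
      by (rule continuous_on_eq) (use ds in auto)
    then have "continuous_on {x / 2<..} (tube Y)" by (rule continuous_on_subset) auto
    then show ?thesis using that by (simp add: continuous_on_eq_continuous_at)
  qed
  then show ?thesis by (simp add: continuous_on_eq_continuous_at)
qed

lemma continuous_on_scaled_tube:
  assumes "compact Y" "Y \<noteq> {}"
  shows "continuous_on X (scaled_tube \<delta> Y)"
  unfolding scaled_tube_def[abs_def]
  by (intro continuous_intros continuous_on_compose2[OF continuous_on_tube[OF assms]]) auto

lemma filterlim_neg_ln_at_right_0: "filterlim (\<lambda>\<epsilon>. - ln \<epsilon>) at_top (at_right (0::real))"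
  using ln_at_0 by (simp add: filterlim_uminus_at_top)

lemma filterlim_exp_minus_at_right_0: "filterlim (\<lambda>t. exp (- t)) (at_right (0::real)) at_top"
proof -
  have "filterlim exp (at_right (0::real)) at_bot"
    unfolding filterlim_at by (auto intro: exp_at_bot)
  then show ?thesis using filterlim_uminus_at_bot_at_top filterlim_compose by blast
qed

lemma content_density_eq:
  "0 < \<epsilon> \<Longrightarrow> \<epsilon> powr (\<delta> - 1) * measure lborel (parallel_set Y \<epsilon>) = scaled_tube \<delta> Y (- ln \<epsilon>)"
  by (simp add: scaled_tube_def tube_def powr_def algebra_simps)

lemma has_minkowski_content_if_tendsto:
  assumes "(scaled_tube \<delta> Y \<longlongrightarrow> M) at_top"
  shows "has_minkowski_content \<delta> Y (ereal M)"
proof -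
  have "((\<lambda>\<epsilon>. scaled_tube \<delta> Y (- ln \<epsilon>)) \<longlongrightarrow> M) (at_right 0)"
    by (rule filterlim_compose[OF assms filterlim_neg_ln_at_right_0])
  moreover have "\<forall>\<^sub>F \<epsilon> in at_right 0. scaled_tube \<delta> Y (- ln \<epsilon>)
      = \<epsilon> powr (\<delta> - 1) * measure lborel (parallel_set Y \<epsilon>)"
    using eventually_at_right_less[of "0::real"] by eventually_elim (simp add: content_density_eq)
  ultimately have "((\<lambda>\<epsilon>. \<epsilon> powr (\<delta> - 1) * measure lborel (parallel_set Y \<epsilon>)) \<longlongrightarrow> M) (at_right 0)"
    by (rule Lim_transform_eventually)
  then have "((\<lambda>\<epsilon>. ereal (\<epsilon> powr (\<delta> - 1) * measure lborel (parallel_set Y \<epsilon>))) \<longlongrightarrow> ereal M) (at_right 0)"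
    by (intro tendsto_intros)
  then show ?thesis
    unfolding has_minkowski_content_def lower_minkowski_content_def upper_minkowski_content_def
    by (auto intro: lim_imp_Liminf lim_imp_Limsup)
qed

text \<open>A content in the sense of \<open>has_minkowski_content\<close> may be infinite; the
  eventual bound excludes this.\<close>

lemma tendsto_if_has_minkowski_content:
  assumes M: "has_minkowski_content \<delta> Y M" and "\<forall>\<^sub>F t in at_top. scaled_tube \<delta> Y t \<le> b"
  obtains C where "(scaled_tube \<delta> Y \<longlongrightarrow> C) at_top"
proof -
  have "((\<lambda>\<epsilon>. ereal (\<epsilon> powr (\<delta> - 1) * measure lborel (parallel_set Y \<epsilon>))) \<longlongrightarrow> M) (at_right 0)"
    using M unfolding has_minkowski_content_def lower_minkowski_content_def upper_minkowski_content_def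
    by (intro Liminf_eq_Limsup) auto
  then have "((\<lambda>t. ereal (exp (- t) powr (\<delta> - 1) * measure lborel (parallel_set Y (exp (- t))))) \<longlongrightarrow> M) at_top"
    by (rule filterlim_compose[OF _ filterlim_exp_minus_at_right_0])
  then have lim: "((\<lambda>t. ereal (scaled_tube \<delta> Y t)) \<longlongrightarrow> M) at_top"
    by (simp add: content_density_eq)
  have "M \<le> ereal b"
    by (rule tendsto_upperbound[OF lim]) (use assms(2) in auto)
  moreover have "0 \<le> M"
    by (rule tendsto_lowerbound[OF lim]) (auto simp: scaled_tube_nonneg)
  ultimately obtain C where "M = ereal C" by (cases M) auto
  then show ?thesis using lim that by simp
qed

lemma has_average_if_tendsto:
  assumes Y: "compact Y" "Y \<noteq> {}"
    and lim: "((\<lambda>T. integral {0..T} (scaled_tube \<delta> Y) / T) \<longlongrightarrow> M) at_top"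
  shows "has_average_minkowski_content \<delta> Y M"
proof -
  have subst: "integral {exp (- T)..1} (\<lambda>\<epsilon>. \<epsilon> powr (\<delta> - 2) * tube Y \<epsilon>) = integral {0..T} (scaled_tube \<delta> Y)"
    if "0 \<le> T" for T
  proof -
    let ?f = "\<lambda>\<epsilon>. \<epsilon> powr (\<delta> - 2) * tube Y \<epsilon>"
    have pos: "0 < x" if "x \<in> {exp (- T)..1}" for x
      using that exp_gt_zero[of "- T"] by (auto simp del: exp_gt_zero)
    have "continuous_on {exp (- T)..1} (tube Y)"
      by (rule continuous_on_subset[OF continuous_on_tube[OF Y]]) (use pos in auto)
    moreover have "continuous_on {exp (- T)..1} (\<lambda>\<epsilon>. \<epsilon> powr (\<delta> - 2))"
      by (rule continuous_on_powr) (use pos in \<open>force intro: continuous_intros\<close>)+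
    ultimately have f: "continuous_on {exp (- T)..1} ?f" by (rule continuous_on_mult[rotated])
    \<comment> \<open>The substitution \<open>\<epsilon> = exp (- t)\<close> reverses orientation,
      so the result is a difference of two integrals, the first over an interval that is empty or a
      point.\<close>
    have "((\<lambda>t. - exp (- t) *\<^sub>R ?f (exp (- t))) has_integral
        (integral {exp (- 0)..exp (- T)} ?f - integral {exp (- T)..exp (- 0)} ?f)) {0..T}"
    proof (rule has_integral_substitution_general[where s="{}" and c="exp (- T)" and d=1])
      show "(\<lambda>t. exp (- t)) ` {0..T} \<subseteq> {exp (- T)..1}" by auto
      show "((\<lambda>t. exp (- t)) has_real_derivative - exp (- t)) (at t within {0..T})" for t
        by (auto intro!: derivative_eq_intros)
    qed (use f that in \<open>auto intro!: continuous_intros\<close>)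
    moreover have "integral {exp (- 0)..exp (- T)} ?f = 0"
      using that by (cases "T = 0") auto
    moreover have "- exp (- t) *\<^sub>R ?f (exp (- t)) = - scaled_tube \<delta> Y t" for t
    proof -
      have "exp (- t) * exp (- t) powr (\<delta> - 2) = exp ((1 - \<delta>) * t)"
        by (simp add: powr_def exp_add[symmetric] algebra_simps)
      then show ?thesis by (simp add: scaled_tube_def mult.assoc[symmetric])
    qed
    ultimately have "((\<lambda>t. - scaled_tube \<delta> Y t) has_integral - integral {exp (- T)..1} ?f) {0..T}" by simp
    then have "(scaled_tube \<delta> Y has_integral integral {exp (- T)..1} ?f) {0..T}"
      by (simp add: has_integral_neg_iff)
    then show ?thesis by (rule integral_unique[symmetric])
  qed
  have "((\<lambda>T. integral {0..- ln T} (scaled_tube \<delta> Y) / (- ln T)) \<longlongrightarrow> M) (at_right 0)"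
    by (rule filterlim_compose[OF lim filterlim_neg_ln_at_right_0])
  moreover have "\<forall>\<^sub>F T in at_right 0. integral {0..- ln T} (scaled_tube \<delta> Y) / (- ln T) =
    inverse \<bar>ln T\<bar> * integral {T..1} (\<lambda>\<epsilon>. \<epsilon> powr (\<delta> - 2) * measure lborel (parallel_set Y \<epsilon>))"
    using eventually_at_right_real[of 0 "1::real"]
  proof (rule eventually_mono)
    fix T :: real assume "T \<in> {0<..<1}"
    then show "integral {0..- ln T} (scaled_tube \<delta> Y) / (- ln T) =
      inverse \<bar>ln T\<bar> * integral {T..1} (\<lambda>\<epsilon>. \<epsilon> powr (\<delta> - 2) * measure lborel (parallel_set Y \<epsilon>))"
      using subst[of "- ln T"] by (simp add: tube_def divide_inverse)
  qed simp
  ultimately show ?thesis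
    unfolding has_average_minkowski_content_def by (rule Lim_transform_eventually)
qed

text \<open>One factor \<open>1 + \<eta>\<close> is the variation of the slope about its reference
  value on a piece, the other the replacement of the reference value by its upper or lower estimate.
  The form fits pointwise and Cesaro limits alike.\<close>

lemma tendsto_squeeze_factor:
  fixes \<phi> :: "'a \<Rightarrow> real"
  assumes "\<And>\<eta>. 0 < \<eta> \<Longrightarrow> \<exists>u l U U'. (\<forall>\<^sub>F t in F. \<phi> t \<le> u t) \<and> (\<forall>\<^sub>F t in F. l t \<le> \<phi> t) \<and>
    (u \<longlongrightarrow> U) F \<and> (l \<longlongrightarrow> U') F \<and> U \<le> (1 + \<eta>)\<^sup>2 * I \<and> I / (1 + \<eta>)\<^sup>2 \<le> U'"
  shows "(\<phi> \<longlongrightarrow> I) F"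
proof (rule order_tendstoI)
  fix y assume y: "I < y"
  have "((\<lambda>\<eta>. (1 + \<eta>)\<^sup>2 * I) \<longlongrightarrow> (1 + 0)\<^sup>2 * I) (at_right 0)" by (intro tendsto_intros)
  then have "\<forall>\<^sub>F \<eta> in at_right 0. (1 + \<eta>)\<^sup>2 * I < y" using y by (intro order_tendstoD(2)) auto
  then have "\<forall>\<^sub>F \<eta> in at_right 0. (1 + \<eta>)\<^sup>2 * I < y \<and> 0 < \<eta>"
    using eventually_at_right_less by (rule eventually_conj)
  from eventually_happens'[OF trivial_limit_at_right_real this] obtain \<eta> where \<eta>: "(1 + \<eta>)\<^sup>2 * I < y" "0 < \<eta>" by blast
  obtain u U where u: "\<forall>\<^sub>F t in F. \<phi> t \<le> u t" "(u \<longlongrightarrow> U) F" "U \<le> (1 + \<eta>)\<^sup>2 * I"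
    using assms[OF \<eta>(2)] by (elim exE conjE) (rule that)
  have "\<forall>\<^sub>F t in F. u t < y" using u(2,3) \<eta>(1) by (intro order_tendstoD(2)[OF u(2)]) auto
  with u(1) show "\<forall>\<^sub>F t in F. \<phi> t < y" by eventually_elim auto
next
  fix y assume y: "y < I"
  have "((\<lambda>\<eta>. I / (1 + \<eta>)\<^sup>2) \<longlongrightarrow> I / (1 + 0)\<^sup>2) (at_right 0)" by (intro tendsto_intros) auto
  then have "\<forall>\<^sub>F \<eta> in at_right 0. y < I / (1 + \<eta>)\<^sup>2" using y by (intro order_tendstoD(1)) auto
  then have "\<forall>\<^sub>F \<eta> in at_right 0. y < I / (1 + \<eta>)\<^sup>2 \<and> 0 < \<eta>"
    using eventually_at_right_less by (rule eventually_conj)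
  from eventually_happens'[OF trivial_limit_at_right_real this] obtain \<eta> where \<eta>: "y < I / (1 + \<eta>)\<^sup>2" "0 < \<eta>" by blast
  obtain l U where u: "\<forall>\<^sub>F t in F. l t \<le> \<phi> t" "(l \<longlongrightarrow> U) F" "I / (1 + \<eta>)\<^sup>2 \<le> U"
    using assms[OF \<eta>(2)] by (elim exE conjE) (rule that)
  have "\<forall>\<^sub>F t in F. y < l t" using u(2,3) \<eta>(1) by (intro order_tendstoD(1)[OF u(2)]) auto
  with u(1) show "\<forall>\<^sub>F t in F. y < \<phi> t" by eventually_elim auto
qed

context affine_ifs
begin

section \<open>Bounds for the exponent and for the scaled volume\<close>

definition smax :: real where "smax = Max ((\<lambda>i. \<bar>s i\<bar>) ` {1..N})"

lemma smax: "0 < smax" "smax < 1" "i \<in> {1..N} \<Longrightarrow> \<bar>s i\<bar> \<le> smax"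
proof -
  have ne: "(\<lambda>i. \<bar>s i\<bar>) ` {1..N} \<noteq> {}" using N_ge by auto
  show "i \<in> {1..N} \<Longrightarrow> \<bar>s i\<bar> \<le> smax" for i unfolding smax_def by simp
  have "smax \<in> (\<lambda>i. \<bar>s i\<bar>) ` {1..N}" unfolding smax_def using ne by (intro Max_in) auto
  then show "0 < smax" "smax < 1" using s_nz s_lt by auto
qed

lemma sw_le_smax: "w \<in> W m \<Longrightarrow> \<bar>sw w\<bar> \<le> smax ^ m"
proof -
  have "set w \<subseteq> {1..N} \<Longrightarrow> \<bar>sw w\<bar> \<le> smax ^ length w" for w
    by (induction w) (use smax in \<open>auto simp: abs_mult intro!: mult_mono\<close>)
  then show "w \<in> W m \<Longrightarrow> \<bar>sw w\<bar> \<le> smax ^ m" by (auto simp: W_def)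
qed

lemma inner_tube_pos: "0 < \<epsilon> \<Longrightarrow> 0 < V \<epsilon> - 2 * \<epsilon>"
proof -
  assume e: "0 < \<epsilon>"
  have cpt: "compact {A, B}" by (simp add: finite_imp_compact)
  have "tube ({A} \<union> {B}) \<epsilon> = tube {A} \<epsilon> + tube {B} \<epsilon> - 2 * \<epsilon> + min (2 * \<epsilon>) (B - A)"
    by (rule tube_Un_ordered) (use AB e in auto)
  moreover have "tube {A, B} \<epsilon> \<le> V \<epsilon>"
    unfolding tube_def
  proof (rule measure_mono_fmeasurable)
    show "parallel_set {A, B} \<epsilon> \<subseteq> parallel_set K \<epsilon>"
      using AB K_ne cpt by (auto simp: parallel_set_compact)
    show "parallel_set {A, B} \<epsilon> \<in> sets lborel"
      using compact_parallel_set[OF cpt] by (simp add: borel_compact)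
  qed (use parallel_set_fmeasurable AB K_ne in auto)
  ultimately show ?thesis using e AB(1) by (simp add: tube_singleton insert_commute)
qed

text \<open>Subtracting \<open>2 * \<epsilon>\<close> once on the right and \<open>N\<close> times
  on the left absorbs the term \<open>2 * (N - 1) * \<epsilon>\<close> of the renewal equation, so
  only the nonnegative gap terms remain. This gives the inequality opposite to the one for
  \<open>V\<close>.\<close>

lemma inner_tube_sub:
  assumes "0 < \<epsilon>"
  shows "(\<Sum>i\<in>{1..N}. \<bar>s i\<bar> * (V (\<epsilon> / \<bar>s i\<bar>) - 2 * (\<epsilon> / \<bar>s i\<bar>))) \<le> V \<epsilon> - 2 * \<epsilon>"
proof -
  obtain ds where ds: "length ds = N - 1" "\<And>d. d \<in> set ds \<Longrightarrow> 0 \<le> d"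
    "\<And>\<epsilon>. 0 \<le> \<epsilon> \<Longrightarrow> V \<epsilon> = (\<Sum>i\<in>{1..N}. \<bar>s i\<bar> * V (\<epsilon> / \<bar>s i\<bar>)) - 2 * (real N - 1) * \<epsilon>
       + (\<Sum>d\<leftarrow>ds. min (2 * \<epsilon>) d)"
    by (rule V_renewal) (rule that)
  have "0 \<le> (\<Sum>d\<leftarrow>ds. min (2 * \<epsilon>) d)"
    using ds(2) assms by (intro sum_list_nonneg) auto
  moreover have "(\<Sum>i\<in>{1..N}. \<bar>s i\<bar> * (V (\<epsilon> / \<bar>s i\<bar>) - 2 * (\<epsilon> / \<bar>s i\<bar>)))
      = (\<Sum>i\<in>{1..N}. \<bar>s i\<bar> * V (\<epsilon> / \<bar>s i\<bar>) - 2 * \<epsilon>)"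
    using s_nz by (intro sum.cong refl) (auto simp: right_diff_distrib)
  ultimately show ?thesis
    using ds(3)[of \<epsilon>] assms by (simp add: sum_subtractf algebra_simps)
qed

lemma tube_sub:
  assumes "0 < \<epsilon>"
  shows "V \<epsilon> \<le> (\<Sum>i\<in>{1..N}. \<bar>s i\<bar> * V (\<epsilon> / \<bar>s i\<bar>))"
    "(\<Sum>i\<in>{1..N}. \<bar>s i\<bar> * V (\<epsilon> / \<bar>s i\<bar>)) - 2 * real N * \<epsilon> \<le> V \<epsilon>"
proof -
  obtain ds where ds: "length ds = N - 1" "\<And>d. d \<in> set ds \<Longrightarrow> 0 \<le> d"
    "\<And>\<epsilon>. 0 \<le> \<epsilon> \<Longrightarrow> V \<epsilon> = (\<Sum>i\<in>{1..N}. \<bar>s i\<bar> * V (\<epsilon> / \<bar>s i\<bar>)) - 2 * (real N - 1) * \<epsilon>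
       + (\<Sum>d\<leftarrow>ds. min (2 * \<epsilon>) d)"
    by (rule V_renewal) (rule that)
  have "0 \<le> (\<Sum>d\<leftarrow>ds. min (2 * \<epsilon>) d)"
    using ds(2) assms by (intro sum_list_nonneg) auto
  moreover have "(\<Sum>d\<leftarrow>ds. min (2 * \<epsilon>) d) \<le> (\<Sum>d\<leftarrow>ds. 2 * \<epsilon>)" by (intro sum_list_mono) auto
  moreover have "(\<Sum>d\<leftarrow>ds. 2 * \<epsilon>) = 2 * (real N - 1) * \<epsilon>"
    using ds(1) N_ge by (simp add: sum_list_triv of_nat_diff algebra_simps)
  ultimately show "V \<epsilon> \<le> (\<Sum>i\<in>{1..N}. \<bar>s i\<bar> * V (\<epsilon> / \<bar>s i\<bar>))"
    "(\<Sum>i\<in>{1..N}. \<bar>s i\<bar> * V (\<epsilon> / \<bar>s i\<bar>)) - 2 * real N * \<epsilon> \<le> V \<epsilon>"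
    using ds(3)[of \<epsilon>] assms by (simp_all add: algebra_simps)
qed

lemma V_tendsto_0:
  assumes "decseq \<epsilon>" "\<epsilon> \<longlonglongrightarrow> 0" "\<And>n. 0 < \<epsilon> n"
  shows "(\<lambda>n. V (\<epsilon> n)) \<longlonglongrightarrow> 0"
proof -
  have "(\<lambda>n. measure lborel (parallel_set K (\<epsilon> n))) \<longlonglongrightarrow> measure lborel (\<Inter>n. parallel_set K (\<epsilon> n))"
  proof (rule Lim_measure_decseq)
    show "range (\<lambda>n. parallel_set K (\<epsilon> n)) \<subseteq> sets lborel"
      using compact_parallel_set[OF AB(5) K_ne] by (auto simp: borel_compact)
    show "decseq (\<lambda>n. parallel_set K (\<epsilon> n))"
      using assms(1) by (force simp: decseq_def parallel_set_def)
    show "emeasure lborel (parallel_set K (\<epsilon> n)) \<noteq> \<infinity>" for n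
      using parallel_set_fmeasurable[OF AB(5) K_ne, of "\<epsilon> n"] by (auto simp: fmeasurable_def)
  qed
  moreover have "(\<Inter>n. parallel_set K (\<epsilon> n)) = K"
  proof
    show "K \<subseteq> (\<Inter>n. parallel_set K (\<epsilon> n))" using assms(3) by (auto simp: parallel_set_def less_imp_le)
    show "(\<Inter>n. parallel_set K (\<epsilon> n)) \<subseteq> K"
    proof
      fix x assume "x \<in> (\<Inter>n. parallel_set K (\<epsilon> n))"
      then have "infdist x K \<le> \<epsilon> n" for n by (auto simp: parallel_set_def)
      then have "infdist x K \<le> 0" by (intro LIMSEQ_le_const[OF assms(2)]) auto
      then have "infdist x K = 0" using infdist_nonneg[of x K] by simp
      then show "x \<in> K" using in_closed_iff_infdist_zero[of K x] AB(5) K_ne compact_imp_closed by auto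
    qed
  qed
  ultimately show ?thesis using null_K by (simp add: tube_def measure_def)
qed

text \<open>If \<open>1 \<le> \<delta>\<close>, the ratios sum to at least 1. Then
  \<open>v \<epsilon> = V \<epsilon> - 2 * \<epsilon>\<close> does not decrease when the radius
  shrinks by \<open>smax\<close>, since every \<open>v (\<epsilon> / \<bar>s i\<bar>)\<close> is at
  least \<open>v (\<epsilon> / smax)\<close>. So \<open>V\<close> stays above \<open>v 1 > 0\<close>
  at arbitrarily small radii, although it tends to the measure of \<open>K\<close>.\<close>

lemma delta_less_1: "\<delta> < 1"
proof (rule ccontr)
  assume "\<not> \<delta> < 1"
  then have "p i \<le> \<bar>s i\<bar>" if "i \<in> {1..N}" for i
    using s_lt[OF that] s_nz[OF that] powr_mono'[of 1 \<delta> "\<bar>s i\<bar>"] by (simp add: p_def)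
  then have ge1: "1 \<le> (\<Sum>i\<in>{1..N}. \<bar>s i\<bar>)" using sum_mono[of "{1..N}" p "\<lambda>i. \<bar>s i\<bar>"] sum_p by simp
  define v where "v \<epsilon> = V \<epsilon> - 2 * \<epsilon>" for \<epsilon>
  have step: "v (\<epsilon> / smax) \<le> v \<epsilon>" if "0 < \<epsilon>" for \<epsilon>
  proof -
    have v0: "0 < v (\<epsilon> / smax)" using inner_tube_pos[of "\<epsilon> / smax"] that smax(1) by (simp add: v_def)
    have "v (\<epsilon> / smax) \<le> (\<Sum>i\<in>{1..N}. \<bar>s i\<bar>) * v (\<epsilon> / smax)" using ge1 v0 by simp
    also have "\<dots> \<le> (\<Sum>i\<in>{1..N}. \<bar>s i\<bar> * v (\<epsilon> / \<bar>s i\<bar>))"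
      unfolding sum_distrib_right
    proof (rule sum_mono, rule mult_left_mono)
      fix i assume i: "i \<in> {1..N}"
      show "v (\<epsilon> / smax) \<le> v (\<epsilon> / \<bar>s i\<bar>)"
        unfolding v_def using that smax smax(3)[OF i] s_nz[OF i] AB(5) K_ne
        by (intro tube_minus_double_mono) (auto intro: divide_left_mono)
    qed simp
    also have "\<dots> \<le> v \<epsilon>" using inner_tube_sub[OF that] by (simp add: v_def)
    finally show ?thesis .
  qed
  have v1: "v 1 \<le> v (smax ^ n)" for n
  proof (induction n)
    case (Suc n)
    have "v (smax ^ n) \<le> v (smax ^ Suc n)" using step[of "smax ^ Suc n"] smax by simp
    then show ?case using Suc by simp
  qed simp
  have "v (smax ^ n) \<le> V (smax ^ n)" for n
    using zero_le_power[of smax n] smax(1) by (simp add: v_def)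
  with v1 have "v 1 \<le> V (smax ^ n)" for n by (rule order_trans)
  moreover have "(\<lambda>n. V (smax ^ n)) \<longlonglongrightarrow> 0"
    using smax by (intro V_tendsto_0 LIMSEQ_power_zero) (auto simp: decseq_def power_decreasing)
  ultimately have "v 1 \<le> 0" by (intro LIMSEQ_le_const[of _ 0]) auto
  then show False using inner_tube_pos[of 1] by (simp add: v_def)
qed

abbreviation Z :: "real \<Rightarrow> real" where "Z \<equiv> scaled_tube \<delta> K"
abbreviation a :: "nat \<Rightarrow> real" where "a \<equiv> (\<lambda>i. - ln \<bar>s i\<bar>)"

lemma p_scaled: "i \<in> {1..N} \<Longrightarrow> p i * Z (t - a i) = exp ((1 - \<delta>) * t) * (\<bar>s i\<bar> * V (exp (- t) / \<bar>s i\<bar>))"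
  using exp_mult_tube[of "\<bar>s i\<bar>" \<delta> t K] s_nz by (simp add: p_def)

lemma exp_delta_tendsto_0: "((\<lambda>t. exp (- \<delta> * t)) \<longlongrightarrow> 0) at_top"
  using filterlim_tendsto_neg_mult_at_bot[OF tendsto_const _ filterlim_ident, of "- \<delta>"] delta_pos
  by (intro filterlim_compose[OF exp_at_bot]) simp

text \<open>These are the inequalities of \<open>tube_sub\<close> in logarithmic scale; the error
  \<open>2 * N * \<epsilon>\<close> is scaled to \<open>2 * N * exp (- \<delta> * t)\<close>, which
  vanishes since \<open>0 < \<delta>\<close>.\<close>

sublocale renewal "{1..N}" p a Z "1 - \<delta>"
proof
  show "0 < p i" if "i \<in> {1..N}" for i using p_pos that .
  show "0 < - ln \<bar>s i\<bar>" if "i \<in> {1..N}" for i using s_lt[OF that] s_nz[OF that] by simp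
  show "Z t \<le> exp ((1 - \<delta>) * (t - s)) * Z s" if "s \<le> t" for s t
    using scaled_tube_growth AB(5) K_ne that by blast
  have sum: "(\<Sum>i\<in>{1..N}. p i * Z (t - a i))
      = exp ((1 - \<delta>) * t) * (\<Sum>i\<in>{1..N}. \<bar>s i\<bar> * V (exp (- t) / \<bar>s i\<bar>))" for t
    unfolding sum_distrib_left by (intro sum.cong refl p_scaled)
  show sub: "Z t \<le> (\<Sum>i\<in>{1..N}. p i * Z (t - a i))" for t
    unfolding sum scaled_tube_def[of \<delta> K t] by (intro mult_left_mono tube_sub) auto
  show "((\<lambda>t. Z t - (\<Sum>i\<in>{1..N}. p i * Z (t - a i))) \<longlongrightarrow> 0) at_top"
  proof (rule Lim_null_comparison)
    have "norm (Z t - (\<Sum>i\<in>{1..N}. p i * Z (t - a i))) \<le> 2 * real N * exp (- \<delta> * t)" for t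
    proof -
      have "(\<Sum>i\<in>{1..N}. p i * Z (t - a i)) - Z t
          = exp ((1 - \<delta>) * t) * ((\<Sum>i\<in>{1..N}. \<bar>s i\<bar> * V (exp (- t) / \<bar>s i\<bar>)) - V (exp (- t)))"
        unfolding sum by (simp add: scaled_tube_def right_diff_distrib)
      also have "\<dots> \<le> exp ((1 - \<delta>) * t) * (2 * real N * exp (- t))"
        using tube_sub(2)[of "exp (- t)"] by (intro mult_left_mono) auto
      also have "\<dots> = 2 * real N * exp (- \<delta> * t)"
        by (simp add: exp_add[symmetric] algebra_simps)
      finally show ?thesis using sub[of t] by simp
    qed
    then show "\<forall>\<^sub>F t in at_top. norm (Z t - (\<Sum>i\<in>{1..N}. p i * Z (t - a i))) \<le> 2 * real N * exp (- \<delta> * t)"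
      by (intro always_eventually allI)
    show "((\<lambda>t. 2 * real N * exp (- \<delta> * t)) \<longlongrightarrow> 0) at_top"
      using tendsto_mult_right_zero[OF exp_delta_tendsto_0, of "2 * real N"] by simp
  qed
qed (use sum_p delta_less_1 scaled_tube_nonneg in auto)

text \<open>The renewal inequality bounds \<open>Z\<close> from above and cannot propagate lower
  bounds. But \<open>v\<close>, the scaled form of \<open>V \<epsilon> - 2 * \<epsilon>\<close>, is
  at least the weighted mean of its translates, so a bound on \<open>{0..M}\<close> persists; each
  induction step extends it by the shortest step \<open>m\<close>.\<close>

lemma Z_lower_bound: "\<exists>c>0. \<forall>t\<ge>0. c \<le> Z t"
proof -
  define v where "v t = exp ((1 - \<delta>) * t) * (V (exp (- t)) - 2 * exp (- t))" for t
  define M where "M = Max (a ` {1..N})"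
  define m where "m = Min (a ` {1..N})"
  have M: "a i \<le> M" "m \<le> a i" if "i \<in> {1..N}" for i using that by (simp_all add: M_def m_def)
  have "m \<in> a ` {1..N}" unfolding m_def using N_ge by (intro Min_in) auto
  then have m: "0 < m" using a_pos by auto
  have "0 < M" using M(2)[of 1] M(1)[of 1] m N_ge by simp
  \<comment> \<open>On \<open>{0..M}\<close> the inner volume is smallest at the smallest radius
    \<open>exp (- M)\<close>, and the scaling factor is at least 1.\<close>
  define c where "c = V (exp (- M)) - 2 * exp (- M)"
  have c: "0 < c" unfolding c_def by (rule inner_tube_pos) simp
  have v_sub: "(\<Sum>i\<in>{1..N}. p i * v (t - a i)) \<le> v t" for t
  proof -
    have "p i * v (t - a i)
        = exp ((1 - \<delta>) * t) * (\<bar>s i\<bar> * (V (exp (- t) / \<bar>s i\<bar>) - 2 * (exp (- t) / \<bar>s i\<bar>)))"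
      if i: "i \<in> {1..N}" for i
    proof -
      have e: "exp (- (t + ln \<bar>s i\<bar>)) = exp (- t) / \<bar>s i\<bar>" using s_nz[OF i] by (simp add: exp_diff)
      have "exp ((1 - \<delta>) * (t + ln \<bar>s i\<bar>)) = exp ((1 - \<delta>) * t) * \<bar>s i\<bar> powr (1 - \<delta>)"
        using s_nz[OF i] by (simp add: powr_def exp_add[symmetric] algebra_simps)
      moreover have "\<bar>s i\<bar> powr \<delta> * \<bar>s i\<bar> powr (1 - \<delta>) = \<bar>s i\<bar>"
        using s_nz[OF i] by (simp add: powr_add[symmetric])
      ultimately have "p i * exp ((1 - \<delta>) * (t + ln \<bar>s i\<bar>)) = exp ((1 - \<delta>) * t) * \<bar>s i\<bar>"
        by (simp add: p_def algebra_simps)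
      then show ?thesis by (simp add: v_def e[simplified] e mult.assoc[symmetric])
    qed
    then have "(\<Sum>i\<in>{1..N}. p i * v (t - a i)) = exp ((1 - \<delta>) * t) *
        (\<Sum>i\<in>{1..N}. \<bar>s i\<bar> * (V (exp (- t) / \<bar>s i\<bar>) - 2 * (exp (- t) / \<bar>s i\<bar>)))"
      unfolding sum_distrib_left by (intro sum.cong refl)
    then show ?thesis
      using inner_tube_sub[of "exp (- t)"] by (simp add: v_def del: minus_add_distrib)
  qed
  have "\<forall>t. 0 \<le> t \<and> t \<le> M + real n * m \<longrightarrow> c \<le> v t" for n
  proof (induction n)
    case 0
    show ?case
    proof (intro allI impI)
      fix t assume t: "0 \<le> t \<and> t \<le> M + real 0 * m"
      have "c \<le> V (exp (- t)) - 2 * exp (- t)"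
        unfolding c_def using t AB(5) K_ne by (intro tube_minus_double_mono) auto
      also have "\<dots> \<le> v t"
        unfolding v_def using t delta_less_1 inner_tube_pos[of "exp (- t)"]
        by (intro mult_le_cancel_right1[THEN iffD2]) (auto simp: less_imp_le)
      finally show "c \<le> v t" .
    qed
  next
    case (Suc n)
    show ?case
    proof (intro allI impI)
      fix t assume t: "0 \<le> t \<and> t \<le> M + real (Suc n) * m"
      show "c \<le> v t"
      proof (cases "t \<le> M + real n * m")
        case True
        then show ?thesis using Suc t by blast
      next
        case False
        have "c \<le> v (t - a i)" if "i \<in> {1..N}" for i
        proof -
          have "0 \<le> real n * m" using m by simp
          then have "0 \<le> t - a i" using M(1)[OF that] False by linarith
          moreover have "t - a i \<le> M + real n * m" using M(2)[OF that] t by (simp add: algebra_simps)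
          ultimately show ?thesis using Suc by blast
        qed
        then have "(\<Sum>i\<in>{1..N}. p i * c) \<le> (\<Sum>i\<in>{1..N}. p i * v (t - a i))"
          using p_pos by (intro sum_mono mult_left_mono) (auto intro: less_imp_le)
        also have "\<dots> \<le> v t" by (rule v_sub)
        finally show ?thesis using sum_p by (simp add: sum_distrib_right[symmetric])
      qed
    qed
  qed
  then have *: "c \<le> v t" if "0 \<le> t" for t
  proof -
    obtain n where "t / m \<le> real n" using real_arch_simple by blast
    then have "t \<le> M + real n * m" using m \<open>0 < M\<close> by (simp add: field_simps)
    then show ?thesis using \<open>\<And>n. \<forall>t. 0 \<le> t \<and> t \<le> M + real n * m \<longrightarrow> c \<le> v t\<close> that by blast
  qed
  have "v t \<le> Z t" for t by (simp add: v_def scaled_tube_def)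
  then show ?thesis using c * by (meson order_trans)
qed

lemma L_pos: "0 < L / \<mu>"
proof -
  obtain c where c: "0 < c" "\<And>t. 0 \<le> t \<Longrightarrow> c \<le> Z t" using Z_lower_bound by blast
  have "c \<le> L / \<mu>"
  proof (rule tendsto_lowerbound[OF Cesaro_Z])
    show "\<forall>\<^sub>F T in at_top. c \<le> J T / T"
      using eventually_gt_at_top[of 0]
    proof eventually_elim
      case (elim T)
      then show ?case using integral_Z_ge[of 0 T c] c(2) by (simp add: J_def field_simps)
    qed
  qed simp
  then show ?thesis using c by simp
qed

end

section \<open>Images under smooth maps\<close>

context affine_ifs
begin

lemma Sw_in: "set w \<subseteq> {1..N} \<Longrightarrow> x \<in> {A..B} \<Longrightarrow> Sw w x \<in> {A..B}"
  using Sw_maps(1)[of w] by blast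

definition word_slope :: "(real \<Rightarrow> real) \<Rightarrow> nat list \<Rightarrow> real" where
  "word_slope gd w = gd (Sw w A)"

text \<open>At a high enough level the pieces are so short that the slope stays within a factor
  \<open>1 + \<eta>\<close> of its reference value, and the bilipschitz estimate applies to each
  piece. Joining the images costs at most \<open>2 * N ^ m * \<epsilon>\<close>, which is negligible
  after scaling because \<open>m\<close> is fixed along with \<open>\<eta>\<close>.\<close>

lemma tube_image_words:
  assumes deriv: "\<And>x. x \<in> {A..B} \<Longrightarrow> (g has_real_derivative gd x) (at x)"
    and cont: "continuous_on {A..B} gd" and pos: "\<And>x. x \<in> {A..B} \<Longrightarrow> 0 < gd x" and "0 < \<eta>"
  obtains m where
    "\<And>w. w \<in> W m \<Longrightarrow> 0 < word_slope gd w"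
    "\<And>w y. w \<in> W m \<Longrightarrow> y \<in> Sw w ` {A..B} \<Longrightarrow>
      word_slope gd w / (1 + \<eta>) \<le> gd y \<and> gd y \<le> word_slope gd w * (1 + \<eta>)"
    "\<And>\<epsilon>. 0 < \<epsilon> \<Longrightarrow> tube (g ` K) \<epsilon> \<le> (\<Sum>w\<in>W m. (word_slope gd w * (1 + \<eta>) * \<bar>sw w\<bar>) *
      V (\<epsilon> / (word_slope gd w * (1 + \<eta>) * \<bar>sw w\<bar>)))"
    "\<And>\<epsilon>. 0 < \<epsilon> \<Longrightarrow> (\<Sum>w\<in>W m. (word_slope gd w / (1 + \<eta>) * \<bar>sw w\<bar>) *
      V (\<epsilon> / (word_slope gd w / (1 + \<eta>) * \<bar>sw w\<bar>))) - 2 * real (N ^ m) * \<epsilon> \<le> tube (g ` K) \<epsilon>"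
proof -
  obtain z where z: "z \<in> {A..B}" "\<And>y. y \<in> {A..B} \<Longrightarrow> gd z \<le> gd y"
    using continuous_attains_inf[OF _ _ cont] AB(1) by auto
  \<comment> \<open>As \<open>gd z\<close> is the least slope,
    \<open>e \<le> \<gamma> * \<eta> / (1 + \<eta>)\<close> for every reference slope
    \<open>\<gamma>\<close>. Then \<open>\<gamma> - e\<close> and \<open>\<gamma> + e\<close> stay
    within \<open>\<gamma> / (1 + \<eta>)\<close> and
    \<open>\<gamma> * (1 + \<eta>)\<close>.\<close>
  define e where "e = gd z * \<eta> / (1 + \<eta>)"
  have "0 < e" unfolding e_def using pos[OF z(1)] \<open>0 < \<eta>\<close> by simp
  have "uniformly_continuous_on {A..B} gd"
    using cont by (rule compact_uniformly_continuous) simp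
  then obtain d where d: "0 < d"
    "\<And>x y. x \<in> {A..B} \<Longrightarrow> y \<in> {A..B} \<Longrightarrow> dist y x < d \<Longrightarrow> dist (gd y) (gd x) < e"
    using \<open>0 < e\<close> unfolding uniformly_continuous_on_def by metis
  have "(\<lambda>m. smax ^ m * (B - A)) \<longlonglongrightarrow> 0 * (B - A)"
    using smax by (intro tendsto_mult LIMSEQ_power_zero tendsto_const) auto
  then have "\<forall>\<^sub>F m in sequentially. smax ^ m * (B - A) < d" using d(1) by (intro order_tendstoD(2)) auto
  then obtain m where m: "smax ^ m * (B - A) < d" by (auto simp: eventually_sequentially)
  let ?\<gamma> = "word_slope gd"
  have words: "set w \<subseteq> {1..N}" if "w \<in> W m" for w using that by (simp add: W_def)
  have slope_pos: "0 < ?\<gamma> w" if "w \<in> W m" for w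
    unfolding word_slope_def using AB(1) by (intro pos Sw_in words that) auto
  have slope: "?\<gamma> w / (1 + \<eta>) \<le> gd y \<and> gd y \<le> ?\<gamma> w * (1 + \<eta>)"
    if w: "w \<in> W m" and y: "y \<in> Sw w ` {A..B}" for w y
  proof -
    obtain x where x: "x \<in> {A..B}" "y = Sw w x" using y by blast
    have "dist y (Sw w A) = \<bar>sw w\<bar> * (x - A)"
      using x Sw_diff[of w x A] by (simp add: dist_real_def abs_mult)
    also have "\<dots> \<le> smax ^ m * (B - A)" using x sw_le_smax[OF w] smax(1) by (intro mult_mono) auto
    finally have "dist y (Sw w A) < d" using m by simp
    moreover have in_AB: "y \<in> {A..B}" "Sw w A \<in> {A..B}"
      using Sw_in[OF words[OF w]] x AB(1) by auto
    ultimately have "dist (gd y) (?\<gamma> w) < e" unfolding word_slope_def by (intro d(2))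
    then have "gd y < ?\<gamma> w + e" "?\<gamma> w - e < gd y" by (simp_all add: dist_real_def abs_less_iff)
    moreover have "gd z \<le> ?\<gamma> w" unfolding word_slope_def using z(2) in_AB by blast
    then have "e \<le> ?\<gamma> w * \<eta> / (1 + \<eta>)"
      unfolding e_def using \<open>0 < \<eta>\<close> by (intro divide_right_mono mult_right_mono) auto
    moreover have "?\<gamma> w * \<eta> / (1 + \<eta>) \<le> ?\<gamma> w * \<eta>"
      using \<open>0 < \<eta>\<close> slope_pos[OF w] by (simp add: field_simps)
    moreover have "?\<gamma> w - ?\<gamma> w * \<eta> / (1 + \<eta>) = ?\<gamma> w / (1 + \<eta>)" using \<open>0 < \<eta>\<close> by (simp add: field_simps)
    moreover have "?\<gamma> w * (1 + \<eta>) = ?\<gamma> w + ?\<gamma> w * \<eta>" by (simp add: algebra_simps)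
    ultimately show ?thesis by (intro conjI; linarith)
  qed
  have mvt: "\<exists>\<xi>\<in>{x..y}. g y - g x = (y - x) * gd \<xi>" if "A \<le> x" "x \<le> y" "y \<le> B" for x y
  proof (cases "x = y")
    case False
    then have "x < y" using that by simp
    then have "\<exists>z>x. z < y \<and> g y - g x = (y - x) * gd z"
      by (rule MVT2) (use deriv that in auto)
    then obtain \<xi> where "x < \<xi>" "\<xi> < y" "g y - g x = (y - x) * gd \<xi>" by blast
    then show ?thesis by (intro bexI[of _ \<xi>]) auto
  qed auto
  have g_strict: "g x < g y" if "A \<le> x" "x < y" "y \<le> B" for x y
  proof -
    obtain \<xi> where "\<xi> \<in> {x..y}" "g y - g x = (y - x) * gd \<xi>" using mvt[of x y] \<open>A \<le> x\<close> \<open>x < y\<close> \<open>y \<le> B\<close> by auto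
    moreover from this have "0 < (y - x) * gd \<xi>" using pos[of \<xi>] \<open>A \<le> x\<close> \<open>x < y\<close> \<open>y \<le> B\<close> by simp
    ultimately show ?thesis by simp
  qed
  have g_mono: "g x \<le> g y" if "A \<le> x" "x \<le> y" "y \<le> B" for x y
    using g_strict[of x y] that by (cases "x = y") auto
  have g_cont: "continuous_on {A..B} g"
    using deriv by (meson DERIV_isCont continuous_at_imp_continuous_on)
  have lu: "A \<le> lw w" "uw w \<le> B" "lw w < uw w" "Sw w ` K \<subseteq> {lw w..uw w}" "Sw w ` {A..B} = {lw w..uw w}"
    if w: "w \<in> W m" for w
  proof -
    have "lw w \<in> {A..B}" "uw w \<in> {A..B}" using lw_in[of w] Sw_maps(3)[OF words[OF w]] AB(4) by blast+
    then show "A \<le> lw w" "uw w \<le> B" by auto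
    show "lw w < uw w" "Sw w ` {A..B} = {lw w..uw w}" by (fact Sw_Icc(4,1)[OF words[OF w]])+
    then show "Sw w ` K \<subseteq> {lw w..uw w}" using AB(4) by blast
  qed
  have piece: "?\<gamma> w / (1 + \<eta>) * \<bar>sw w\<bar> * V (\<epsilon> / (?\<gamma> w / (1 + \<eta>) * \<bar>sw w\<bar>)) \<le> tube (g ` Sw w ` K) \<epsilon> \<and>
      tube (g ` Sw w ` K) \<epsilon> \<le> ?\<gamma> w * (1 + \<eta>) * \<bar>sw w\<bar> * V (\<epsilon> / (?\<gamma> w * (1 + \<eta>) * \<bar>sw w\<bar>))"
    if w: "w \<in> W m" and "0 < \<epsilon>" for w \<epsilon>
  proof -
    let ?c = "?\<gamma> w / (1 + \<eta>)" and ?C = "?\<gamma> w * (1 + \<eta>)"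
    have cC: "0 < ?c" "?c \<le> ?C"
      using slope_pos[OF w] \<open>0 < \<eta>\<close> slope[OF w, of "Sw w A"] AB(1) by auto
    have sl: "?c * (y - x) \<le> g y - g x \<and> g y - g x \<le> ?C * (y - x)"
      if x: "x \<in> Sw w ` K" and y: "y \<in> Sw w ` K" and le: "x \<le> y" for x y
    proof -
      have xy: "x \<in> {lw w..uw w}" "y \<in> {lw w..uw w}" using lu(4)[OF w] x y by auto
      then obtain \<xi> where \<xi>: "\<xi> \<in> {x..y}" "g y - g x = (y - x) * gd \<xi>"
        using mvt[of x y] lu(1,2)[OF w] le by auto
      then have "\<xi> \<in> Sw w ` {A..B}" unfolding lu(5)[OF w] using xy by auto
      then have "?c \<le> gd \<xi>" "gd \<xi> \<le> ?C" using slope[OF w] by auto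
      then have "(y - x) * ?c \<le> (y - x) * gd \<xi>" "(y - x) * gd \<xi> \<le> (y - x) * ?C"
        using le by (auto intro!: mult_left_mono simp del: times_divide_eq_right)
      then show ?thesis unfolding \<xi>(2) mult.commute[of _ "y - x"] ..
    qed
    have Y: "compact (Sw w ` K)" "Sw w ` K \<noteq> {}" "continuous_on (Sw w ` K) g"
      using compact_Sw[OF AB(5)] K_ne lu(1,2,4)[OF w]
      by (auto intro!: continuous_on_subset[OF g_cont])
    have "?c * tube (Sw w ` K) (\<epsilon> / ?c) \<le> tube (g ` Sw w ` K) \<epsilon>"
      "tube (g ` Sw w ` K) \<epsilon> \<le> ?C * tube (Sw w ` K) (\<epsilon> / ?C)"
      by (rule tube_bilipschitz_image[OF Y cC(1) \<open>0 < \<epsilon>\<close> _ cC(2)]; use sl in blast)+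
    then show ?thesis
      by (simp only: tube_affine_Sw[OF words[OF w]] divide_divide_eq_left mult.assoc)
  qed
  have "\<exists>ds. length ds = card (W m) - 1 \<and> (\<forall>d\<in>set ds. 0 \<le> d) \<and>
    (\<forall>\<epsilon>\<ge>0. tube (\<Union>w\<in>W m. g ` Sw w ` K) \<epsilon> =
       (\<Sum>w\<in>W m. tube (g ` Sw w ` K) \<epsilon>) - 2 * (real (card (W m)) - 1) * \<epsilon> + (\<Sum>d\<leftarrow>ds. min (2 * \<epsilon>) d))"
  proof (rule tube_UN_ordered[where l="\<lambda>w. g (lw w)" and u="\<lambda>w. g (uw w)", OF finite_W W_ne])
    fix w assume w: "w \<in> W m"
    have "compact (g ` Sw w ` K)"
      using compact_Sw[OF AB(5), of w] lu(1,2,4)[OF w]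
      by (intro compact_continuous_image[where f=g] continuous_on_subset[OF g_cont]) auto
    moreover have "g ` Sw w ` K \<subseteq> {g (lw w)..g (uw w)}"
    proof
      fix y assume "y \<in> g ` Sw w ` K"
      then obtain x where "x \<in> {lw w..uw w}" "y = g x" using lu(4)[OF w] by blast
      then show "y \<in> {g (lw w)..g (uw w)}" using g_mono lu(1,2)[OF w] by auto
    qed
    ultimately show "compact (g ` Sw w ` K) \<and> g ` Sw w ` K \<subseteq> {g (lw w)..g (uw w)} \<and> g (lw w) \<in> g ` Sw w ` K \<and>
      g (uw w) \<in> g ` Sw w ` K \<and> g (lw w) < g (uw w)"
      using lw_in[of w] g_strict lu[OF w] by auto
    fix v assume v: "v \<in> W m" "w \<noteq> v"
    show "g (uw w) \<le> g (lw v) \<or> g (uw v) \<le> g (lw w)"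
      using W_ordered[OF w v] g_mono lu(1,2,3)[OF w] lu(1,2,3)[OF v(1)] by (meson less_imp_le order_trans)
  qed
  then obtain ds where ds: "length ds = card (W m) - 1 \<and> (\<forall>d\<in>set ds. 0 \<le> d) \<and>
    (\<forall>\<epsilon>\<ge>0. tube (\<Union>w\<in>W m. g ` Sw w ` K) \<epsilon> =
       (\<Sum>w\<in>W m. tube (g ` Sw w ` K) \<epsilon>) - 2 * (real (card (W m)) - 1) * \<epsilon> + (\<Sum>d\<leftarrow>ds. min (2 * \<epsilon>) d))" ..
  have U: "(\<Union>w\<in>W m. g ` Sw w ` K) = g ` K" by (subst (2) K_words[of m]) (simp add: image_UN)
  have bounds: "tube (g ` K) \<epsilon> \<le> (\<Sum>w\<in>W m. tube (g ` Sw w ` K) \<epsilon>) \<and>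
    (\<Sum>w\<in>W m. tube (g ` Sw w ` K) \<epsilon>) - 2 * real (N ^ m) * \<epsilon> \<le> tube (g ` K) \<epsilon>" if "0 < \<epsilon>" for \<epsilon>
  proof -
    have "0 \<le> (\<Sum>d\<leftarrow>ds. min (2 * \<epsilon>) d)" using ds that by (intro sum_list_nonneg) auto
    moreover have "(\<Sum>d\<leftarrow>ds. min (2 * \<epsilon>) d) \<le> (\<Sum>d\<leftarrow>ds. 2 * \<epsilon>)" by (intro sum_list_mono) auto
    moreover have "1 \<le> card (W m)" using card_W[of m] N_ge by simp
    then have "(\<Sum>d\<leftarrow>ds. 2 * \<epsilon>) = 2 * (real (card (W m)) - 1) * \<epsilon>"
      using ds by (simp add: sum_list_triv of_nat_diff algebra_simps)
    moreover have "tube (g ` K) \<epsilon> = (\<Sum>w\<in>W m. tube (g ` Sw w ` K) \<epsilon>) - 2 * (real (card (W m)) - 1) * \<epsilon>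
        + (\<Sum>d\<leftarrow>ds. min (2 * \<epsilon>) d)"
      using ds that unfolding U by auto
    moreover have "2 * (real (card (W m)) - 1) * \<epsilon> \<le> 2 * real (N ^ m) * \<epsilon>"
      using that by (simp add: card_W)
    ultimately show ?thesis by linarith
  qed
  show ?thesis
  proof (rule that)
    fix \<epsilon> :: real assume \<epsilon>: "0 < \<epsilon>"
    have "(\<Sum>w\<in>W m. tube (g ` Sw w ` K) \<epsilon>) \<le> (\<Sum>w\<in>W m. (?\<gamma> w * (1 + \<eta>) * \<bar>sw w\<bar>) *
      V (\<epsilon> / (?\<gamma> w * (1 + \<eta>) * \<bar>sw w\<bar>)))"
      by (intro sum_mono conjunct2[OF piece] \<epsilon>)
    then show "tube (g ` K) \<epsilon> \<le> (\<Sum>w\<in>W m. (?\<gamma> w * (1 + \<eta>) * \<bar>sw w\<bar>) *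
      V (\<epsilon> / (?\<gamma> w * (1 + \<eta>) * \<bar>sw w\<bar>)))"
      using bounds[OF \<epsilon>] by linarith
    have "(\<Sum>w\<in>W m. (?\<gamma> w / (1 + \<eta>) * \<bar>sw w\<bar>) *
      V (\<epsilon> / (?\<gamma> w / (1 + \<eta>) * \<bar>sw w\<bar>))) \<le> (\<Sum>w\<in>W m. tube (g ` Sw w ` K) \<epsilon>)"
      by (intro sum_mono conjunct1[OF piece] \<epsilon>)
    then show "(\<Sum>w\<in>W m. (?\<gamma> w / (1 + \<eta>) * \<bar>sw w\<bar>) *
      V (\<epsilon> / (?\<gamma> w / (1 + \<eta>) * \<bar>sw w\<bar>))) - 2 * real (N ^ m) * \<epsilon> \<le> tube (g ` K) \<epsilon>"
      using bounds[OF \<epsilon>] by linarith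
  qed (use slope slope_pos in auto)
qed

text \<open>The translations by the logarithms of the slope and of \<open>\<bar>sw w\<bar>\<close>
  are kept apart: the latter is minus a sum of steps, which the limits of \<open>Z\<close> do not
  see, whereas the former ends up in the integral.\<close>

lemma scaled_tube_image_words:
  assumes "\<And>x. x \<in> {A..B} \<Longrightarrow> (g has_real_derivative gd x) (at x)"
    and "continuous_on {A..B} gd" and "\<And>x. x \<in> {A..B} \<Longrightarrow> 0 < gd x" and "0 < \<eta>"
  obtains m where
    "\<And>w. w \<in> W m \<Longrightarrow> 0 < word_slope gd w"
    "\<And>w y. w \<in> W m \<Longrightarrow> y \<in> Sw w ` {A..B} \<Longrightarrow>
      word_slope gd w / (1 + \<eta>) \<le> gd y \<and> gd y \<le> word_slope gd w * (1 + \<eta>)"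
    "\<And>t. scaled_tube \<delta> (g ` K) t \<le> (\<Sum>w\<in>W m. pw w * ((word_slope gd w * (1 + \<eta>)) powr \<delta> *
      Z (t + ln (word_slope gd w * (1 + \<eta>)) + ln \<bar>sw w\<bar>)))"
    "\<And>t. (\<Sum>w\<in>W m. pw w * ((word_slope gd w / (1 + \<eta>)) powr \<delta> *
      Z (t + ln (word_slope gd w / (1 + \<eta>)) + ln \<bar>sw w\<bar>))) - 2 * real (N ^ m) * exp (- \<delta> * t)
      \<le> scaled_tube \<delta> (g ` K) t"
proof -
  let ?\<gamma> = "word_slope gd"
  obtain m where m: "\<And>w. w \<in> W m \<Longrightarrow> 0 < ?\<gamma> w"
    "\<And>w y. w \<in> W m \<Longrightarrow> y \<in> Sw w ` {A..B} \<Longrightarrow> ?\<gamma> w / (1 + \<eta>) \<le> gd y \<and> gd y \<le> ?\<gamma> w * (1 + \<eta>)"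
    "\<And>\<epsilon>. 0 < \<epsilon> \<Longrightarrow> tube (g ` K) \<epsilon> \<le> (\<Sum>w\<in>W m. (?\<gamma> w * (1 + \<eta>) * \<bar>sw w\<bar>) *
      V (\<epsilon> / (?\<gamma> w * (1 + \<eta>) * \<bar>sw w\<bar>)))"
    "\<And>\<epsilon>. 0 < \<epsilon> \<Longrightarrow> (\<Sum>w\<in>W m. (?\<gamma> w / (1 + \<eta>) * \<bar>sw w\<bar>) *
      V (\<epsilon> / (?\<gamma> w / (1 + \<eta>) * \<bar>sw w\<bar>))) - 2 * real (N ^ m) * \<epsilon> \<le> tube (g ` K) \<epsilon>"
    by (rule tube_image_words[OF assms], assumption, assumption, rule that)
  have sum: "exp ((1 - \<delta>) * t) * (\<Sum>w\<in>W m. (c w * \<bar>sw w\<bar>) * V (exp (- t) / (c w * \<bar>sw w\<bar>)))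
    = (\<Sum>w\<in>W m. pw w * (c w powr \<delta> * Z (t + ln (c w) + ln \<bar>sw w\<bar>)))"
    if c: "\<And>w. w \<in> W m \<Longrightarrow> 0 < c w" for c t
    unfolding sum_distrib_left
  proof (rule sum.cong[OF refl])
    fix w assume w: "w \<in> W m"
    then have sw: "0 < \<bar>sw w\<bar>" using sw_nz[of w] by (simp add: W_def)
    show "exp ((1 - \<delta>) * t) * ((c w * \<bar>sw w\<bar>) * V (exp (- t) / (c w * \<bar>sw w\<bar>)))
      = pw w * (c w powr \<delta> * Z (t + ln (c w) + ln \<bar>sw w\<bar>))"
      using exp_mult_tube[of "c w * \<bar>sw w\<bar>" \<delta> t K] c[OF w] sw
      by (simp add: pw_def powr_mult ln_mult add.assoc)
  qed
  show ?thesis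
  proof (rule that)
    show "\<And>w. w \<in> W m \<Longrightarrow> 0 < ?\<gamma> w"
      "\<And>w y. w \<in> W m \<Longrightarrow> y \<in> Sw w ` {A..B} \<Longrightarrow> ?\<gamma> w / (1 + \<eta>) \<le> gd y \<and> gd y \<le> ?\<gamma> w * (1 + \<eta>)"
      by (fact m)+
    fix t
    have "scaled_tube \<delta> (g ` K) t \<le> exp ((1 - \<delta>) * t) * (\<Sum>w\<in>W m. (?\<gamma> w * (1 + \<eta>) * \<bar>sw w\<bar>) *
      V (exp (- t) / (?\<gamma> w * (1 + \<eta>) * \<bar>sw w\<bar>)))"
      unfolding scaled_tube_def[of \<delta> "g ` K"] by (intro mult_left_mono m) auto
    also have "\<dots> = (\<Sum>w\<in>W m. pw w * ((?\<gamma> w * (1 + \<eta>)) powr \<delta> * Z (t + ln (?\<gamma> w * (1 + \<eta>)) + ln \<bar>sw w\<bar>)))"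
      by (rule sum) (use m(1) \<open>0 < \<eta>\<close> in simp)
    finally show "scaled_tube \<delta> (g ` K) t \<le> \<dots>" .
    have "(\<Sum>w\<in>W m. pw w * ((?\<gamma> w / (1 + \<eta>)) powr \<delta> * Z (t + ln (?\<gamma> w / (1 + \<eta>)) + ln \<bar>sw w\<bar>)))
        - 2 * real (N ^ m) * exp (- \<delta> * t)
      = exp ((1 - \<delta>) * t) * ((\<Sum>w\<in>W m. (?\<gamma> w / (1 + \<eta>) * \<bar>sw w\<bar>) *
      V (exp (- t) / (?\<gamma> w / (1 + \<eta>) * \<bar>sw w\<bar>))) - 2 * real (N ^ m) * exp (- t))"
    proof -
      have "exp ((1 - \<delta>) * t) * (2 * real (N ^ m) * exp (- t)) = 2 * real (N ^ m) * exp (- \<delta> * t)"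
        by (simp add: exp_add[symmetric] algebra_simps)
      then show ?thesis
        unfolding right_diff_distrib[of "exp ((1 - \<delta>) * t)"]
        by (subst sum) (use m(1) \<open>0 < \<eta>\<close> in \<open>simp_all only: zero_less_divide_iff\<close>, auto)
    qed
    also have "\<dots> \<le> scaled_tube \<delta> (g ` K) t"
      unfolding scaled_tube_def[of \<delta> "g ` K"] by (intro mult_left_mono m) auto
    finally show "(\<Sum>w\<in>W m. pw w * ((?\<gamma> w / (1 + \<eta>)) powr \<delta> * Z (t + ln (?\<gamma> w / (1 + \<eta>)) + ln \<bar>sw w\<bar>)))
        - 2 * real (N ^ m) * exp (- \<delta> * t) \<le> scaled_tube \<delta> (g ` K) t" .
  qed
qed

section \<open>Word sums and integrals of slope functions\<close>

lemma continuous_pos_bounds: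
  assumes "continuous_on {A..B} gd" and "\<And>x. x \<in> {A..B} \<Longrightarrow> 0 < (gd x :: real)"
  obtains c C where "0 < c" "\<And>x. x \<in> {A..B} \<Longrightarrow> c \<le> gd x \<and> gd x \<le> C"
proof -
  obtain x where x: "x \<in> {A..B}" "\<forall>y\<in>{A..B}. gd x \<le> gd y"
    using continuous_attains_inf[OF _ _ assms(1)] AB(1) by auto
  obtain y where "\<forall>z\<in>{A..B}. gd z \<le> gd y"
    using continuous_attains_sup[OF _ _ assms(1)] AB(1) by auto
  then show ?thesis using that[of "gd x" "gd y"] x assms(2) by auto
qed

text \<open>\<open>Q\<close> will be \<open>x powr \<delta> * P (ln x)\<close> for a limit profile
  \<open>P\<close> that inherits \<open>growth\<close> but perhaps no continuity. Monotonicity of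
  \<open>Q x / x\<close> is what growth becomes; it yields measurability and bounds on compact
  ranges of slopes.\<close>

lemma set_integrable_slope_function:
  assumes cont: "continuous_on {A..B} gd" and pos: "\<And>x. x \<in> {A..B} \<Longrightarrow> 0 < gd x"
    and Q: "\<And>x. 0 < x \<Longrightarrow> 0 \<le> Q x" "\<And>x y. 0 < x \<Longrightarrow> x \<le> y \<Longrightarrow> Q y / y \<le> Q x / (x::real)"
  shows "set_integrable \<nu> K (\<lambda>x. Q (gd x))"
proof -
  obtain c C where c: "0 < c" "\<And>x. x \<in> {A..B} \<Longrightarrow> c \<le> gd x \<and> gd x \<le> C"
    using continuous_pos_bounds[OF cont pos] by blast
  \<comment> \<open>Cutting off at the lower bound \<open>c\<close> of the slopes extends the
    monotone quotient to the whole line without changing it on the range of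
    \<open>gd\<close>.\<close>
  define h where "h x = - (Q (max c x) / max c x)" for x
  have "mono h" unfolding h_def using c(1) Q(2) by (intro monoI) auto
  then have h: "h \<in> borel_measurable borel" by (rule borel_measurable_mono)
  define k where "k x = indicator K x *\<^sub>R gd x" for x
  have k: "k \<in> borel_measurable borel"
    unfolding k_def[abs_def] using AB
    by (intro borel_measurable_continuous_on_indicator continuous_on_subset[OF cont]) (auto simp: borel_compact)
  have "(\<lambda>x. indicator K x *\<^sub>R (max c (k x) * - h (k x))) \<in> borel_measurable borel"
    using h k borel_compact[OF AB(5)] by measurable
  also have eq: "(\<lambda>x. indicator K x *\<^sub>R (max c (k x) * - h (k x))) = (\<lambda>x. indicator K x *\<^sub>R Q (gd x))"
  proof
    fix x
    show "indicator K x *\<^sub>R (max c (k x) * - h (k x)) = indicator K x *\<^sub>R Q (gd x)"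
    proof (cases "x \<in> K")
      case True
      then have "c \<le> gd x" using c(2) AB(4) by blast
      then show ?thesis using True c(1) by (simp add: k_def h_def max_def)
    qed simp
  qed
  finally have meas: "(\<lambda>x. indicator K x *\<^sub>R Q (gd x)) \<in> borel_measurable \<nu>"
    by (simp add: measurable_cong_sets[OF sets_nu refl])
  have bound: "norm (indicator K x *\<^sub>R Q (gd x)) \<le> C * (Q c / c)" for x
  proof (cases "x \<in> K")
    case True
    then have x: "c \<le> gd x" "gd x \<le> C" using c(2) AB(4) by auto
    have "Q (gd x) = gd x * (Q (gd x) / gd x)" using x c(1) by simp
    also have "\<dots> \<le> C * (Q c / c)"
      using x c(1) Q by (intro mult_mono) auto
    finally show ?thesis using True Q(1)[of "gd x"] x c(1) by simp
  next
    case False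
    have "c \<le> C" using c(2)[of A] AB(1) by auto
    then show ?thesis using False Q(1)[of c] c(1) by simp
  qed
  show ?thesis
    unfolding set_integrable_def
    by (rule integrable_const_bound[OF _ meas]) (use bound in auto)
qed

text \<open>If \<open>x \<le> y \<le> (1 + \<eta>)\<^sup>2 * x\<close>, monotonicity of the quotient
  yields \<open>Q y \<le> (1 + \<eta>)\<^sup>2 * Q x\<close>. This compares the estimated slope of a
  piece with the true slope at its points, and integration over the piece does the rest.\<close>

lemma word_sum_bounds:
  assumes cont: "continuous_on {A..B} gd" and pos: "\<And>x. x \<in> {A..B} \<Longrightarrow> 0 < gd x"
    and Q: "\<And>x. 0 < x \<Longrightarrow> 0 \<le> Q x" "\<And>x y. 0 < x \<Longrightarrow> x \<le> y \<Longrightarrow> Q y / y \<le> Q x / (x::real)"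
    and "0 < \<eta>" and \<gamma>: "\<And>w. w \<in> W m \<Longrightarrow> 0 < word_slope gd w"
    and slope: "\<And>w y. w \<in> W m \<Longrightarrow> y \<in> Sw w ` {A..B} \<Longrightarrow>
      word_slope gd w / (1 + \<eta>) \<le> gd y \<and> gd y \<le> word_slope gd w * (1 + \<eta>)"
  shows "(\<Sum>w\<in>W m. pw w * Q (word_slope gd w * (1 + \<eta>))) \<le> (1 + \<eta>)\<^sup>2 * (LINT x:K|\<nu>. Q (gd x))"
    "(LINT x:K|\<nu>. Q (gd x)) / (1 + \<eta>)\<^sup>2 \<le> (\<Sum>w\<in>W m. pw w * Q (word_slope gd w / (1 + \<eta>)))"
proof -
  have int: "set_integrable \<nu> K (\<lambda>x. Q (gd x))"
    by (rule set_integrable_slope_function[OF cont pos Q])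
  have scale: "Q y \<le> (1 + \<eta>)\<^sup>2 * Q x" if "0 < x" "x \<le> y" "y \<le> (1 + \<eta>)\<^sup>2 * x" for x y
  proof -
    have "Q y = y * (Q y / y)" using that by simp
    also have "\<dots> \<le> ((1 + \<eta>)\<^sup>2 * x) * (Q x / x)" using that Q by (intro mult_mono) auto
    finally show ?thesis using that by simp
  qed
  have gd: "0 < gd y" "y \<in> Sw w ` {A..B}" if "w \<in> W m" "y \<in> Sw w ` K" for w y
  proof -
    have "y \<in> K" using Sw_maps(3)[of w] that unfolding W_def by blast
    then have "y \<in> {A..B}" using AB(4) by blast
    then show "0 < gd y" by (rule pos)
    show "y \<in> Sw w ` {A..B}" using that(2) AB(4) by blast
  qed
  have "(\<Sum>w\<in>W m. pw w * (Q (word_slope gd w * (1 + \<eta>)) / (1 + \<eta>)\<^sup>2)) \<le> (LINT x:K|\<nu>. Q (gd x))"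
  proof (rule sum_pw_le_integral[OF int])
    fix w y assume wy: "w \<in> W m" "y \<in> Sw w ` K"
    have "word_slope gd w \<le> gd y * (1 + \<eta>)"
      using slope[OF wy(1) gd(2)[OF wy]] \<open>0 < \<eta>\<close> by (simp add: pos_divide_le_eq)
    then have "word_slope gd w * (1 + \<eta>) \<le> gd y * (1 + \<eta>) * (1 + \<eta>)"
      using \<open>0 < \<eta>\<close> by (intro mult_right_mono) auto
    then have "word_slope gd w * (1 + \<eta>) \<le> (1 + \<eta>)\<^sup>2 * gd y"
      by (simp add: power2_eq_square mult.commute mult.left_commute)
    then have "Q (word_slope gd w * (1 + \<eta>)) \<le> (1 + \<eta>)\<^sup>2 * Q (gd y)"
      using slope[OF wy(1) gd(2)[OF wy]] gd(1)[OF wy] by (intro scale) auto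
    then show "Q (word_slope gd w * (1 + \<eta>)) / (1 + \<eta>)\<^sup>2 \<le> Q (gd y)"
      using \<open>0 < \<eta>\<close> by (simp add: pos_divide_le_eq mult.commute)
  qed
  then show "(\<Sum>w\<in>W m. pw w * Q (word_slope gd w * (1 + \<eta>))) \<le> (1 + \<eta>)\<^sup>2 * (LINT x:K|\<nu>. Q (gd x))"
    using \<open>0 < \<eta>\<close> by (simp add: sum_divide_distrib[symmetric] pos_divide_le_eq mult.commute)
  have "(LINT x:K|\<nu>. Q (gd x)) \<le> (\<Sum>w\<in>W m. pw w * ((1 + \<eta>)\<^sup>2 * Q (word_slope gd w / (1 + \<eta>))))"
  proof (rule integral_le_sum_pw[OF int])
    fix w y assume wy: "w \<in> W m" "y \<in> Sw w ` K"
    have "(1 + \<eta>)\<^sup>2 * (word_slope gd w / (1 + \<eta>)) = word_slope gd w * (1 + \<eta>)"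
      using \<open>0 < \<eta>\<close> by (simp add: power2_eq_square)
    then have "gd y \<le> (1 + \<eta>)\<^sup>2 * (word_slope gd w / (1 + \<eta>))"
      using slope[OF wy(1) gd(2)[OF wy]] by simp
    then show "Q (gd y) \<le> (1 + \<eta>)\<^sup>2 * Q (word_slope gd w / (1 + \<eta>))"
      using slope[OF wy(1) gd(2)[OF wy]] \<gamma>[OF wy(1)] \<open>0 < \<eta>\<close> by (intro scale) auto
  qed
  also have "\<dots> = (1 + \<eta>)\<^sup>2 * (\<Sum>w\<in>W m. pw w * Q (word_slope gd w / (1 + \<eta>)))"
    by (simp add: sum_distrib_left mult.left_commute)
  finally show "(LINT x:K|\<nu>. Q (gd x)) / (1 + \<eta>)\<^sup>2 \<le> (\<Sum>w\<in>W m. pw w * Q (word_slope gd w / (1 + \<eta>)))"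
    using \<open>0 < \<eta>\<close> by (simp add: pos_divide_le_eq mult.commute)
qed

lemma powr_antimono_quotient:
  assumes "0 \<le> M" "0 < x" "x \<le> y"
  shows "M * y powr \<delta> / y \<le> M * x powr \<delta> / x"
proof -
  have "y powr (\<delta> - 1) \<le> x powr (\<delta> - 1)"
    using assms delta_less_1 by (intro powr_mono2') auto
  then show ?thesis
    using assms by (simp add: powr_diff mult_left_mono flip: times_divide_eq_right)
qed

text \<open>\<open>F\<close> and \<open>P\<close> cover two cases: all large times with a constant
  \<open>P\<close>, and a coset of the lattice with the periodic limit. The hypothesis on
  \<open>P\<close> contains the required invariance, as its limit may not depend on the word
  \<open>w\<close>.\<close>

lemma scaled_tube_image_tendsto:
  assumes g: "\<And>x. x \<in> {A..B} \<Longrightarrow> (g has_real_derivative gd x) (at x)"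
    "continuous_on {A..B} gd" "\<And>x. x \<in> {A..B} \<Longrightarrow> 0 < gd x"
    and F: "F \<le> at_top" "F \<noteq> bot"
    and P: "\<And>w x. set w \<subseteq> {1..N} \<Longrightarrow> ((\<lambda>t. Z (t + x + ln \<bar>sw w\<bar>)) \<longlongrightarrow> P x) F"
  shows "((scaled_tube \<delta> (g ` K)) \<longlongrightarrow> (LINT x:K|\<nu>. gd x powr \<delta> * P (ln (gd x)))) F"
proof (rule tendsto_squeeze_factor)
  fix \<eta> :: real assume "0 < \<eta>"
  define Q where "Q x = x powr \<delta> * P (ln x)" for x
  have P0: "((\<lambda>t. Z (t + x)) \<longlongrightarrow> P x) F" for x using P[of "[]" x] by simp
  have "0 \<le> P x" for x
    by (rule tendsto_lowerbound[OF P0 _ F(2)]) (simp add: scaled_tube_nonneg)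
  then have Q0: "0 \<le> Q x" for x by (simp add: Q_def)
  have Q1: "Q y / y \<le> Q x / x" if "0 < x" "x \<le> y" for x y
  proof -
    have "((\<lambda>t. exp ((1 - \<delta>) * (ln y - ln x)) * Z (t + ln x)) \<longlongrightarrow> exp ((1 - \<delta>) * (ln y - ln x)) * P (ln x)) F"
      by (intro tendsto_intros P0)
    moreover have "Z (t + ln y) \<le> exp ((1 - \<delta>) * (ln y - ln x)) * Z (t + ln x)" for t
      using growth[of "t + ln x" "t + ln y"] that by simp
    ultimately have "P (ln y) \<le> exp ((1 - \<delta>) * (ln y - ln x)) * P (ln x)"
      by (rule tendsto_le[OF F(2) _ P0 always_eventually[OF allI]])
    then have "Q y / y \<le> (y powr \<delta> / y) * (exp ((1 - \<delta>) * (ln y - ln x)) * P (ln x))"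
      using that unfolding Q_def by (simp add: mult_left_mono divide_right_mono)
    also have "\<dots> = Q x / x"
    proof -
      have "y powr \<delta> / y = exp ((\<delta> - 1) * ln y)" "x powr \<delta> / x = exp ((\<delta> - 1) * ln x)"
        using that by (simp_all add: powr_def exp_diff left_diff_distrib)
      moreover have "exp ((\<delta> - 1) * ln y) * exp ((1 - \<delta>) * (ln y - ln x)) = exp ((\<delta> - 1) * ln x)"
        by (simp add: exp_add[symmetric] algebra_simps)
      moreover have "Q x / x = (x powr \<delta> / x) * P (ln x)" by (simp add: Q_def)
      ultimately show ?thesis by (simp only: mult.assoc[symmetric])
    qed
    finally show ?thesis .
  qed
  obtain m where m: "\<And>w. w \<in> W m \<Longrightarrow> 0 < word_slope gd w"
    "\<And>w y. w \<in> W m \<Longrightarrow> y \<in> Sw w ` {A..B} \<Longrightarrow>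
      word_slope gd w / (1 + \<eta>) \<le> gd y \<and> gd y \<le> word_slope gd w * (1 + \<eta>)"
    "\<And>t. scaled_tube \<delta> (g ` K) t \<le> (\<Sum>w\<in>W m. pw w * ((word_slope gd w * (1 + \<eta>)) powr \<delta> *
      Z (t + ln (word_slope gd w * (1 + \<eta>)) + ln \<bar>sw w\<bar>)))"
    "\<And>t. (\<Sum>w\<in>W m. pw w * ((word_slope gd w / (1 + \<eta>)) powr \<delta> *
      Z (t + ln (word_slope gd w / (1 + \<eta>)) + ln \<bar>sw w\<bar>))) - 2 * real (N ^ m) * exp (- \<delta> * t)
      \<le> scaled_tube \<delta> (g ` K) t"
    by (rule scaled_tube_image_words[OF g \<open>0 < \<eta>\<close>], assumption, assumption, rule that)
  have lim: "((\<lambda>t. \<Sum>w\<in>W m. pw w * (c w powr \<delta> * Z (t + ln (c w) + ln \<bar>sw w\<bar>)))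
      \<longlongrightarrow> (\<Sum>w\<in>W m. pw w * Q (c w))) F" for c
    unfolding Q_def by (intro tendsto_sum tendsto_mult tendsto_const P) (auto simp: W_def)
  have exp0: "((\<lambda>t. 2 * real (N ^ m) * exp (- \<delta> * t)) \<longlongrightarrow> 0) F"
    using tendsto_mult_right_zero[OF filterlim_mono[OF exp_delta_tendsto_0 order_refl F(1)]] by simp
  have sums: "(\<Sum>w\<in>W m. pw w * Q (word_slope gd w * (1 + \<eta>))) \<le> (1 + \<eta>)\<^sup>2 * (LINT x:K|\<nu>. Q (gd x))"
    "(LINT x:K|\<nu>. Q (gd x)) / (1 + \<eta>)\<^sup>2 \<le> (\<Sum>w\<in>W m. pw w * Q (word_slope gd w / (1 + \<eta>)))"
    by (rule word_sum_bounds[OF g(2,3) Q0 Q1 \<open>0 < \<eta>\<close> m(1,2)]; assumption)+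
  show "\<exists>u l U U'. (\<forall>\<^sub>F t in F. scaled_tube \<delta> (g ` K) t \<le> u t) \<and> (\<forall>\<^sub>F t in F. l t \<le> scaled_tube \<delta> (g ` K) t) \<and>
    (u \<longlongrightarrow> U) F \<and> (l \<longlongrightarrow> U') F \<and> U \<le> (1 + \<eta>)\<^sup>2 * (LINT x:K|\<nu>. gd x powr \<delta> * P (ln (gd x))) \<and>
    (LINT x:K|\<nu>. gd x powr \<delta> * P (ln (gd x))) / (1 + \<eta>)\<^sup>2 \<le> U'"
    using always_eventually[OF allI[OF m(3)]] always_eventually[OF allI[OF m(4)]]
      lim[of "\<lambda>w. word_slope gd w * (1 + \<eta>)"]
      tendsto_diff[OF lim[of "\<lambda>w. word_slope gd w / (1 + \<eta>)"] exp0] sums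
    unfolding Q_def diff_zero by (intro exI conjI)
qed

lemma Cesaro_exp_delta: "((\<lambda>T. integral {0..T} (\<lambda>t. exp (- \<delta> * t)) / T) \<longlongrightarrow> 0) at_top"
proof (rule lhospital_at_top_at_top[where g'="\<lambda>_. 1" and f'="\<lambda>t. exp (- \<delta> * t)"])
  show "\<forall>\<^sub>F T in at_top. ((\<lambda>T. integral {0..T} (\<lambda>t. exp (- \<delta> * t))) has_real_derivative exp (- \<delta> * T)) (at T)"
    using eventually_gt_at_top[of 0]
  proof eventually_elim
    case (elim T)
    have "((\<lambda>T. integral {0..T} (\<lambda>t. exp (- \<delta> * t))) has_real_derivative exp (- \<delta> * T)) (at T within {0..T + 1})"
      using elim by (intro integral_has_real_derivative continuous_intros) auto
    moreover have "T \<in> interior {0..T + 1}" using elim by simp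
    ultimately show ?case by (metis at_within_interior)
  qed
qed (use exp_delta_tendsto_0 in \<open>auto intro: filterlim_ident\<close>)

text \<open>Pointwise limits of the translates of \<open>Z\<close> are replaced by their Cesaro
  means. These all equal \<open>L / \<mu>\<close>, so the translations that depend on words and
  slopes disappear, lattice or not.\<close>

lemma Cesaro_scaled_tube_image:
  assumes g: "\<And>x. x \<in> {A..B} \<Longrightarrow> (g has_real_derivative gd x) (at x)"
    "continuous_on {A..B} gd" "\<And>x. x \<in> {A..B} \<Longrightarrow> 0 < gd x"
  shows "((\<lambda>T. integral {0..T} (scaled_tube \<delta> (g ` K)) / T) \<longlongrightarrow>
    L / \<mu> * (LINT x:K|\<nu>. gd x powr \<delta>)) at_top"
proof (rule tendsto_squeeze_factor)
  fix \<eta> :: real assume "0 < \<eta>"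
  define Q where "Q x = (L / \<mu>) * x powr \<delta>" for x
  have Q0: "0 \<le> Q x" for x unfolding Q_def using L_pos by (intro mult_nonneg_nonneg) auto
  have Q1: "Q y / y \<le> Q x / x" if "0 < x" "x \<le> y" for x y
    unfolding Q_def using L_pos that by (intro powr_antimono_quotient) auto
  obtain m where m: "\<And>w. w \<in> W m \<Longrightarrow> 0 < word_slope gd w"
    "\<And>w y. w \<in> W m \<Longrightarrow> y \<in> Sw w ` {A..B} \<Longrightarrow>
      word_slope gd w / (1 + \<eta>) \<le> gd y \<and> gd y \<le> word_slope gd w * (1 + \<eta>)"
    "\<And>t. scaled_tube \<delta> (g ` K) t \<le> (\<Sum>w\<in>W m. pw w * ((word_slope gd w * (1 + \<eta>)) powr \<delta> *
      Z (t + ln (word_slope gd w * (1 + \<eta>)) + ln \<bar>sw w\<bar>)))"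
    "\<And>t. (\<Sum>w\<in>W m. pw w * ((word_slope gd w / (1 + \<eta>)) powr \<delta> *
      Z (t + ln (word_slope gd w / (1 + \<eta>)) + ln \<bar>sw w\<bar>))) - 2 * real (N ^ m) * exp (- \<delta> * t)
      \<le> scaled_tube \<delta> (g ` K) t"
    by (rule scaled_tube_image_words[OF g \<open>0 < \<eta>\<close>], assumption, assumption, rule that)
  let ?S = "\<lambda>c t. \<Sum>w\<in>W m. pw w * (c w powr \<delta> * Z (t + (ln (c w) + ln \<bar>sw w\<bar>)))"
  let ?I = "\<lambda>c T. \<Sum>w\<in>W m. pw w * (c w powr \<delta> * (integral {0..T} (\<lambda>t. Z (t + (ln (c w) + ln \<bar>sw w\<bar>))) / T))"
  have Z_int: "(\<lambda>t. Z (t + x)) integrable_on {0..T}" for x T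
    using Z_shift_integrable[of "- x" 0 T] by simp
  have S_int: "?S c integrable_on {0..T}" for c T
    using finite_W by (intro integrable_sum integrable_on_mult_right Z_int)
  have I_eq: "integral {0..T} (?S c) / T = ?I c T" for c T
    using finite_W Z_int
    by (simp add: integral_sum integrable_on_mult_right sum_divide_distrib)
  have lim: "(?I c \<longlongrightarrow> (\<Sum>w\<in>W m. pw w * Q (c w))) at_top" for c
    unfolding Q_def mult.commute[of "L / \<mu>"]
    by (intro tendsto_sum tendsto_mult tendsto_const Cesaro_Z_shift)
  have gK: "compact (g ` K)" "g ` K \<noteq> {}"
  proof -
    have "continuous_on {A..B} g"
      using g(1) by (meson DERIV_isCont continuous_at_imp_continuous_on)
    then show "compact (g ` K)" "g ` K \<noteq> {}"
      using AB K_ne by (auto intro!: compact_continuous_image intro: continuous_on_subset)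
  qed
  have gK_int: "scaled_tube \<delta> (g ` K) integrable_on {0..T}" for T
    by (intro integrable_continuous_real continuous_on_scaled_tube gK)
  have exp_int: "(\<lambda>t. exp (- \<delta> * t)) integrable_on {0..T}" for T
    by (rule integrable_continuous_real) (intro continuous_intros)
  have up: "\<forall>\<^sub>F T in at_top. integral {0..T} (scaled_tube \<delta> (g ` K)) / T \<le> ?I (\<lambda>w. word_slope gd w * (1 + \<eta>)) T"
    using eventually_gt_at_top[of 0]
  proof eventually_elim
    case (elim T)
    have "integral {0..T} (scaled_tube \<delta> (g ` K)) \<le> integral {0..T} (?S (\<lambda>w. word_slope gd w * (1 + \<eta>)))"
      using m(3) by (intro integral_le gK_int S_int) (simp add: add.assoc)
    then show ?case unfolding I_eq[symmetric] using elim by (intro divide_right_mono) auto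
  qed
  have low: "\<forall>\<^sub>F T in at_top. ?I (\<lambda>w. word_slope gd w / (1 + \<eta>)) T
      - 2 * real (N ^ m) * (integral {0..T} (\<lambda>t. exp (- \<delta> * t)) / T)
      \<le> integral {0..T} (scaled_tube \<delta> (g ` K)) / T"
    using eventually_gt_at_top[of 0]
  proof eventually_elim
    case (elim T)
    have "integral {0..T} (\<lambda>t. ?S (\<lambda>w. word_slope gd w / (1 + \<eta>)) t - 2 * real (N ^ m) * exp (- \<delta> * t))
      \<le> integral {0..T} (scaled_tube \<delta> (g ` K))"
      using m(4) by (intro integral_le gK_int integrable_diff S_int integrable_on_mult_right exp_int)
        (simp add: add.assoc)
    also have "integral {0..T} (\<lambda>t. ?S (\<lambda>w. word_slope gd w / (1 + \<eta>)) t - 2 * real (N ^ m) * exp (- \<delta> * t))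
      = integral {0..T} (?S (\<lambda>w. word_slope gd w / (1 + \<eta>))) - 2 * real (N ^ m) * integral {0..T} (\<lambda>t. exp (- \<delta> * t))"
      by (subst integral_diff) (intro S_int integrable_on_mult_right exp_int | simp)+
    finally have "(integral {0..T} (?S (\<lambda>w. word_slope gd w / (1 + \<eta>))) - 2 * real (N ^ m) * integral {0..T} (\<lambda>t. exp (- \<delta> * t))) / T
      \<le> integral {0..T} (scaled_tube \<delta> (g ` K)) / T"
      using elim by (intro divide_right_mono) auto
    then show ?case unfolding I_eq[symmetric] by (simp add: diff_divide_distrib)
  qed
  have exp0: "((\<lambda>T. 2 * real (N ^ m) * (integral {0..T} (\<lambda>t. exp (- \<delta> * t)) / T)) \<longlongrightarrow> 0) at_top"
    by (rule tendsto_mult_right_zero[OF Cesaro_exp_delta])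
  have sums: "(\<Sum>w\<in>W m. pw w * Q (word_slope gd w * (1 + \<eta>))) \<le> (1 + \<eta>)\<^sup>2 * (LINT x:K|\<nu>. Q (gd x))"
    "(LINT x:K|\<nu>. Q (gd x)) / (1 + \<eta>)\<^sup>2 \<le> (\<Sum>w\<in>W m. pw w * Q (word_slope gd w / (1 + \<eta>)))"
    by (rule word_sum_bounds[OF g(2,3) Q0 Q1 \<open>0 < \<eta>\<close> m(1,2)]; assumption)+
  have Qint: "(LINT x:K|\<nu>. Q (gd x)) = L / \<mu> * (LINT x:K|\<nu>. gd x powr \<delta>)"
    unfolding Q_def by simp
  show "\<exists>u l U U'. (\<forall>\<^sub>F T in at_top. integral {0..T} (scaled_tube \<delta> (g ` K)) / T \<le> u T) \<and>
    (\<forall>\<^sub>F T in at_top. l T \<le> integral {0..T} (scaled_tube \<delta> (g ` K)) / T) \<and>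
    (u \<longlongrightarrow> U) at_top \<and> (l \<longlongrightarrow> U') at_top \<and> U \<le> (1 + \<eta>)\<^sup>2 * (L / \<mu> * (LINT x:K|\<nu>. gd x powr \<delta>)) \<and>
    L / \<mu> * (LINT x:K|\<nu>. gd x powr \<delta>) / (1 + \<eta>)\<^sup>2 \<le> U'"
    using up low lim[of "\<lambda>w. word_slope gd w * (1 + \<eta>)"]
      tendsto_diff[OF lim[of "\<lambda>w. word_slope gd w / (1 + \<eta>)"] exp0] sums
    unfolding Qint diff_zero by (intro exI conjI)
qed

end

section \<open>The lattice case\<close>

text \<open>The interval is kept shorter than \<open>\<alpha>\<close>, so that a further point has
  at most one translate in it, and a smaller interval beside that translate is still free. It will
  supply radii away from the kinks of the gap terms at all scales.\<close>

lemma avoid_translates: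
  fixes D :: "real set"
  assumes "finite D" "0 < \<alpha>"
  obtains x y where "x < y" "\<And>d k. d \<in> D \<Longrightarrow> d + of_int k * \<alpha> \<notin> {x..y}"
proof -
  have "\<exists>x y. x < y \<and> y - x < \<alpha> \<and> (\<forall>d\<in>D. \<forall>k::int. d + of_int k * \<alpha> \<notin> {x..y})"
    using assms(1)
  proof (induction D)
    case empty
    show ?case by (rule exI[of _ 0], rule exI[of _ "\<alpha> / 2"]) (use assms(2) in auto)
  next
    case (insert d D)
    then obtain x y where xy: "x < y" "y - x < \<alpha>" "\<forall>d\<in>D. \<forall>k::int. d + of_int k * \<alpha> \<notin> {x..y}" by blast
    show ?case
    proof (cases "\<exists>k::int. d + of_int k * \<alpha> \<in> {x..y}")
      case False
      then show ?thesis using xy by blast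
    next
      case True
      then obtain k0 :: int where k0: "d + of_int k0 * \<alpha> \<in> {x..y}" by blast
      have other: "d + of_int k * \<alpha> \<notin> {x..y}" if "k \<noteq> k0" for k :: int
      proof
        assume k: "d + of_int k * \<alpha> \<in> {x..y}"
        have "1 \<le> \<bar>real_of_int (k - k0)\<bar>" using that by linarith
        then have "1 * \<alpha> \<le> \<bar>real_of_int (k - k0)\<bar> * \<alpha>" using assms(2) by (intro mult_right_mono) auto
        also have "\<dots> = \<bar>(d + of_int k * \<alpha>) - (d + of_int k0 * \<alpha>)\<bar>"
          using assms(2) by (simp add: abs_mult left_diff_distrib[symmetric])
        also have "\<dots> \<le> y - x" using k k0 unfolding abs_le_iff atLeastAtMost_iff by linarith
        finally show False using xy(2) by simp
      qed
      define z where "z = d + of_int k0 * \<alpha>"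
      have zin: "x \<le> z" "z \<le> y" using k0 by (auto simp: z_def)
      obtain x' y' where x'y': "x \<le> x'" "x' < y'" "y' \<le> y" "z \<notin> {x'..y'}"
      proof (cases "z < y")
        case True
        then show ?thesis using that[of "(z + y) / 2" y] zin by auto
      next
        case False
        then show ?thesis using that[of x "(x + y) / 2"] xy(1) zin by auto
      qed
      have sub: "{x'..y'} \<subseteq> {x..y}" using x'y' by auto
      have "d + of_int k * \<alpha> \<notin> {x'..y'}" for k :: int
        using other[of k] x'y'(4) sub unfolding z_def by (cases "k = k0") auto
      then have "\<forall>d\<in>insert d D. \<forall>k::int. d + of_int k * \<alpha> \<notin> {x'..y'}" using xy(3) sub by blast
      moreover have "x' < y'" "y' - x' < \<alpha>" using x'y' xy(2) by auto
      ultimately show ?thesis by blast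
    qed
  qed
  then show ?thesis using that by blast
qed

lemma sum_list_affine:
  fixes f :: "'a \<Rightarrow> real \<Rightarrow> real"
  assumes "\<And>d. d \<in> set ds \<Longrightarrow> \<exists>p q. \<forall>\<epsilon>\<in>E. f d \<epsilon> = p + q * \<epsilon>"
  shows "\<exists>p q. \<forall>\<epsilon>\<in>E. (\<Sum>d\<leftarrow>ds. f d \<epsilon>) = p + q * \<epsilon>"
  using assms
proof (induction ds)
  case Nil
  show ?case by (intro exI[of _ 0]) simp
next
  case (Cons d ds)
  then obtain p q p' q' where "\<forall>\<epsilon>\<in>E. (\<Sum>d\<leftarrow>ds. f d \<epsilon>) = p + q * \<epsilon>" "\<forall>\<epsilon>\<in>E. f d \<epsilon> = p' + q' * \<epsilon>"
    by (metis list.set_intros)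
  then have "\<forall>\<epsilon>\<in>E. (\<Sum>d\<leftarrow>d # ds. f d \<epsilon>) = (p + p') + (q + q') * \<epsilon>" by (simp add: algebra_simps)
  then show ?case by blast
qed

text \<open>Affinity is expressed as interpolation between \<open>u\<close> and \<open>v\<close>,
  without coefficients, so that it passes to pointwise limits of affine functions. It would force
  the derivative to be constant, but that of \<open>x powr e\<close> is strictly decreasing.\<close>

lemma powr_not_affine:
  fixes c e :: real
  assumes "0 < c" "0 < e" "e < 1" "0 < u" "u < v"
    and affine: "\<And>x. x \<in> {u..v} \<Longrightarrow> c * x powr e * (v - u) = c * u powr e * (v - x) + c * v powr e * (x - u)"
  shows False
proof -
  define k where "k = (c * v powr e - c * u powr e) / (v - u)"
  have val: "c * x powr e = c * u powr e + k * (x - u)" if "x \<in> {u..v}" for x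
  proof -
    have kv: "k * (v - u) = c * v powr e - c * u powr e" using assms(5) by (simp add: k_def)
    have "(c * u powr e + k * (x - u)) * (v - u)
        = c * u powr e * (v - u) + (k * (v - u)) * (x - u)"
      by (simp add: algebra_simps)
    also have "\<dots> = c * u powr e * (v - u) + (c * v powr e - c * u powr e) * (x - u)"
      unfolding kv ..
    also have "\<dots> = c * u powr e * (v - x) + c * v powr e * (x - u)" by (simp add: algebra_simps)
    finally have "c * x powr e * (v - u) = (c * u powr e + k * (x - u)) * (v - u)"
      using affine[OF that] by simp
    then show ?thesis using assms(5) by simp
  qed
  have slope: "c * (e * x powr (e - 1)) = k" if x: "x \<in> {u<..<v}" for x
  proof -
    have "((\<lambda>x. c * x powr e) has_real_derivative c * (e * x powr (e - 1))) (at x)"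
      using x assms(4) by (auto intro!: derivative_eq_intros)
    moreover have "((\<lambda>x. c * u powr e + k * (x - u)) has_real_derivative k) (at x)"
      by (auto intro!: derivative_eq_intros)
    then have "((\<lambda>x. c * x powr e) has_real_derivative k) (at x)"
      by (rule has_field_derivative_transform_within_open[OF _ open_greaterThanLessThan x])
        (rule val[symmetric], simp)
    ultimately show ?thesis by (rule DERIV_unique)
  qed
  define x y where "x = (2 * u + v) / 3" and "y = (u + 2 * v) / 3"
  have xy: "x \<in> {u<..<v}" "y \<in> {u<..<v}" "x < y" using assms(5) by (auto simp: x_def y_def)
  then have "c * (e * x powr (e - 1)) = c * (e * y powr (e - 1))" using slope by metis
  then have "x powr (e - 1) = y powr (e - 1)" using assms(1,2) by simp
  moreover have "y powr (e - 1) < x powr (e - 1)"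
    using xy assms(3,4) by (intro powr_less_mono2_neg) auto
  ultimately show False by simp
qed

text \<open>The convergence is not assumed to be uniform in the coset. Finitely many cosets at
  distance \<open>d\<close> suffice, since \<open>growth\<close> controls \<open>f\<close> in
  between at the cost of a factor \<open>exp (\<kappa> * d)\<close>.\<close>

lemma tendsto_at_top_if_along_lattice:
  fixes f :: "real \<Rightarrow> real"
  assumes growth: "\<And>s t. s \<le> t \<Longrightarrow> f t \<le> exp (\<kappa> * (t - s)) * f s" and "0 \<le> \<kappa>"
    and nonneg: "\<And>t. 0 \<le> f t" and "0 < \<alpha>"
    and lim: "\<And>t0. (\<lambda>k. f (t0 + real k * \<alpha>)) \<longlonglongrightarrow> M"
  shows "(f \<longlongrightarrow> M) at_top"
proof -
  have M: "0 \<le> M" by (rule LIMSEQ_le_const[OF lim[of 0]]) (use nonneg in auto)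
  have grid: "\<forall>\<^sub>F t in at_top. \<exists>s s'. t - d \<le> s \<and> s \<le> t \<and> t \<le> s' \<and> s' \<le> t + d \<and> P (f s) \<and> P (f s')"
    if "0 < d" and P: "\<forall>\<^sub>F y in nhds M. P y" for d P
  proof -
    \<comment> \<open>The offsets up to \<open>J * d\<close> cover a full period, with one more node
      so that every \<open>t\<close> has a node on its right.\<close>
    define J where "J = nat \<lceil>\<alpha> / d\<rceil> + 1"
    have "\<forall>\<^sub>F k in sequentially. \<forall>j\<in>{..J}. P (f (real j * d + real k * \<alpha>))"
      using P lim by (intro eventually_ball_finite ballI) (auto simp: filterlim_iff)
    then obtain k0 where k0: "\<And>k j. k0 \<le> k \<Longrightarrow> j \<le> J \<Longrightarrow> P (f (real j * d + real k * \<alpha>))"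
      unfolding eventually_sequentially by auto
    show ?thesis
      using eventually_ge_at_top[of "real k0 * \<alpha>"]
    proof eventually_elim
      case (elim t)
      then have t: "real k0 \<le> t / \<alpha>" using \<open>0 < \<alpha>\<close> by (simp add: field_simps)
      define k where "k = nat \<lfloor>t / \<alpha>\<rfloor>"
      have k: "real k \<le> t / \<alpha>" "t / \<alpha> < real k + 1" "k0 \<le> k" unfolding k_def using t by linarith+
      then have kt: "0 \<le> t - real k * \<alpha>" "t - real k * \<alpha> < \<alpha>" using \<open>0 < \<alpha>\<close> by (auto simp: field_simps)
      define j where "j = nat \<lfloor>(t - real k * \<alpha>) / d\<rfloor>"
      have "0 \<le> (t - real k * \<alpha>) / d" "(t - real k * \<alpha>) / d \<le> \<alpha> / d"
        using kt \<open>0 < d\<close> by (auto intro: divide_right_mono)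
      then have j: "real j \<le> (t - real k * \<alpha>) / d" "(t - real k * \<alpha>) / d < real j + 1" "j + 1 \<le> J"
        unfolding j_def J_def by linarith+
      then have "real j * d + real k * \<alpha> \<le> t" "t < real j * d + real k * \<alpha> + d"
        using \<open>0 < d\<close> by (auto simp: field_simps)
      moreover have "real (j + 1) * d + real k * \<alpha> = real j * d + real k * \<alpha> + d" by (simp add: algebra_simps)
      ultimately show ?case using k0[OF k(3), of j] k0[OF k(3), of "j + 1"] j(3) \<open>0 < d\<close>
        by (intro exI[of _ "real j * d + real k * \<alpha>"] exI[of _ "real (j + 1) * d + real k * \<alpha>"]) simp
    qed
  qed
  show ?thesis
  proof (rule order_tendstoI)
    fix y assume "M < y"
    have "((\<lambda>d. exp (\<kappa> * d) * M) \<longlongrightarrow> exp (\<kappa> * 0) * M) (at_right 0)" by (intro tendsto_intros)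
    then have "\<forall>\<^sub>F d in at_right 0. exp (\<kappa> * d) * M < y" using \<open>M < y\<close> by (intro order_tendstoD(2)) auto
    then have "\<forall>\<^sub>F d in at_right 0. exp (\<kappa> * d) * M < y \<and> 0 < d"
      using eventually_at_right_less by (rule eventually_conj)
    from eventually_happens'[OF trivial_limit_at_right_real this]
    obtain d where d: "exp (\<kappa> * d) * M < y" "0 < d" by blast
    have "M < y / exp (\<kappa> * d)" using d(1) by (simp add: field_simps)
    then have "\<forall>\<^sub>F x in nhds M. x < y / exp (\<kappa> * d)" by (rule order_tendstoD(2)[OF filterlim_ident]) 
    from grid[OF d(2) this] show "\<forall>\<^sub>F t in at_top. f t < y"
    proof eventually_elim
      case (elim t)
      then obtain s where s: "t - d \<le> s" "s \<le> t" "f s < y / exp (\<kappa> * d)" by (elim exE conjE)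
      have "f t \<le> exp (\<kappa> * (t - s)) * f s" using growth s(2) .
      also have "\<dots> \<le> exp (\<kappa> * d) * f s"
        using s(1) \<open>0 \<le> \<kappa>\<close> nonneg by (intro mult_right_mono) (auto intro: mult_left_mono)
      also have "\<dots> < y" using s(3) by (simp add: field_simps)
      finally show ?case .
    qed
  next
    fix y assume "y < M"
    have "((\<lambda>d. exp (\<kappa> * d) * y) \<longlongrightarrow> exp (\<kappa> * 0) * y) (at_right 0)" by (intro tendsto_intros)
    then have "\<forall>\<^sub>F d in at_right 0. exp (\<kappa> * d) * y < M" using \<open>y < M\<close> by (intro order_tendstoD(2)) auto
    then have "\<forall>\<^sub>F d in at_right 0. exp (\<kappa> * d) * y < M \<and> 0 < d"
      using eventually_at_right_less by (rule eventually_conj)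
    from eventually_happens'[OF trivial_limit_at_right_real this]
    obtain d where d: "exp (\<kappa> * d) * y < M" "0 < d" by blast
    then have "\<forall>\<^sub>F x in nhds M. exp (\<kappa> * d) * y < x" by (intro order_tendstoD(1)[OF filterlim_ident])
    from grid[OF d(2) this] show "\<forall>\<^sub>F t in at_top. y < f t"
    proof eventually_elim
      case (elim t)
      then obtain s where s: "t \<le> s" "s \<le> t + d" "exp (\<kappa> * d) * y < f s" by (elim exE conjE)
      have "f s \<le> exp (\<kappa> * (s - t)) * f t" using growth s(1) .
      also have "\<dots> \<le> exp (\<kappa> * d) * f t"
        using s(2) \<open>0 \<le> \<kappa>\<close> nonneg by (intro mult_right_mono) (auto intro: mult_left_mono)
      finally have "exp (\<kappa> * d) * y < exp (\<kappa> * d) * f t" using s(3) by linarith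
      then show ?case by simp
    qed
  qed
qed

context affine_ifs
begin

text \<open>
  In the lattice case there is an interval \<open>J\<close> such that \<open>V\<close> is affine on every dilate of \<open>J\<close>
  by a power of \<open>exp \<alpha>\<close>. If the content existed, then \<open>\<epsilon> powr (1 - \<delta>)\<close> would be affine on \<open>J\<close>.
\<close>

lemma not_tendsto_lattice:
  fixes m :: "nat \<Rightarrow> nat"
  assumes "0 < \<alpha>" and m: "\<And>i. i \<in> {1..N} \<Longrightarrow> a i = real (m i) * \<alpha>"
  shows "\<not> (Z \<longlongrightarrow> C) at_top"
proof
  assume lim: "(Z \<longlongrightarrow> C) at_top"
  obtain ds where ds: "length ds = N - 1" "\<And>d. d \<in> set ds \<Longrightarrow> 0 \<le> d"
    "\<And>\<epsilon>. 0 \<le> \<epsilon> \<Longrightarrow> V \<epsilon> = (\<Sum>i\<in>{1..N}. \<bar>s i\<bar> * V (\<epsilon> / \<bar>s i\<bar>)) - 2 * (real N - 1) * \<epsilon>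
       + (\<Sum>d\<leftarrow>ds. min (2 * \<epsilon>) d)"
    by (rule V_renewal) (rule that)
  \<comment> \<open>\<open>ln (d / 2)\<close> locates the kink of
    \<open>min (2 * \<epsilon>) d\<close> in logarithmic scale. For \<open>d = 0\<close> it is a
    default value, harmless because the minimum is then 0 at all positive radii.\<close>
  obtain x y where xy: "x < y" "\<And>d k. d \<in> (\<lambda>d. ln (d / 2)) ` set ds \<Longrightarrow> d + of_int k * \<alpha> \<notin> {x..y}"
    by (rule avoid_translates[of "(\<lambda>d. ln (d / 2)) ` set ds" \<alpha>]) (use assms(1) in auto)
  define E where "E k = {exp (x - of_int k * \<alpha>)..exp (y - of_int k * \<alpha>)}" for k :: int
  define aff where "aff k = (\<exists>p q. \<forall>\<epsilon>\<in>E k. V \<epsilon> = p + q * \<epsilon>)" for k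
  have E_pos: "0 < \<epsilon>" if "\<epsilon> \<in> E k" for \<epsilon> k
    using that exp_gt_zero[of "x - of_int k * \<alpha>"] unfolding E_def atLeastAtMost_iff by linarith
  obtain \<rho> c where \<rho>: "0 < \<rho>" "\<And>\<epsilon>. \<rho> \<le> \<epsilon> \<Longrightarrow> V \<epsilon> = 2 * \<epsilon> + c"
    using tube_eventually_affine[OF AB(5) K_ne] by blast
  \<comment> \<open>Up to \<open>k1\<close> the dilates lie beyond \<open>\<rho>\<close>, where
    \<open>V\<close> is affine; the renewal equation then carries affinity from the indices
    \<open>k - m i\<close> to \<open>k\<close>.\<close>
  define k1 where "k1 = \<lfloor>(x - ln \<rho>) / \<alpha>\<rfloor>"
  have base: "aff k" if "k \<le> k1" for k
  proof -
    have "of_int k \<le> (x - ln \<rho>) / \<alpha>" using that unfolding k1_def by linarith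
    then have "ln \<rho> \<le> x - of_int k * \<alpha>" using assms(1) by (simp add: field_simps)
    then have "\<rho> \<le> exp (x - of_int k * \<alpha>)" using \<rho>(1) by (metis exp_le_cancel_iff exp_ln)
    then have "\<forall>\<epsilon>\<in>E k. V \<epsilon> = c + 2 * \<epsilon>" using \<rho>(2) by (auto simp: E_def)
    then show ?thesis unfolding aff_def by blast
  qed
  have min_affine: "\<exists>p q. \<forall>\<epsilon>\<in>E k. min (2 * \<epsilon>) d = p + q * \<epsilon>" if d: "d \<in> set ds" for d k
  proof (cases "d = 0")
    case True
    then have "\<forall>\<epsilon>\<in>E k. min (2 * \<epsilon>) d = 0 + 0 * \<epsilon>" by (force dest: E_pos simp: min_def)
    then show ?thesis by blast
  next
    case False
    then have "0 < d" using ds(2)[OF d] by simp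
    have "ln (d / 2) + of_int k * \<alpha> \<notin> {x..y}" using xy(2) d by blast
    then consider "ln (d / 2) < x - of_int k * \<alpha>" | "y - of_int k * \<alpha> < ln (d / 2)" by force
    then show ?thesis
    proof cases
      case 1
      then have "d / 2 < exp (x - of_int k * \<alpha>)" using \<open>0 < d\<close>
        by (metis exp_less_cancel_iff exp_ln half_gt_zero)
      then have "\<forall>\<epsilon>\<in>E k. min (2 * \<epsilon>) d = d + 0 * \<epsilon>" by (auto simp: E_def min_def)
      then show ?thesis by blast
    next
      case 2
      then have "exp (y - of_int k * \<alpha>) < d / 2" using \<open>0 < d\<close>
        by (metis exp_less_cancel_iff exp_ln half_gt_zero)
      then have "\<forall>\<epsilon>\<in>E k. min (2 * \<epsilon>) d = 0 + 2 * \<epsilon>" by (auto simp: E_def min_def)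
      then show ?thesis by blast
    qed
  qed
  have m_pos: "0 < m i" if "i \<in> {1..N}" for i
    using m[OF that] a_pos[OF that] by (cases "m i") auto
  have affine: "aff (k1 + int n)" for n
  proof (induction n rule: less_induct)
    case (less n)
    show ?case
    proof (cases n)
      case 0
      then show ?thesis using base by simp
    next
      case (Suc n')
      have scaled: "\<epsilon> / \<bar>s i\<bar> \<in> E (k1 + int n - int (m i))" if i: "i \<in> {1..N}" and "\<epsilon> \<in> E (k1 + int n)" for i \<epsilon>
      proof -
        have "1 / \<bar>s i\<bar> = exp (a i)" using s_nz[OF i] by (simp add: exp_minus inverse_eq_divide)
        then have eq: "\<epsilon> / \<bar>s i\<bar> = \<epsilon> * exp (real (m i) * \<alpha>)" using m[OF i] by (metis times_divide_eq_right mult.right_neutral)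
        have "exp (z - of_int (k1 + int n) * \<alpha>) * exp (real (m i) * \<alpha>)
            = exp (z - of_int (k1 + int n - int (m i)) * \<alpha>)" for z
          by (simp add: exp_add[symmetric] algebra_simps)
        then show ?thesis
          using that(2) unfolding E_def eq atLeastAtMost_iff
          by (metis exp_ge_zero mult_right_mono)
      qed
      have "\<exists>p q. \<forall>\<epsilon>\<in>E (k1 + int n). \<bar>s i\<bar> * V (\<epsilon> / \<bar>s i\<bar>) = p + q * \<epsilon>" if i: "i \<in> {1..N}" for i
      proof -
        have "aff (k1 + int n - int (m i))"
        proof (cases "m i \<le> n")
          case True
          then have eq: "k1 + int n - int (m i) = k1 + int (n - m i)" by simp
          show ?thesis unfolding eq by (rule less) (use m_pos[OF i] Suc in simp)
        qed (auto intro: base)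
        then obtain p q where "\<forall>\<epsilon>\<in>E (k1 + int n - int (m i)). V \<epsilon> = p + q * \<epsilon>" unfolding aff_def by blast
        then have "\<forall>\<epsilon>\<in>E (k1 + int n). \<bar>s i\<bar> * V (\<epsilon> / \<bar>s i\<bar>) = \<bar>s i\<bar> * p + q * \<epsilon>"
          using scaled[OF i] s_nz[OF i] by (simp add: algebra_simps)
        then show ?thesis by blast
      qed
      then obtain p q where pq: "\<And>i \<epsilon>. i \<in> {1..N} \<Longrightarrow> \<epsilon> \<in> E (k1 + int n) \<Longrightarrow>
          \<bar>s i\<bar> * V (\<epsilon> / \<bar>s i\<bar>) = p i + q i * \<epsilon>" by metis
      obtain p' q' where pq': "\<forall>\<epsilon>\<in>E (k1 + int n). (\<Sum>d\<leftarrow>ds. min (2 * \<epsilon>) d) = p' + q' * \<epsilon>"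
        using sum_list_affine[of ds "E (k1 + int n)" "\<lambda>d \<epsilon>. min (2 * \<epsilon>) d"] min_affine by blast
      have "V \<epsilon> = (sum p {1..N} + p') + (sum q {1..N} - 2 * (real N - 1) + q') * \<epsilon>"
        if \<epsilon>: "\<epsilon> \<in> E (k1 + int n)" for \<epsilon>
      proof -
        have "(\<Sum>i\<in>{1..N}. \<bar>s i\<bar> * V (\<epsilon> / \<bar>s i\<bar>)) = (\<Sum>i\<in>{1..N}. p i + q i * \<epsilon>)"
          using pq \<epsilon> by (intro sum.cong) auto
        then have "V \<epsilon> = (\<Sum>i\<in>{1..N}. p i + q i * \<epsilon>) - 2 * (real N - 1) * \<epsilon> + (p' + q' * \<epsilon>)"
          using ds(3)[of \<epsilon>] E_pos[OF \<epsilon>] pq' \<epsilon> by simp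
        moreover have "(\<Sum>i\<in>{1..N}. p i + q i * \<epsilon>) = sum p {1..N} + sum q {1..N} * \<epsilon>"
          by (simp add: sum.distrib sum_distrib_right)
        ultimately show ?thesis by (simp add: algebra_simps)
      qed
      then show ?thesis unfolding aff_def by blast
    qed
  qed
  have affine': "aff (int n)" for n
    using base[of "int n"] affine[of "nat (int n - k1)"] by (cases "int n \<le> k1") auto
  \<comment> \<open>Rescaling by powers of \<open>exp \<alpha>\<close> brings all dilates back to
    one interval. There each \<open>Vn n\<close> is affine, and the sequence converges to
    \<open>C * \<epsilon> powr (1 - \<delta>)\<close>.\<close>
  define Vn where "Vn n \<epsilon> = exp ((1 - \<delta>) * (real n * \<alpha>)) * V (\<epsilon> * exp (- (real n * \<alpha>)))" for n \<epsilon>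
  have Vn_lim: "(\<lambda>n. Vn n \<epsilon>) \<longlonglongrightarrow> C * \<epsilon> powr (1 - \<delta>)" if "0 < \<epsilon>" for \<epsilon>
  proof -
    have "filterlim (\<lambda>n. - ln \<epsilon> + real n * \<alpha>) at_top sequentially"
      by (rule filterlim_tendsto_add_at_top[OF tendsto_const])
        (rule filterlim_at_top_mult_tendsto_pos[OF tendsto_const assms(1) filterlim_real_sequentially])
    then have "(\<lambda>n. Z (- ln \<epsilon> + real n * \<alpha>) * \<epsilon> powr (1 - \<delta>)) \<longlonglongrightarrow> C * \<epsilon> powr (1 - \<delta>)"
      by (intro tendsto_mult tendsto_const filterlim_compose[OF lim])
    moreover have "Z (- ln \<epsilon> + real n * \<alpha>) * \<epsilon> powr (1 - \<delta>) = Vn n \<epsilon>" for n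
    proof -
      have "exp (- (- ln \<epsilon> + real n * \<alpha>)) = \<epsilon> * exp (- (real n * \<alpha>))"
        using that by (simp add: exp_diff exp_minus field_simps)
      moreover have "exp ((1 - \<delta>) * (- ln \<epsilon> + real n * \<alpha>)) * \<epsilon> powr (1 - \<delta>) = exp ((1 - \<delta>) * (real n * \<alpha>))"
        using that by (simp add: powr_def exp_add[symmetric] algebra_simps)
      ultimately show ?thesis by (simp add: scaled_tube_def Vn_def algebra_simps)
    qed
    ultimately show ?thesis by simp
  qed
  have Vn_affine: "\<exists>p q. \<forall>\<epsilon>\<in>{exp x..exp y}. Vn n \<epsilon> = p + q * \<epsilon>" for n
  proof -
    obtain p q where pq: "\<forall>\<epsilon>\<in>E (int n). V \<epsilon> = p + q * \<epsilon>" using affine'[of n] unfolding aff_def by blast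
    have "\<epsilon> * exp (- (real n * \<alpha>)) \<in> E (int n)" if "\<epsilon> \<in> {exp x..exp y}" for \<epsilon>
      using that unfolding E_def by (simp add: exp_diff exp_minus field_simps)
    then have "\<forall>\<epsilon>\<in>{exp x..exp y}. Vn n \<epsilon> = exp ((1 - \<delta>) * (real n * \<alpha>)) * p
        + (exp ((1 - \<delta>) * (real n * \<alpha>)) * q * exp (- (real n * \<alpha>))) * \<epsilon>"
      using pq by (simp add: Vn_def algebra_simps)
    then show ?thesis by blast
  qed
  obtain c0 where c0: "0 < c0" "\<And>t. 0 \<le> t \<Longrightarrow> c0 \<le> Z t" using Z_lower_bound by blast
  have "\<forall>\<^sub>F t in at_top. c0 \<le> Z t"
    using eventually_ge_at_top[of 0] by eventually_elim (rule c0)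
  then have "c0 \<le> C" by (intro tendsto_lowerbound[OF lim]) auto
  show False
  proof (rule powr_not_affine[of C "1 - \<delta>" "exp x" "exp y"])
    show "0 < C" using c0 \<open>c0 \<le> C\<close> by simp
    fix \<epsilon> assume \<epsilon>: "\<epsilon> \<in> {exp x..exp y}"
    then have pos: "0 < \<epsilon>" using exp_gt_zero[of x] unfolding atLeastAtMost_iff by linarith
    have "Vn n \<epsilon> * (exp y - exp x) = Vn n (exp x) * (exp y - \<epsilon>) + Vn n (exp y) * (\<epsilon> - exp x)" for n
    proof -
      obtain p q where "\<forall>\<epsilon>\<in>{exp x..exp y}. Vn n \<epsilon> = p + q * \<epsilon>" using Vn_affine by blast
      then show ?thesis using \<epsilon> xy(1) by (simp add: algebra_simps)
    qed
    moreover have "(\<lambda>n. Vn n \<epsilon> * (exp y - exp x)) \<longlonglongrightarrow> C * \<epsilon> powr (1 - \<delta>) * (exp y - exp x)"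
      by (intro tendsto_mult tendsto_const Vn_lim pos)
    moreover have "(\<lambda>n. Vn n (exp x) * (exp y - \<epsilon>) + Vn n (exp y) * (\<epsilon> - exp x)) \<longlonglongrightarrow>
        C * exp x powr (1 - \<delta>) * (exp y - \<epsilon>) + C * exp y powr (1 - \<delta>) * (\<epsilon> - exp x)"
      by (intro tendsto_add tendsto_mult tendsto_const Vn_lim) auto
    ultimately show "C * \<epsilon> powr (1 - \<delta>) * (exp y - exp x)
        = C * exp x powr (1 - \<delta>) * (exp y - \<epsilon>) + C * exp y powr (1 - \<delta>) * (\<epsilon> - exp x)"
      using LIMSEQ_unique by simp
  qed (use delta_pos delta_less_1 xy(1) in auto)
qed

section \<open>Hoelder continuity of the distribution function\<close>

definition smin :: real where "smin = Min ((\<lambda>i. \<bar>s i\<bar>) ` {1..N})"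

lemma smin: "0 < smin" "smin < 1" "i \<in> {1..N} \<Longrightarrow> smin \<le> \<bar>s i\<bar>"
proof -
  have ne: "(\<lambda>i. \<bar>s i\<bar>) ` {1..N} \<noteq> {}" using N_ge by auto
  show "i \<in> {1..N} \<Longrightarrow> smin \<le> \<bar>s i\<bar>" for i unfolding smin_def by simp
  have "smin \<in> (\<lambda>i. \<bar>s i\<bar>) ` {1..N}" unfolding smin_def using ne by (intro Min_in) auto
  then show "0 < smin" "smin < 1" using s_nz s_lt by auto
qed

lemma smin_le_sw: "w \<in> W m \<Longrightarrow> smin ^ m \<le> \<bar>sw w\<bar>"
proof -
  have "set w \<subseteq> {1..N} \<Longrightarrow> smin ^ length w \<le> \<bar>sw w\<bar>" for w
    by (induction w) (use smin in \<open>auto simp: abs_mult intro!: mult_mono\<close>)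
  then show "w \<in> W m \<Longrightarrow> smin ^ m \<le> \<bar>sw w\<bar>" by (auto simp: W_def)
qed

text \<open>If three intervals of level \<open>m\<close> met \<open>{x..y}\<close>, the middle one
  would lie inside it, but each of them has length at least \<open>smin ^ m * (B - A)\<close>. Each
  of the at most two remaining pieces has mass at most
  \<open>(smax powr \<delta>) ^ m\<close>.\<close>

lemma nu_short_interval:
  assumes xy: "x \<le> y" "y - x < smin ^ m * (B - A)"
  shows "measure \<nu> {x..y} \<le> 2 * (smax powr \<delta>) ^ m"
proof -
  define T where "T = {w\<in>W m. {lw w..uw w} \<inter> {x..y} \<noteq> {}}"
  have "finite T" unfolding T_def using finite_W by simp
  have words: "set w \<subseteq> {1..N}" if "w \<in> W m" for w using that by (simp add: W_def)
  have K_sub: "{x..y} \<inter> K \<subseteq> (\<Union>w\<in>T. Sw w ` K)"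
  proof
    fix z assume z: "z \<in> {x..y} \<inter> K"
    then obtain w where "w \<in> W m" "z \<in> Sw w ` K" using K_words[of m] by blast
    moreover from this have "z \<in> {lw w..uw w}"
      using Sw_Icc(1)[OF words] AB(4) by blast
    ultimately show "z \<in> (\<Union>w\<in>T. Sw w ` K)" using z unfolding T_def by blast
  qed
  have card: "card T \<le> 2"
  proof (cases "T = {}")
    case False
    define w1 where "w1 = arg_min_on lw T"
    define w2 where "w2 = arg_min_on (\<lambda>w. - lw w) T"
    have w1: "w1 \<in> T" "\<And>v. v \<in> T \<Longrightarrow> lw w1 \<le> lw v"
      unfolding w1_def using arg_min_if_finite[OF \<open>finite T\<close> False, of lw]
      by (auto simp: not_less)
    have w2: "w2 \<in> T" "\<And>v. v \<in> T \<Longrightarrow> lw v \<le> lw w2"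
      unfolding w2_def using arg_min_if_finite[OF \<open>finite T\<close> False, of "\<lambda>w. - lw w"]
      by (auto simp: not_less)
    have "T \<subseteq> {w1, w2}"
    proof
      fix v assume v: "v \<in> T"
      show "v \<in> {w1, w2}"
      proof (rule ccontr)
        assume nv: "v \<notin> {w1, w2}"
        have W: "v \<in> W m" "w1 \<in> W m" "w2 \<in> W m" using v w1 w2 by (auto simp: T_def)
        have lt: "lw w < uw w" if "w \<in> W m" for w using Sw_Icc(4)[OF words[OF that]] .
        have "uw w1 \<le> lw v" using W_ordered[OF W(2,1)] nv w1(2)[OF v] lt[OF W(1)] by auto
        moreover have "uw v \<le> lw w2" using W_ordered[OF W(1,3)] nv w2(2)[OF v] lt[OF W(3)] lt[OF W(1)] by force
        moreover have "x \<le> uw w1" "lw w2 \<le> y" using w1(1) w2(1) by (auto simp: T_def)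
        ultimately have "uw v - lw v \<le> y - x" by linarith
        then have "\<bar>sw v\<bar> * (B - A) \<le> y - x" using Sw_Icc(3)[OF words[OF W(1)]] by simp
        moreover have "smin ^ m * (B - A) \<le> \<bar>sw v\<bar> * (B - A)"
          using smin_le_sw[OF W(1)] AB(1) by (intro mult_right_mono) auto
        ultimately show False using xy(2) by simp
      qed
    qed
    then have "card T \<le> card {w1, w2}" by (intro card_mono) auto
    also have "\<dots> \<le> 2" by (simp add: card_insert_if)
    finally show ?thesis .
  qed simp
  have sets: "Sw w ` K \<in> sets \<nu>" for w using compact_Sw[OF AB(5)] by (rule sets_compact)
  have "measure \<nu> {x..y} = measure \<nu> ({x..y} \<inter> K)"
  proof -
    have Ks: "K \<in> sets \<nu>" by (rule sets_compact[OF AB(5)])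
    have "measure \<nu> (space \<nu> - K) = 0" using prob_compl[OF Ks] nu_K by simp
    moreover have "measure \<nu> ({x..y} - K) \<le> measure \<nu> (space \<nu> - K)"
      using Ks sets_compact[of "{x..y}"] sets.sets_into_space[of "{x..y}" \<nu>] by (intro finite_measure_mono) auto
    moreover have "measure \<nu> {x..y} = measure \<nu> ({x..y} \<inter> K) + measure \<nu> ({x..y} - K)"
      using Ks sets_compact[of "{x..y}"]
      by (subst finite_measure_Union[symmetric]) (auto intro!: arg_cong[where f="measure \<nu>"])
    ultimately show ?thesis by (simp add: measure_le_0_iff)
  qed
  also have "\<dots> \<le> measure \<nu> (\<Union>w\<in>T. Sw w ` K)"
    using K_sub sets \<open>finite T\<close> by (intro finite_measure_mono) auto
  also have "\<dots> \<le> (\<Sum>w\<in>T. measure \<nu> (Sw w ` K))"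
    using sets \<open>finite T\<close> by (intro finite_measure_subadditive_finite) auto
  also have "\<dots> \<le> (\<Sum>w\<in>T. (smax powr \<delta>) ^ m)"
  proof (rule sum_mono)
    fix w assume "w \<in> T"
    then have w: "w \<in> W m" by (simp add: T_def)
    have "measure \<nu> (Sw w ` K) = \<bar>sw w\<bar> powr \<delta>" using nu_piece[OF w] by (simp add: pw_def)
    also have "\<dots> \<le> (smax ^ m) powr \<delta>" using sw_le_smax[OF w] delta_pos by (intro powr_mono2) auto
    also have "\<dots> = (smax powr \<delta>) ^ m"
      using smax(1) by (simp add: powr_realpow[symmetric] powr_powr mult.commute)
    finally show "measure \<nu> (Sw w ` K) \<le> (smax powr \<delta>) ^ m" .
  qed
  also have "\<dots> \<le> 2 * (smax powr \<delta>) ^ m"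
    using card by (simp add: mult_right_mono)
  finally show ?thesis .
qed

lemma nu_interval_Hoelder:
  obtains C \<beta> where "0 < \<beta>" "0 < C" "\<And>x y. x \<le> y \<Longrightarrow> measure \<nu> {x..y} \<le> C * (y - x) powr \<beta>"
proof -
  \<comment> \<open>Chosen so that \<open>smin powr \<beta> = smax powr \<delta>\<close>, which
    turns the mass bound at level \<open>m\<close> into a power of the length bound at that
    level.\<close>
  define \<beta> where "\<beta> = \<delta> * ln smax / ln smin"
  have lns: "ln smax < 0" "ln smin < 0" using smax smin by auto
  have "0 < \<beta>" unfolding \<beta>_def using lns delta_pos by (intro divide_neg_neg mult_pos_neg)
  have pow: "smax powr \<delta> = smin powr \<beta>" using smax smin lns by (simp add: powr_def \<beta>_def)
  define C where "C = 2 / (smin * (B - A)) powr \<beta>"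
  have "0 < C" using smin AB(1) by (simp add: C_def)
  have main: "measure \<nu> {x..y} \<le> C * (y - x) powr \<beta>" if "x < y" for x y
  proof -
    have "(\<lambda>n. smin ^ n * (B - A)) \<longlonglongrightarrow> 0 * (B - A)"
      using smin by (intro tendsto_mult LIMSEQ_power_zero tendsto_const) auto
    then have "\<forall>\<^sub>F n in sequentially. smin ^ n * (B - A) < y - x"
      using that by (intro order_tendstoD(2)) auto
    then have ex: "\<exists>n. smin ^ n * (B - A) \<le> y - x" by (auto simp: eventually_sequentially intro: less_imp_le)
    \<comment> \<open>With \<open>n\<close> least, the interval is shorter than all those of level
      \<open>n - 1\<close>; the lost level is the factor \<open>smin\<close> in \<open>C\<close>.
      For \<open>n = 0\<close> the truncated \<open>n - 1\<close> leaves the trivial bound.\<close>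
    define n where "n = (LEAST n. smin ^ n * (B - A) \<le> y - x)"
    have n: "smin ^ n * (B - A) \<le> y - x" unfolding n_def using ex by (rule LeastI_ex)
    have "measure \<nu> {x..y} \<le> 2 * (smin powr \<beta>) ^ (n - 1)"
    proof (cases n)
      case 0
      have "measure \<nu> {x..y} \<le> 1" by (rule prob_le_1)
      also have "1 \<le> 2 * (smin powr \<beta>) ^ (n - 1)" using 0 by simp
      finally show ?thesis .
    next
      case (Suc n')
      then have "\<not> smin ^ n' * (B - A) \<le> y - x" unfolding n_def by (metis lessI not_less_Least)
      then show ?thesis using nu_short_interval[of x y n'] that Suc by (simp add: pow)
    qed
    also have "\<dots> \<le> C * (y - x) powr \<beta>"
    proof -
      have "smin ^ (n - 1) * (smin * (B - A)) \<le> y - x"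
      proof (cases n)
        case 0
        have "smin * (B - A) \<le> 1 * (B - A)" using smin AB(1) by (intro mult_right_mono) auto
        then show ?thesis using n 0 by simp
      next
        case (Suc n')
        then show ?thesis using n by (simp add: algebra_simps)
      qed
      then have "(smin ^ (n - 1) * (smin * (B - A))) powr \<beta> \<le> (y - x) powr \<beta>"
        using smin AB(1) \<open>0 < \<beta>\<close> by (intro powr_mono2) auto
      then have "(smin powr \<beta>) ^ (n - 1) * (smin * (B - A)) powr \<beta> \<le> (y - x) powr \<beta>"
        using smin AB(1) by (simp add: powr_mult powr_realpow[symmetric] powr_powr mult.commute)
      then show ?thesis using smin AB(1) by (simp add: C_def field_simps)
    qed
    finally show ?thesis .
  qed
  have "measure \<nu> {x..y} \<le> C * (y - x) powr \<beta>" if "x \<le> y" for x y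
  proof (cases "x = y")
    case True
    \<comment> \<open>At a single point the claim is that \<open>\<nu>\<close> has no atom there; it
      follows by shrinking the intervals \<open>{x..z}\<close>.\<close>
    have "((\<lambda>z. C * (z - x) powr \<beta>) \<longlongrightarrow> C * (x - x) powr \<beta>) (at_right x)"
      using \<open>0 < \<beta>\<close> by (intro tendsto_intros tendsto_powr') (auto intro!: eventually_mono[OF eventually_at_right_less])
    moreover have "\<forall>\<^sub>F z in at_right x. measure \<nu> {x..x} \<le> C * (z - x) powr \<beta>"
      using eventually_at_right_less[of x]
    proof eventually_elim
      case (elim z)
      have "measure \<nu> {x..x} \<le> measure \<nu> {x..z}"
        using elim by (intro finite_measure_mono sets_compact) auto
      then show ?case using main[OF elim] by simp
    qed
    ultimately have "measure \<nu> {x..x} \<le> C * (x - x) powr \<beta>"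
      by (intro tendsto_lowerbound[of _ _ "at_right x"]) auto
    then show ?thesis using True by simp
  next
    case False
    then show ?thesis using main that by simp
  qed
  then show ?thesis using that \<open>0 < \<beta>\<close> \<open>0 < C\<close> by blast
qed

sublocale nu: real_distribution \<nu>
  by standard (rule sets_nu)

lemma cdf_Hoelder:
  obtains C \<beta> where "0 < \<beta>" "0 < C" "\<And>x y. \<bar>cdf \<nu> x - cdf \<nu> y\<bar> \<le> C * \<bar>x - y\<bar> powr \<beta>"
proof -
  obtain C \<beta> where C: "0 < \<beta>" "0 < C" "\<And>x y. x \<le> y \<Longrightarrow> measure \<nu> {x..y} \<le> C * (y - x) powr \<beta>"
    by (rule nu_interval_Hoelder) (rule that)
  have le: "\<bar>cdf \<nu> x - cdf \<nu> y\<bar> \<le> C * \<bar>x - y\<bar> powr \<beta>" if "x < y" for x y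
  proof -
    have "cdf \<nu> y - cdf \<nu> x = measure \<nu> {x<..y}" using nu.cdf_diff_eq[OF that] .
    moreover have "measure \<nu> {x<..y} \<le> measure \<nu> {x..y}"
      by (intro finite_measure_mono sets_compact) auto
    moreover have "0 \<le> measure \<nu> {x<..y}" by simp
    moreover have "measure \<nu> {x..y} \<le> C * (y - x) powr \<beta>" using C(3)[of x y] that by simp
    ultimately have "\<bar>cdf \<nu> x - cdf \<nu> y\<bar> \<le> C * (y - x) powr \<beta>" by linarith
    then show ?thesis using that by simp
  qed
  have "\<bar>cdf \<nu> x - cdf \<nu> y\<bar> \<le> C * \<bar>x - y\<bar> powr \<beta>" for x y
    using le[of x y] le[of y x] by (cases x y rule: linorder_cases) (auto simp: abs_minus_commute)
  then show ?thesis using that C(1,2) by blast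
qed

lemma continuous_on_cdf: "continuous_on X (cdf \<nu>)"
proof -
  obtain C \<beta> where C: "0 < \<beta>" "0 < C" "\<And>x y. \<bar>cdf \<nu> x - cdf \<nu> y\<bar> \<le> C * \<bar>x - y\<bar> powr \<beta>"
    by (rule cdf_Hoelder) (rule that)
  have "isCont (cdf \<nu>) x" for x
    unfolding isCont_def tendsto_dist_iff[of "cdf \<nu>"]
  proof (rule Lim_null_comparison)
    show "\<forall>\<^sub>F y in at x. norm (dist (cdf \<nu> y) (cdf \<nu> x)) \<le> C * \<bar>y - x\<bar> powr \<beta>"
      using C(3) by (auto simp: dist_real_def)
    have "((\<lambda>y. C * \<bar>y - x\<bar> powr \<beta>) \<longlongrightarrow> C * \<bar>x - x\<bar> powr \<beta>) (at x)"
      using C(1) by (intro tendsto_intros tendsto_powr') auto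
    then show "((\<lambda>y. C * \<bar>y - x\<bar> powr \<beta>) \<longlongrightarrow> 0) (at x)" by simp
  qed
  then show ?thesis by (simp add: continuous_at_imp_continuous_on)
qed

end

section \<open>Images under maps built from the distribution function\<close>

lemma cdf_uniform_01: "cdf (uniform_measure lborel {0..1}) u = min 1 (max 0 u)"
proof -
  have "{0..1} \<inter> {..u} = {0..min 1 u}" by auto
  then have "measure lborel ({0..1} \<inter> {..u}) = max 0 (min 1 u)" by (simp add: max_def)
  then show ?thesis
    unfolding cdf_def by (subst measure_uniform_measure) (auto simp: min_def max_def)
qed

context affine_ifs
begin

section \<open>Transport of the measure by its distribution function\<close>

lemma cdf_K_ends: "x < A \<Longrightarrow> cdf \<nu> x = 0" "B \<le> x \<Longrightarrow> cdf \<nu> x = 1"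
proof -
  have Ks: "K \<in> sets \<nu>" by (rule sets_compact[OF AB(5)])
  show "cdf \<nu> x = 1" if "B \<le> x"
  proof -
    have "measure \<nu> K \<le> measure \<nu> {..x}"
      using that AB(4) by (intro finite_measure_mono) (auto simp: sets_nu)
    then have "1 \<le> cdf \<nu> x" using nu_K by (simp add: cdf_def)
    then show ?thesis using nu.cdf_bounded_prob[of x] by linarith
  qed
  show "cdf \<nu> x = 0" if "x < A"
  proof -
    have "measure \<nu> {..x} \<le> measure \<nu> (space \<nu> - K)"
      using that AB(4) Ks by (intro finite_measure_mono) auto
    also have "\<dots> = 0" using prob_compl[OF Ks] nu_K by simp
    finally show ?thesis by (simp add: cdf_def measure_le_0_iff)
  qed
qed

lemma cdf_mono: "x \<le> y \<Longrightarrow> cdf \<nu> x \<le> cdf \<nu> y"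
  by (rule nu.cdf_nondecreasing)

lemma cdf_borel: "cdf \<nu> \<in> borel_measurable borel"
  by (rule borel_measurable_continuous_onI[OF continuous_on_cdf])

text \<open>The distribution function is continuous as \<open>\<nu>\<close> has no atoms. For
  \<open>0 \<le> u < 1\<close> its sublevel set is therefore a half-line \<open>{..c}\<close> at
  whose end the value \<open>u\<close> is attained, by the intermediate value theorem, so the mass
  of the set is \<open>u\<close>.\<close>

lemma distr_cdf_uniform: "distr \<nu> borel (cdf \<nu>) = uniform_measure lborel {0..1}"
proof (rule cdf_unique)
  have m: "cdf \<nu> \<in> borel_measurable \<nu>"
    using cdf_borel by (simp add: measurable_cong_sets[OF sets_nu refl])
  show "real_distribution (distr \<nu> borel (cdf \<nu>))" using m by (rule real_distribution_distr)
  show "real_distribution (uniform_measure lborel {0..1::real})"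
    unfolding real_distribution_def real_distribution_axioms_def
    by (auto intro!: prob_space_uniform_measure)
  show "cdf (distr \<nu> borel (cdf \<nu>)) = cdf (uniform_measure lborel {0..1})"
  proof
    fix u
    have "cdf (distr \<nu> borel (cdf \<nu>)) u = measure \<nu> (cdf \<nu> -` {..u} \<inter> space \<nu>)"
      unfolding cdf_def[of "distr \<nu> borel (cdf \<nu>)"] by (rule measure_distr[OF m]) simp
    then have lhs: "cdf (distr \<nu> borel (cdf \<nu>)) u = measure \<nu> {x. cdf \<nu> x \<le> u}"
      by (simp add: vimage_def)
    consider "u < 0" | "0 \<le> u" "u < 1" | "1 \<le> u" by linarith
    then have "measure \<nu> {x. cdf \<nu> x \<le> u} = min 1 (max 0 u)"
    proof cases
      case 1
      then have "{x. cdf \<nu> x \<le> u} = {}" using nu.cdf_nonneg by (auto simp: not_le intro: less_le_trans)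
      then show ?thesis using 1 by simp
    next
      case 3
      then have "{x. cdf \<nu> x \<le> u} = space \<nu>" using nu.cdf_bounded_prob order_trans by auto
      then show ?thesis using 3 prob_space by simp
    next
      case 2
      \<comment> \<open>The restriction to \<open>{A - 1..B}\<close> gives a compact set and loses
        nothing relevant: the distribution function vanishes at \<open>A - 1\<close> and exceeds
        \<open>u\<close> from \<open>B\<close> on.\<close>
      define T where "T = {A - 1..B} \<inter> {x. cdf \<nu> x \<le> u}"
      have "A - 1 \<in> T" using cdf_K_ends(1)[of "A - 1"] 2 AB(1) by (simp add: T_def)
      moreover have "compact T"
        unfolding T_def by (intro compact_Int_closed closed_Collect_le continuous_on_cdf continuous_on_const) simp
      ultimately obtain c where c: "c \<in> T" "\<And>x. x \<in> T \<Longrightarrow> x \<le> c"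
        using compact_attains_sup[of T] by blast
      have c': "A - 1 \<le> c" "c \<le> B" "cdf \<nu> c \<le> u" using c(1) by (auto simp: T_def)
      have "cdf \<nu> c = u"
      proof (rule ccontr)
        assume "cdf \<nu> c \<noteq> u"
        then have "cdf \<nu> c < u" using c' by simp
        moreover have "u \<le> cdf \<nu> B" using cdf_K_ends(2)[of B] 2 by simp
        ultimately obtain z where "c \<le> z" "z \<le> B" "cdf \<nu> z = u"
          using IVT'[of "cdf \<nu>" c u B] c'(2) continuous_on_cdf by auto
        moreover from this have "z \<in> T" using c' by (auto simp: T_def)
        ultimately show False using c(2)[of z] \<open>cdf \<nu> c < u\<close> by auto
      qed
      moreover have "{x. cdf \<nu> x \<le> u} = {..c}"
      proof (intro set_eqI iffI; unfold mem_Collect_eq atMost_iff)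
        fix x assume x: "cdf \<nu> x \<le> u"
        show "x \<le> c"
        proof (rule ccontr)
          assume "\<not> x \<le> c"
          moreover have "x < B" using x cdf_K_ends(2)[of x] 2 by force
          ultimately have "x \<in> T" using x c' by (auto simp: T_def)
          then show False using c(2)[of x] \<open>\<not> x \<le> c\<close> by simp
        qed
      next
        fix x assume "x \<le> c"
        then show "cdf \<nu> x \<le> u" using cdf_mono[of x c] c' by simp
      qed
      ultimately show ?thesis using 2 by (simp add: cdf_def)
    qed
    then show "cdf (distr \<nu> borel (cdf \<nu>)) u = cdf (uniform_measure lborel {0..1}) u"
      unfolding lhs cdf_uniform_01 .
  qed
qed

lemma integral_cdf_substitution:
  fixes \<phi> :: "real \<Rightarrow> real"
  assumes "\<phi> \<in> borel_measurable borel"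
  shows "(LINT x:K|\<nu>. \<phi> (cdf \<nu> x)) = (LINT u:{0..1}|lborel. \<phi> u)"
proof -
  have m: "cdf \<nu> \<in> borel_measurable \<nu>"
    using cdf_borel by (simp add: measurable_cong_sets[OF sets_nu refl])
  have Ks: "K \<in> sets \<nu>" by (rule sets_compact[OF AB(5)])
  have "AE x in \<nu>. x \<in> K" using nu_K Ks by (simp add: prob_eq_1)
  then have ae: "AE x in \<nu>. indicator K x *\<^sub>R \<phi> (cdf \<nu> x) = \<phi> (cdf \<nu> x)" by eventually_elim simp
  have \<phi>m: "(\<lambda>x. \<phi> (cdf \<nu> x)) \<in> borel_measurable \<nu>" by (rule measurable_compose[OF m assms])
  have "(LINT x:K|\<nu>. \<phi> (cdf \<nu> x)) = (LINT x|\<nu>. \<phi> (cdf \<nu> x))"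
    unfolding set_lebesgue_integral_def
    by (intro integral_cong_AE borel_measurable_scaleR borel_measurable_indicator Ks \<phi>m ae)
  also have "\<dots> = (LINT u|distr \<nu> borel (cdf \<nu>). \<phi> u)"
    by (rule integral_distr[symmetric, OF m assms])
  also have "\<dots> = (LINT u|uniform_measure lborel {0..1}. \<phi> u)" by (simp only: distr_cdf_uniform)
  also have "\<dots> = (LINT u:{0..1}|lborel. \<phi> u)"
  proof -
    have "uniform_measure lborel {0..1::real} = density lborel (\<lambda>x. ennreal (indicator {0..1} x))"
      unfolding uniform_measure_def by (simp add: divide_ennreal_def ennreal_indicator)
    then show ?thesis
      unfolding set_lebesgue_integral_def
      by (simp add: integral_density assms)
  qed
  finally show ?thesis .
qed

text \<open>The slope of the lattice map as a function of the value \<open>u\<close> of the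
  distribution function. Its logarithm runs from 0 at \<open>u = 0\<close> to
  \<open>- \<alpha> * n\<close> at \<open>u = 1\<close>, through exactly \<open>n\<close>
  periods.\<close>

definition cdf_slope :: "real \<Rightarrow> nat \<Rightarrow> real \<Rightarrow> real" where
  "cdf_slope \<alpha> n u = (u * (exp (\<delta> * \<alpha> * real n) - 1) + 1) powr (- 1 / \<delta>)"

lemma cdf_slope_base:
  assumes "0 < \<alpha>" "0 \<le> u"
  shows "1 \<le> u * (exp (\<delta> * \<alpha> * real n) - 1) + 1"
  using assms delta_pos by simp

lemma cdf_slope_pos: "0 < \<alpha> \<Longrightarrow> 0 \<le> u \<Longrightarrow> 0 < cdf_slope \<alpha> n u"
  unfolding cdf_slope_def using cdf_slope_base[of \<alpha> u n] by simp

lemma continuous_on_cdf_slope: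
  assumes "0 < \<alpha>"
  shows "continuous_on X (\<lambda>x. cdf_slope \<alpha> n (cdf \<nu> x))"
  unfolding cdf_slope_def
proof (intro continuous_on_powr continuous_intros continuous_on_cdf ballI)
  fix x show "cdf \<nu> x * (exp (\<delta> * \<alpha> * real n) - 1) + 1 \<noteq> 0"
    using cdf_slope_base[OF assms nu.cdf_nonneg, of x n] by linarith
qed

lemma lattice_map_deriv:
  assumes "0 < \<alpha>" "c < x"
  shows "((\<lambda>x. integral {c..x} (\<lambda>t. cdf_slope \<alpha> n (cdf \<nu> t))) has_real_derivative cdf_slope \<alpha> n (cdf \<nu> x)) (at x)"
proof -
  have "((\<lambda>x. integral {c..x} (\<lambda>t. cdf_slope \<alpha> n (cdf \<nu> t))) has_real_derivative cdf_slope \<alpha> n (cdf \<nu> x))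
      (at x within {c..x + 1})"
    using assms by (intro integral_has_real_derivative continuous_on_cdf_slope) auto
  moreover have "x \<in> interior {c..x + 1}" using assms by simp
  ultimately show ?thesis by (metis at_within_interior)
qed

lemma periodic_integral_const:
  fixes h :: "real \<Rightarrow> real"
  assumes int: "\<And>x y. h integrable_on {x..y}" and per: "\<And>t. h (t + q) = h t" and "0 \<le> q"
  shows "integral {x - q..x} h = integral {y - q..y} h"
proof -
  have le: "integral {x - q..x} h = integral {y - q..y} h" if "x \<le> y" for x y
  proof -
    have "integral {x - q..x} h + integral {x..y} h = integral {x - q..y} h"
      "integral {x - q..y - q} h + integral {y - q..y} h = integral {x - q..y} h"
      using that \<open>0 \<le> q\<close> int by (intro Henstock_Kurzweil_Integration.integral_combine; simp)+
    moreover have "integral {x - q..y - q} h = integral {x..y} h"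
    proof -
      have "integral {x - q..y - q} (\<lambda>t. h (t - (- q))) = integral {x - q - (- q)..y - q - (- q)} h"
        by (rule integral_shift)
      then show ?thesis using per by simp
    qed
    ultimately show ?thesis by simp
  qed
  show ?thesis
  proof (cases "x \<le> y")
    case False
    then show ?thesis using le[of y x] by (metis linear)
  qed (rule le)
qed

text \<open>
  With \<open>\<psi> u = ln (u (E - 1) + 1) / \<delta>\<close> and \<open>E = exp (\<delta> \<alpha> n)\<close>, the integrand is
  \<open>\<delta> / (E - 1) H (t0 - \<psi> u) \<psi>' u\<close>, so the integral is a multiple of the integral of \<open>H\<close> over \<open>n\<close> periods.
\<close>

lemma cdf_slope_integral:
  assumes "0 < \<alpha>" "1 \<le> n" and int: "\<And>x y. set_integrable lborel {x..y} H"
  shows "(LINT u:{0..1}|lborel. cdf_slope \<alpha> n u powr \<delta> * H (t0 + ln (cdf_slope \<alpha> n u)))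
    = \<delta> / (exp (\<delta> * \<alpha> * real n) - 1) * integral {t0 - \<alpha> * real n..t0} H"
proof -
  define E where "E = exp (\<delta> * \<alpha> * real n)"
  have E: "1 < E" unfolding E_def using assms delta_pos by simp
  define \<psi> where "\<psi> u = ln (u * (E - 1) + 1) / \<delta>" for u
  define \<psi>' where "\<psi>' u = (E - 1) / (u * (E - 1) + 1) / \<delta>" for u
  have base: "0 < u * (E - 1) + 1" if "0 \<le> u" for u
    using mult_nonneg_nonneg[OF that, of "E - 1"] E by linarith
  have \<psi>01: "\<psi> 0 = 0" "\<psi> 1 = \<alpha> * real n" using delta_pos by (simp_all add: \<psi>_def E_def)
  have slope: "cdf_slope \<alpha> n u powr \<delta> * H (t0 + ln (cdf_slope \<alpha> n u)) = \<delta> / (E - 1) * (H (t0 - \<psi> u) * \<psi>' u)"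
    if "0 \<le> u" for u
  proof -
    have "- 1 / \<delta> * \<delta> = - 1" using delta_pos by simp
    then have "cdf_slope \<alpha> n u powr \<delta> = (u * (E - 1) + 1) powr - 1"
      unfolding cdf_slope_def E_def[symmetric] powr_powr by (rule arg_cong)
    then have "cdf_slope \<alpha> n u powr \<delta> = 1 / (u * (E - 1) + 1)"
      using base[OF that] by (simp add: powr_minus_divide)
    moreover have "ln (cdf_slope \<alpha> n u) = - \<psi> u"
      using base[OF that] by (simp add: cdf_slope_def E_def[symmetric] \<psi>_def ln_powr)
    moreover have "\<delta> / (E - 1) * (H (t0 - \<psi> u) * \<psi>' u) = 1 / (u * (E - 1) + 1) * H (t0 - \<psi> u)"
      using E delta_pos by (simp add: \<psi>'_def)
    ultimately show ?thesis by simp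
  qed
  have int': "set_integrable lborel {0..\<alpha> * real n} (\<lambda>s. H (t0 - s))"
    "(LINT s:{0..\<alpha> * real n}|lborel. H (t0 - s)) = integral {t0 - \<alpha> * real n..t0} H"
  proof -
    let ?f = "\<lambda>x. indicator {t0 - \<alpha> * real n..t0} x *\<^sub>R H x"
    have f: "integrable lborel ?f" using int[of "t0 - \<alpha> * real n" t0] by (simp add: set_integrable_def)
    have eq: "?f (t0 + (- 1) * s) = indicator {0..\<alpha> * real n} s *\<^sub>R H (t0 - s)" for s
      by (auto simp: indicator_def)
    show "set_integrable lborel {0..\<alpha> * real n} (\<lambda>s. H (t0 - s))"
      using lborel_integrable_real_affine[OF f, of "- 1" t0] unfolding eq set_integrable_def by simp
    have "(LINT s:{0..\<alpha> * real n}|lborel. H (t0 - s)) = (LINT x:{t0 - \<alpha> * real n..t0}|lborel. H x)"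
      using lborel_integral_real_affine[of "- 1" ?f t0] unfolding eq set_lebesgue_integral_def by simp
    also have "\<dots> = integral {t0 - \<alpha> * real n..t0} H"
      by (rule set_borel_integral_eq_integral(2)[OF int])
    finally show "(LINT s:{0..\<alpha> * real n}|lborel. H (t0 - s)) = integral {t0 - \<alpha> * real n..t0} H" .
  qed
  have subst: "(LBINT s. H (t0 - s) * indicator {\<psi> 0..\<psi> 1} s) = (LBINT u. H (t0 - \<psi> u) * \<psi>' u * indicator {0..1} u)"
  proof (rule integral_substitution(2))
    show "set_integrable lborel {\<psi> 0..\<psi> 1} (\<lambda>s. H (t0 - s))" using int'(1) by (simp add: \<psi>01)
    show "(\<psi> has_real_derivative \<psi>' u) (at u)" if "u \<in> {0..1}" for u
      unfolding \<psi>_def \<psi>'_def using base[of u] that delta_pos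
      by (auto intro!: derivative_eq_intros)
    show "continuous_on {0..1} \<psi>'"
      unfolding \<psi>'_def using base delta_pos by (intro continuous_intros) force+
    show "0 \<le> \<psi>' u" if "u \<in> {0..1}" for u
      unfolding \<psi>'_def using base[of u] that delta_pos E by simp
  qed simp
  have "(LINT u:{0..1}|lborel. cdf_slope \<alpha> n u powr \<delta> * H (t0 + ln (cdf_slope \<alpha> n u)))
      = (LBINT u. \<delta> / (E - 1) * (H (t0 - \<psi> u) * \<psi>' u * indicator {0..1} u))"
    unfolding set_lebesgue_integral_def
    by (intro Bochner_Integration.integral_cong refl) (auto simp: indicator_def slope)
  also have "\<dots> = \<delta> / (E - 1) * (LBINT u. H (t0 - \<psi> u) * \<psi>' u * indicator {0..1} u)" by simp
  also have "(LBINT u. H (t0 - \<psi> u) * \<psi>' u * indicator {0..1} u) = (LBINT s. H (t0 - s) * indicator {\<psi> 0..\<psi> 1} s)"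
    using subst by simp
  also have "\<dots> = (LINT s:{0..\<alpha> * real n}|lborel. H (t0 - s))"
    unfolding set_lebesgue_integral_def \<psi>01 by (simp add: mult.commute)
  finally show ?thesis using int'(2) by (simp add: E_def)
qed

text \<open>The periodic limit \<open>H\<close> of \<open>Z\<close> enters through an integral over
  the slopes. As \<open>\<nu>\<close> becomes uniform under its distribution function, this is a
  multiple of the integral of \<open>H\<close> over \<open>n\<close> full periods, hence the same on
  every coset, and the coset limits combine to one limit.\<close>

lemma lattice_map_tendsto:
  fixes m :: "nat \<Rightarrow> nat"
  assumes \<alpha>: "0 < \<alpha>" and m: "\<And>i. i \<in> {1..N} \<Longrightarrow> a i = real (m i) * \<alpha>"
    and k0: "\<And>k. k0 \<le> k \<Longrightarrow> real k * \<alpha> \<in> shift_semigroup {1..N} a"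
    and n: "1 \<le> n" and c: "c < A"
  shows "\<exists>M. (scaled_tube \<delta> ((\<lambda>x. integral {c..x} (\<lambda>t. cdf_slope \<alpha> n (cdf \<nu> t))) ` K) \<longlongrightarrow> M) at_top"
proof -
  let ?h = "\<lambda>x. integral {c..x} (\<lambda>t. cdf_slope \<alpha> n (cdf \<nu> t))"
  have "\<exists>l. (\<lambda>k. Z (t0 + real k * \<alpha>)) \<longlonglongrightarrow> l" for t0
    by (rule convergent_lattice[OF \<alpha> m k0])
  then obtain H where H: "\<And>t0. (\<lambda>k. Z (t0 + real k * \<alpha>)) \<longlonglongrightarrow> H t0" by metis
  have shift: "H (t + real j * \<alpha>) = H t" for t j
  proof -
    have "(\<lambda>k. Z (t + real (k + j) * \<alpha>)) \<longlonglongrightarrow> H t" by (rule LIMSEQ_ignore_initial_segment[OF H])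
    then have "(\<lambda>k. Z ((t + real j * \<alpha>) + real k * \<alpha>)) \<longlonglongrightarrow> H t" by (simp add: algebra_simps)
    then show ?thesis using H LIMSEQ_unique by blast
  qed
  have H_borel: "H \<in> borel_measurable borel"
  proof (rule borel_measurable_LIMSEQ_real[OF H])
    show "(\<lambda>t. Z (t + real k * \<alpha>)) \<in> borel_measurable borel" for k
      using Z_borel by measurable
  qed
  have H_bounds: "0 \<le> H t" "H t \<le> exp ((1 - \<delta>) * (t - s)) * H s" if "s \<le> t" for s t
  proof -
    show "0 \<le> H t" by (rule LIMSEQ_le_const[OF H]) (auto simp: scaled_tube_nonneg)
    have "Z (t + real k * \<alpha>) \<le> exp ((1 - \<delta>) * (t - s)) * Z (s + real k * \<alpha>)" for k
      using growth[of "s + real k * \<alpha>" "t + real k * \<alpha>"] that by simp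
    then show "H t \<le> exp ((1 - \<delta>) * (t - s)) * H s"
      by (intro LIMSEQ_le[OF H tendsto_mult[OF tendsto_const H]]) auto
  qed
  have H_int: "set_integrable lborel {x..y} H" for x y
    unfolding set_integrable_def
  proof (rule integrableI_bounded_set_indicator[where B="exp ((1 - \<delta>) * (y - x)) * H x"])
    have "H t \<le> exp ((1 - \<delta>) * (y - x)) * H x" if t: "t \<in> {x..y}" for t
    proof -
      have "H t \<le> exp ((1 - \<delta>) * (t - x)) * H x" using H_bounds(2)[of x t] t by simp
      also have "\<dots> \<le> exp ((1 - \<delta>) * (y - x)) * H x"
        using t delta_less_1 H_bounds(1)[of x x] by (intro mult_right_mono) (auto intro: mult_left_mono)
      finally show ?thesis .
    qed
    then show "AE t in lborel. t \<in> {x..y} \<longrightarrow> norm (H t) \<le> exp ((1 - \<delta>) * (y - x)) * H x"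
      using H_bounds(1) by auto
  qed (use H_borel in \<open>auto simp: emeasure_lborel_Icc_eq\<close>)
  have deriv: "(?h has_real_derivative cdf_slope \<alpha> n (cdf \<nu> x)) (at x)" if "x \<in> {A..B}" for x
    using lattice_map_deriv[OF \<alpha>, of c x n] that c by simp
  have pos: "0 < cdf_slope \<alpha> n (cdf \<nu> x)" for x by (rule cdf_slope_pos[OF \<alpha> nu.cdf_nonneg])
  define I where "I t0 = \<delta> / (exp (\<delta> * \<alpha> * real n) - 1) * integral {t0 - real n * \<alpha>..t0} H" for t0
  have lim: "(\<lambda>k. scaled_tube \<delta> (?h ` K) (t0 + real k * \<alpha>)) \<longlonglongrightarrow> I t0" for t0
  proof -
    define F where "F = filtermap (\<lambda>k. t0 + real k * \<alpha>) sequentially"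
    have F: "F \<le> at_top" "F \<noteq> bot"
    proof -
      show "F \<le> at_top"
        unfolding F_def filterlim_def[symmetric]
        by (rule filterlim_tendsto_add_at_top[OF tendsto_const])
          (rule filterlim_at_top_mult_tendsto_pos[OF tendsto_const \<alpha> filterlim_real_sequentially])
      show "F \<noteq> bot" by (simp add: F_def filtermap_bot_iff)
    qed
    have P: "((\<lambda>t. Z (t + x + ln \<bar>sw w\<bar>)) \<longlongrightarrow> H (t0 + x)) F" if w: "set w \<subseteq> {1..N}" for w x
    proof -
      \<comment> \<open>The contraction along a word translates by a multiple of
        \<open>\<alpha>\<close>, which leaves the periodic limit unchanged.\<close>
      have "\<exists>j. - ln \<bar>sw w\<bar> = real j * \<alpha>" using w
      proof (induction w)
        case Nil
        show ?case by (intro exI[of _ 0]) simp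
      next
        case (Cons i w)
        then obtain j where "- ln \<bar>sw w\<bar> = real j * \<alpha>" by auto
        moreover have "- ln \<bar>sw (i # w)\<bar> = a i + - ln \<bar>sw w\<bar>"
          using s_nz[of i] sw_nz[of w] Cons.prems by (simp add: abs_mult ln_mult)
        ultimately have "- ln \<bar>sw (i # w)\<bar> = real (m i + j) * \<alpha>"
          using m[of i] Cons.prems by (simp add: algebra_simps)
        then show ?case by blast
      qed
      then obtain j where j: "ln \<bar>sw w\<bar> = - (real j * \<alpha>)" by (metis minus_equation_iff)
      have "(\<lambda>k. Z ((t0 + x - real j * \<alpha>) + real k * \<alpha>)) \<longlonglongrightarrow> H (t0 + x - real j * \<alpha>)" by (rule H)
      moreover have "H (t0 + x - real j * \<alpha>) = H (t0 + x)" using shift[of "t0 + x - real j * \<alpha>" j] by simp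
      ultimately show ?thesis unfolding F_def filterlim_filtermap j by (simp add: algebra_simps)
    qed
    have "((scaled_tube \<delta> (?h ` K)) \<longlongrightarrow>
      (LINT x:K|\<nu>. cdf_slope \<alpha> n (cdf \<nu> x) powr \<delta> * H (t0 + ln (cdf_slope \<alpha> n (cdf \<nu> x))))) F"
      by (rule scaled_tube_image_tendsto[OF deriv continuous_on_cdf_slope[OF \<alpha>] pos F P])
    also have "(LINT x:K|\<nu>. cdf_slope \<alpha> n (cdf \<nu> x) powr \<delta> * H (t0 + ln (cdf_slope \<alpha> n (cdf \<nu> x))))
        = (LINT u:{0..1}|lborel. cdf_slope \<alpha> n u powr \<delta> * H (t0 + ln (cdf_slope \<alpha> n u)))"
    proof (rule integral_cdf_substitution)
      have "cdf_slope \<alpha> n \<in> borel_measurable borel" unfolding cdf_slope_def[abs_def] by measurable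
      then show "(\<lambda>u. cdf_slope \<alpha> n u powr \<delta> * H (t0 + ln (cdf_slope \<alpha> n u))) \<in> borel_measurable borel"
        using H_borel by measurable
    qed
    also have "\<dots> = I t0"
      unfolding I_def using cdf_slope_integral[OF \<alpha> n H_int, of t0] by (simp add: mult.commute)
    finally show ?thesis unfolding F_def filterlim_filtermap .
  qed
  have "I t0 = I 0" for t0
    unfolding I_def
    using periodic_integral_const[of H "real n * \<alpha>" t0 0] shift \<alpha>
      set_borel_integral_eq_integral(1)[OF H_int] by simp
  then have lim': "(\<lambda>k. scaled_tube \<delta> (?h ` K) (t0 + real k * \<alpha>)) \<longlonglongrightarrow> I 0" for t0
    using lim by metis
  have hK: "compact (?h ` K)" "?h ` K \<noteq> {}"
  proof -
    have "continuous_on {A..B} ?h"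
      using deriv by (meson DERIV_isCont continuous_at_imp_continuous_on)
    then show "compact (?h ` K)" "?h ` K \<noteq> {}"
      using AB K_ne by (auto intro!: compact_continuous_image intro: continuous_on_subset)
  qed
  have "(scaled_tube \<delta> (?h ` K) \<longlongrightarrow> I 0) at_top"
    by (rule tendsto_at_top_if_along_lattice[OF scaled_tube_growth[OF hK] _ scaled_tube_nonneg \<alpha> lim'])
      (use delta_less_1 in auto)
  then show ?thesis by blast
qed

text \<open>The derivative is a Lipschitz function of the distribution function and inherits its
  Hoelder exponent. With this the lattice map is an admissible map under which the image of
  \<open>K\<close> can have a content in the lattice case.\<close>

lemma admissible_lattice_map:
  assumes "0 < \<alpha>"
  shows "\<exists>\<beta>. 0 < \<beta> \<and> C1_Hoelder_on \<beta> {c<..} (\<lambda>x. integral {c..x} (\<lambda>t. cdf_slope \<alpha> n (cdf \<nu> t))) \<and>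
    (\<exists>e>0. \<forall>x\<in>{c<..}. e \<le> \<bar>deriv (\<lambda>x. integral {c..x} (\<lambda>t. cdf_slope \<alpha> n (cdf \<nu> t))) x\<bar>)"
proof -
  let ?h = "\<lambda>x. integral {c..x} (\<lambda>t. cdf_slope \<alpha> n (cdf \<nu> t))"
  define E where "E = exp (\<delta> * \<alpha> * real n)"
  have E: "1 \<le> E" unfolding E_def using assms delta_pos by simp
  obtain C \<beta> where C: "0 < \<beta>" "0 < C" "\<And>x y. \<bar>cdf \<nu> x - cdf \<nu> y\<bar> \<le> C * \<bar>x - y\<bar> powr \<beta>"
    by (rule cdf_Hoelder) (rule that)
  have deriv: "deriv ?h x = cdf_slope \<alpha> n (cdf \<nu> x)" "?h field_differentiable (at x)" if "x \<in> {c<..}" for x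
    using lattice_map_deriv[OF assms, of c x n] that
    by (auto intro: DERIV_imp_deriv simp: field_differentiable_def)
  have Lip: "\<bar>cdf_slope \<alpha> n u - cdf_slope \<alpha> n v\<bar> \<le> (E - 1) / \<delta> * \<bar>u - v\<bar>" if "0 \<le> u" "0 \<le> v" for u v
  proof -
    have lt: "\<bar>cdf_slope \<alpha> n u - cdf_slope \<alpha> n v\<bar> \<le> (E - 1) / \<delta> * \<bar>u - v\<bar>" if uv: "0 \<le> u" "u < v" for u v
    proof -
      define f' where "f' z = - 1 / \<delta> * (z * (E - 1) + 1) powr (- 1 / \<delta> - 1) * (E - 1)" for z
      have d: "(cdf_slope \<alpha> n has_real_derivative f' z) (at z)" if "u \<le> z" "z \<le> v" for z
      proof -
        have "0 < z * (E - 1) + 1" using cdf_slope_base[OF assms, of z n] that uv by (simp add: E_def)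
        then show ?thesis
          unfolding cdf_slope_def[abs_def] E_def[symmetric] f'_def
          by (auto intro!: derivative_eq_intros)
      qed
      have "\<exists>z>u. z < v \<and> cdf_slope \<alpha> n v - cdf_slope \<alpha> n u = (v - u) * f' z"
        by (rule MVT2[OF uv(2) d])
      then obtain z where z: "u < z" "z < v" "cdf_slope \<alpha> n v - cdf_slope \<alpha> n u = (v - u) * f' z" by blast
      have "1 \<le> z * (E - 1) + 1" using cdf_slope_base[OF assms, of z n] z uv by (simp add: E_def)
      then have "(z * (E - 1) + 1) powr (- 1 / \<delta> - 1) \<le> 1"
        using powr_mono2'[of "- (1 / \<delta>) - 1" 1 "z * (E - 1) + 1"] delta_pos
        by (simp add: order.trans[of "- 1" 0])
      then have "(1 / \<delta>) * (z * (E - 1) + 1) powr (- 1 / \<delta> - 1) * (E - 1) \<le> (1 / \<delta>) * 1 * (E - 1)"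
        using delta_pos E by (intro mult_right_mono mult_left_mono) auto
      then have "\<bar>f' z\<bar> \<le> (E - 1) / \<delta>"
        using delta_pos E by (simp add: f'_def abs_mult)
      then have "\<bar>(v - u) * f' z\<bar> \<le> (E - 1) / \<delta> * \<bar>u - v\<bar>"
        using uv by (simp add: abs_mult mult.commute mult_left_mono del: times_divide_eq_left times_divide_eq_right)
      then show ?thesis using z(3) by (simp add: abs_minus_commute)
    qed
    show ?thesis using lt[of u v] lt[of v u] that
      by (cases u v rule: linorder_cases) (auto simp: abs_minus_commute)
  qed
  have "\<bar>deriv ?h x - deriv ?h y\<bar> \<le> ((E - 1) / \<delta> * C) * \<bar>x - y\<bar> powr \<beta>" if "x \<in> {c<..}" "y \<in> {c<..}" for x y
  proof -
    have "\<bar>deriv ?h x - deriv ?h y\<bar> \<le> (E - 1) / \<delta> * \<bar>cdf \<nu> x - cdf \<nu> y\<bar>"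
      using deriv(1) that Lip[OF nu.cdf_nonneg nu.cdf_nonneg] by simp
    also have "\<dots> \<le> (E - 1) / \<delta> * (C * \<bar>x - y\<bar> powr \<beta>)"
      using C(3) E delta_pos by (intro mult_left_mono) auto
    finally show ?thesis by (simp only: mult.assoc)
  qed
  moreover have "E powr (- 1 / \<delta>) \<le> \<bar>deriv ?h x\<bar>" if "x \<in> {c<..}" for x
  proof -
    have "cdf \<nu> x * (E - 1) \<le> 1 * (E - 1)"
      using nu.cdf_bounded_prob[of x] E by (intro mult_right_mono) auto
    then have "E powr (- 1 / \<delta>) \<le> (cdf \<nu> x * (E - 1) + 1) powr (- 1 / \<delta>)"
      using cdf_slope_base[OF assms nu.cdf_nonneg, of x n] delta_pos
      by (intro powr_mono2') (auto simp: E_def)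
    then show ?thesis using deriv(1)[OF that] by (simp add: cdf_slope_def E_def)
  qed
  moreover have "0 < E powr (- 1 / \<delta>)" using E by simp
  ultimately show ?thesis using deriv(2) C(1) unfolding C1_Hoelder_on_def by blast
qed

end

section \<open>Minkowski contents of self-similar sets and their images\<close>

context affine_ifs
begin

lemma content_K_average: "has_average_minkowski_content \<delta> K (L / \<mu>)"
  by (rule has_average_if_tendsto[OF AB(5) K_ne]) (use Cesaro_Z in \<open>simp add: J_def\<close>)

text \<open>\<open>deriv g\<close> is continuous without zeros, so it has a constant sign
  \<open>\<sigma>\<close> on the hull. The map \<open>\<sigma> * g\<close> is increasing with slope
  \<open>\<bar>deriv g x\<bar>\<close>, and reflecting the image does not change volumes.\<close>

lemma C1_image_limits:
  assumes U: "{A..B} \<subseteq> U" and diff: "\<And>x. x \<in> U \<Longrightarrow> g field_differentiable (at x)"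
    and cont: "continuous_on U (deriv g)" and nz: "\<And>x. x \<in> U \<Longrightarrow> deriv g x \<noteq> 0"
  shows "has_average_minkowski_content \<delta> (g ` K) (L / \<mu> * derivative_moment \<nu> K \<delta> g)"
    "(Z \<longlongrightarrow> M) at_top \<Longrightarrow> (scaled_tube \<delta> (g ` K) \<longlongrightarrow> M * derivative_moment \<nu> K \<delta> g) at_top"
proof -
  have contAB: "continuous_on {A..B} (deriv g)" using cont U by (rule continuous_on_subset)
  have nzAB: "deriv g x \<noteq> 0" if "x \<in> {A..B}" for x using nz U that by blast
  have der: "(g has_real_derivative deriv g x) (at x)" if "x \<in> {A..B}" for x
    using diff U that by (auto simp: field_differentiable_derivI)
  define \<sigma> :: real where "\<sigma> = sgn (deriv g A)"
  have \<sigma>: "\<bar>\<sigma>\<bar> = 1" using nzAB[of A] AB(1) by (simp add: \<sigma>_def)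
  have sign: "\<sigma> * deriv g x = \<bar>deriv g x\<bar>" if x: "x \<in> {A..B}" for x
  proof (cases "deriv g A > 0")
    case True
    have "deriv g x > 0"
    proof (rule ccontr)
      assume "\<not> deriv g x > 0"
      then obtain z where "A \<le> z" "z \<le> x" "deriv g z = 0"
        using IVT2'[of "deriv g" x 0 A] True x continuous_on_subset[OF contAB, of "{A..x}"] by auto
      then show False using nzAB[of z] x by auto
    qed
    then show ?thesis using True by (simp add: \<sigma>_def)
  next
    case False
    then have neg: "deriv g A < 0" using nzAB[of A] AB(1) by simp
    have "deriv g x < 0"
    proof (rule ccontr)
      assume "\<not> deriv g x < 0"
      then obtain z where "A \<le> z" "z \<le> x" "deriv g z = 0"
        using IVT'[of "deriv g" A 0 x] neg x continuous_on_subset[OF contAB, of "{A..x}"] by auto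
      then show False using nzAB[of z] x by auto
    qed
    then show ?thesis using neg by (simp add: \<sigma>_def)
  qed
  define h where "h x = \<sigma> * g x" for x
  have h: "(h has_real_derivative \<bar>deriv g x\<bar>) (at x)" if "x \<in> {A..B}" for x
    unfolding h_def sign[OF that, symmetric] by (intro DERIV_cmult der that)
  have hc: "continuous_on {A..B} (\<lambda>x. \<bar>deriv g x\<bar>)" by (intro continuous_intros contAB)
  have hp: "0 < \<bar>deriv g x\<bar>" if "x \<in> {A..B}" for x using nzAB[OF that] by simp
  have gK: "compact (g ` K)" "g ` K \<noteq> {}"
  proof -
    have "continuous_on {A..B} g" using der by (meson DERIV_isCont continuous_at_imp_continuous_on)
    then show "compact (g ` K)" "g ` K \<noteq> {}"
      using AB K_ne by (auto intro!: compact_continuous_image intro: continuous_on_subset)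
  qed
  have "tube (h ` K) = tube (g ` K)"
  proof
    fix \<epsilon>
    have "\<sigma> \<noteq> 0" using \<sigma> by auto
    then have "tube ((\<lambda>x. \<sigma> * x + 0) ` g ` K) \<epsilon> = tube (g ` K) \<epsilon>"
      using tube_affine_image[OF gK, of \<sigma> 0 \<epsilon>] \<sigma> by simp
    then show "tube (h ` K) \<epsilon> = tube (g ` K) \<epsilon>" by (simp add: image_image h_def)
  qed
  then have st: "scaled_tube \<delta> (h ` K) = scaled_tube \<delta> (g ` K)" by (simp add: scaled_tube_def fun_eq_iff)
  have moment: "(LINT x:K|\<nu>. \<bar>deriv g x\<bar> powr \<delta>) = derivative_moment \<nu> K \<delta> g"
    by (simp add: derivative_moment_def)
  show "has_average_minkowski_content \<delta> (g ` K) (L / \<mu> * derivative_moment \<nu> K \<delta> g)"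
    using has_average_if_tendsto[OF gK] Cesaro_scaled_tube_image[OF h hc hp] unfolding st moment .
  assume Z: "(Z \<longlongrightarrow> M) at_top"
  have "((\<lambda>t. Z (t + x + ln \<bar>sw w\<bar>)) \<longlongrightarrow> M) at_top" for x w
  proof (rule filterlim_compose[OF Z])
    have "filterlim (\<lambda>t. (x + ln \<bar>sw w\<bar>) + t) at_top at_top"
      by (rule filterlim_tendsto_add_at_top[OF tendsto_const filterlim_ident])
    then show "filterlim (\<lambda>t. t + x + ln \<bar>sw w\<bar>) at_top at_top" by (simp add: algebra_simps)
  qed
  then have "(scaled_tube \<delta> (h ` K) \<longlongrightarrow> (LINT x:K|\<nu>. \<bar>deriv g x\<bar> powr \<delta> * M)) at_top"
    by (intro scaled_tube_image_tendsto[where P="\<lambda>_. M", OF h hc hp]) auto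
  then show "(scaled_tube \<delta> (g ` K) \<longlongrightarrow> M * derivative_moment \<nu> K \<delta> g) at_top"
    unfolding st moment[symmetric] by (simp add: mult.commute)
qed

lemma no_content_lattice:
  assumes "0 < \<alpha>" and "\<And>i. i \<in> {1..N} \<Longrightarrow> a i = real (m i) * \<alpha>"
  shows "\<not> has_minkowski_content \<delta> K M"
proof
  assume M: "has_minkowski_content \<delta> K M"
  obtain b where "\<And>t. 0 \<le> t \<Longrightarrow> Z t \<le> b" using Z_bounded[of 0] by auto
  then have "\<forall>\<^sub>F t in at_top. Z t \<le> b"
    by (intro eventually_mono[OF eventually_ge_at_top[of 0]])
  then show False
    using tendsto_if_has_minkowski_content[OF M] not_tendsto_lattice[OF assms] by blast
qed

end

lemma shift_semigroup_cong:
  assumes "\<And>i. i \<in> I \<Longrightarrow> a i = a' i"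
  shows "shift_semigroup I a = shift_semigroup I a'"
proof -
  have "x \<in> shift_semigroup I a'" if "x \<in> shift_semigroup I a" "\<And>i. i \<in> I \<Longrightarrow> a i = a' i" for x a a'
    using that(1) by induction (auto simp: that(2) intro: shift_semigroup.intros)
  then show ?thesis using assms by (intro set_eqI iffI) metis+
qed

section \<open>From conformal systems of similarities to affine maps\<close>

text \<open>At every \<open>x\<close> the triangle inequality between \<open>f l\<close>,
  \<open>f x\<close> and \<open>f u\<close> is an equality, so \<open>f x\<close> lies between the
  end values at a determined position; the sign of \<open>f u - f l\<close> decides the
  orientation.\<close>

lemma similarity_on_interval_affine:
  fixes f :: "real \<Rightarrow> real"
  assumes "l < u" and f: "\<And>x y. x \<in> {l..u} \<Longrightarrow> y \<in> {l..u} \<Longrightarrow> \<bar>f x - f y\<bar> = r * \<bar>x - y\<bar>"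
  obtains s b where "\<bar>s\<bar> = r" "\<And>x. x \<in> {l..u} \<Longrightarrow> f x = s * x + b"
proof -
  have ful: "\<bar>f u - f l\<bar> = r * (u - l)" using f[of u l] assms(1) by simp
  have parts: "\<bar>f x - f l\<bar> = r * (x - l)" "\<bar>f u - f x\<bar> = r * (u - x)" if "x \<in> {l..u}" for x
    using f[of x l] f[of u x] that by auto
  have split: "r * (u - l) = r * (x - l) + r * (u - x)" for x by (simp add: algebra_simps)
  have "0 \<le> r * (u - l)" using ful abs_ge_zero[of "f u - f l"] by linarith
  then have "0 \<le> r" using assms(1) by (simp add: zero_le_mult_iff)
  show ?thesis
  proof (cases "0 \<le> f u - f l")
    case True
    have *: "f x = r * x + (f l - r * l)" if "x \<in> {l..u}" for x
    proof -
      have "f x - f l = r * (x - l)" using parts[OF that] ful split[of x] True by linarith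
      then show ?thesis by (simp add: algebra_simps)
    qed
    show ?thesis by (rule that[of r "f l - r * l"]) (use \<open>0 \<le> r\<close> in simp, rule *)
  next
    case False
    have *: "f x = - r * x + (f l + r * l)" if "x \<in> {l..u}" for x
    proof -
      have "f l - f x = r * (x - l)" using parts[OF that] ful split[of x] False by linarith
      then show ?thesis by (simp add: algebra_simps)
    qed
    show ?thesis by (rule that[of "- r" "f l + r * l"]) (use \<open>0 \<le> r\<close> in simp, rule *)
  qed
qed

text \<open>\<open>A\<close> and \<open>B\<close> are the least and the greatest point of
  \<open>K\<close>. The hull may be smaller than \<open>X\<close>, but its interior lies in that of
  \<open>X\<close>, so disjointness of the images and nullity of the overlaps are inherited.\<close>

lemma affine_ifs_if_conformal:
  assumes ifs: "self_similar_IFS X N R r" and osc: "open_set_condition N R (interior X)"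
    and K: "self_similar_set X N R K" and null: "emeasure lborel K = 0"
    and conf: "conformal_measure X N R K \<delta> \<nu>"
  obtains s b A B where "affine_ifs N s b K A B \<delta> \<nu>" "\<And>i. i \<in> {1..N} \<Longrightarrow> \<bar>s i\<bar> = r i" "{A..B} \<subseteq> X"
proof -
  have X: "X \<noteq> {}" "compact X" "is_interval X" and N: "2 \<le> N"
    and R: "\<And>i. i \<in> {1..N} \<Longrightarrow> 0 < r i \<and> r i < 1 \<and> R i ` X \<subseteq> X"
      "\<And>i x y. i \<in> {1..N} \<Longrightarrow> x \<in> X \<Longrightarrow> y \<in> X \<Longrightarrow> \<bar>R i x - R i y\<bar> = r i * \<bar>x - y\<bar>"
    using ifs unfolding self_similar_IFS_def by auto
  obtain l u where lu: "X = {l..u}"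
    using X connected_compact_interval_1[of X] by (auto simp: is_interval_connected_1)
  have "interior X \<noteq> {}" using osc by (simp add: open_set_condition_def)
  then have "l < u" by (simp add: lu)
  have "\<exists>s b. \<bar>s\<bar> = r i \<and> (\<forall>x\<in>X. R i x = s * x + b)" if i: "i \<in> {1..N}" for i
    using similarity_on_interval_affine[OF \<open>l < u\<close>, of "R i" "r i"] R(2)[OF i] unfolding lu by metis
  then obtain s b where s: "\<And>i. i \<in> {1..N} \<Longrightarrow> \<bar>s i\<bar> = r i"
    and Rs: "\<And>i x. i \<in> {1..N} \<Longrightarrow> x \<in> X \<Longrightarrow> R i x = s i * x + b i" by metis
  have K': "K \<noteq> {}" "compact K" "K \<subseteq> X" "K = (\<Union>i\<in>{1..N}. R i ` K)"
    using K by (auto simp: self_similar_set_def)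
  obtain A where A: "A \<in> K" "\<And>x. x \<in> K \<Longrightarrow> A \<le> x" using compact_attains_inf[OF K'(2,1)] by blast
  obtain B where B: "B \<in> K" "\<And>x. x \<in> K \<Longrightarrow> x \<le> B" using compact_attains_sup[OF K'(2,1)] by blast
  have ABX: "{A..B} \<subseteq> X" using A B K'(3) lu by auto
  have img: "(\<lambda>x. s i * x + b i) ` C = R i ` C" if "i \<in> {1..N}" "C \<subseteq> X" for i C
    using Rs that by (auto simp: image_iff subset_iff)
  have cptR: "compact (R i ` C)" if "i \<in> {1..N}" "C \<subseteq> X" "compact C" for i C
    unfolding img[OF that(1,2), symmetric] using that(3)
    by (intro compact_continuous_image continuous_intros)
  have \<nu>: "prob_space \<nu>" "sets \<nu> = sets borel" "measure \<nu> (- K) = 0"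
    "\<And>i j. i \<in> {1..N} \<Longrightarrow> j \<in> {1..N} \<Longrightarrow> i \<noteq> j \<Longrightarrow> measure \<nu> (R i ` X \<inter> R j ` X) = 0"
    "\<And>i B. i \<in> {1..N} \<Longrightarrow> B \<in> sets borel \<Longrightarrow> B \<subseteq> X \<Longrightarrow>
      measure \<nu> (R i ` B) = (LINT x:B|\<nu>. \<bar>vector_derivative (R i) (at x within X)\<bar> powr \<delta>)"
    using conf unfolding conformal_measure_def by auto
  interpret prob_space \<nu> by (rule \<nu>(1))
  have space: "space \<nu> = UNIV" using sets_eq_imp_space_eq[OF \<nu>(2)] by simp
  have sets: "C \<in> sets \<nu>" if "compact C" for C using that by (simp add: \<nu>(2) borel_compact)
  have nu_K: "measure \<nu> K = 1"
    using prob_compl[OF sets[OF K'(2)]] \<nu>(3) by (simp add: space Compl_eq_Diff_UNIV)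
  have overlap: "measure \<nu> (R i ` C \<inter> R j ` C) = 0"
    if "i \<in> {1..N}" "j \<in> {1..N}" "i \<noteq> j" "C \<subseteq> X" for i j C
  proof -
    have "measure \<nu> (R i ` C \<inter> R j ` C) \<le> measure \<nu> (R i ` X \<inter> R j ` X)"
      using that cptR[OF that(1) order_refl X(2)] cptR[OF that(2) order_refl X(2)]
      by (intro finite_measure_mono sets compact_Int) auto
    then show ?thesis using \<nu>(4)[OF that(1-3)] by (simp add: measure_le_0_iff)
  qed
  \<comment> \<open>If \<open>K\<close> were a single point, every map would fix it; it would then
    be an overlap of two images, of mass 0, and carry the full mass at the same time.\<close>
  have "A < B"
  proof (rule ccontr)
    assume "\<not> A < B"
    then have "K = {A}" using A B by force
    moreover have "R i ` K \<subseteq> K" if "i \<in> {1..N}" for i by (subst (2) K'(4)) (use that in blast)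
    ultimately have "R i ` K = K" if "i \<in> {1..N}" for i using that by auto
    then have "R 1 ` K \<inter> R 2 ` K = K" using N by auto
    then show False using overlap[of 1 2 K] N K'(3) nu_K by auto
  qed
  have "affine_ifs N s b K A B \<delta> \<nu>"
  proof (rule affine_ifs.intro)
    show "2 \<le> N" "A < B" "A \<in> K" "B \<in> K" "compact K" "prob_space \<nu>" "sets \<nu> = sets borel" "measure \<nu> K = 1"
      "emeasure lborel K = 0"
      by (fact N \<open>A < B\<close> A(1) B(1) K'(2) \<nu>(1,2) nu_K null)+
    show "K \<subseteq> {A..B}" using A B by auto
    show "s i \<noteq> 0" "\<bar>s i\<bar> < 1" if "i \<in> {1..N}" for i using R(1)[OF that] s[OF that] by auto
    show "K = (\<Union>i\<in>{1..N}. (\<lambda>x. s i * x + b i) ` K)"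
      by (subst K'(4)) (use img[OF _ K'(3)] in auto)
  next
    fix i j assume ij: "i \<in> {1..N}" "j \<in> {1..N}" "i \<noteq> j"
    have "{A<..<B} \<subseteq> {A..B}" by auto
    then have oX: "{A<..<B} \<subseteq> X" using ABX by blast
    then have "{A<..<B} \<subseteq> interior X" by (intro interior_maximal) auto
    then have "R i ` {A<..<B} \<inter> R j ` {A<..<B} \<subseteq> R i ` interior X \<inter> R j ` interior X" by blast
    also have "\<dots> = {}" using osc ij by (simp add: open_set_condition_def)
    finally show "(\<lambda>x. s i * x + b i) ` {A<..<B} \<inter> (\<lambda>x. s j * x + b j) ` {A<..<B} = {}"
      unfolding img[OF ij(1) oX] img[OF ij(2) oX] by blast
    show "measure \<nu> ((\<lambda>x. s i * x + b i) ` {A..B} \<inter> (\<lambda>x. s j * x + b j) ` {A..B}) = 0"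
      unfolding img[OF ij(1) ABX] img[OF ij(2) ABX] by (rule overlap[OF ij ABX])
  next
    fix i C assume i: "i \<in> {1..N}" and C: "compact C" "C \<subseteq> {A..B}"
    have CX: "C \<subseteq> X" using C(2) ABX by blast
    have der: "vector_derivative (R i) (at x within X) = s i" if "x \<in> X" for x
    proof -
      have "((\<lambda>x. s i * x + b i) has_vector_derivative s i) (at x within X)"
        unfolding has_real_derivative_iff_has_vector_derivative[symmetric]
        by (auto intro!: derivative_eq_intros)
      then have "(R i has_vector_derivative s i) (at x within X)"
        by (rule has_vector_derivative_transform[OF that, rotated]) (simp add: Rs[OF i])
      then show ?thesis
        using vector_derivative_within_closed_interval[OF \<open>l < u\<close>, of x "R i" "s i"] that by (simp add: lu)
    qed
    have "measure \<nu> (R i ` C) = (LINT x:C|\<nu>. \<bar>vector_derivative (R i) (at x within X)\<bar> powr \<delta>)"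
      using C(1) CX i by (intro \<nu>(5)) (auto simp: borel_compact)
    also have "\<dots> = (LINT x:C|\<nu>. \<bar>s i\<bar> powr \<delta>)"
      using CX by (intro set_lebesgue_integral_cong sets C(1)) (auto simp: der)
    also have "\<dots> = \<bar>s i\<bar> powr \<delta> * measure \<nu> C"
      unfolding set_lebesgue_integral_def using sets[OF C(1)] by simp
    finally show "measure \<nu> ((\<lambda>x. s i * x + b i) ` C) = \<bar>s i\<bar> powr \<delta> * measure \<nu> C"
      by (simp only: img[OF i CX])
  qed
  then show ?thesis using that s ABX by blast
qed

lemma C1_Hoelder_continuous_deriv:
  assumes "C1_Hoelder_on \<alpha> U g" "0 < \<alpha>"
  shows "continuous_on U (deriv g)"
proof -
  obtain C where C: "\<And>x y. x \<in> U \<Longrightarrow> y \<in> U \<Longrightarrow> \<bar>deriv g x - deriv g y\<bar> \<le> C * \<bar>x - y\<bar> powr \<alpha>"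
    using assms(1) unfolding C1_Hoelder_on_def by blast
  show ?thesis
    unfolding continuous_on_def
  proof
    fix x assume x: "x \<in> U"
    show "(deriv g \<longlongrightarrow> deriv g x) (at x within U)"
      unfolding tendsto_dist_iff[of "deriv g"]
    proof (rule Lim_null_comparison)
      show "\<forall>\<^sub>F y in at x within U. norm (dist (deriv g y) (deriv g x)) \<le> C * \<bar>y - x\<bar> powr \<alpha>"
        unfolding eventually_at_filter using C x by (auto simp: dist_real_def intro!: always_eventually)
      have "((\<lambda>y. C * \<bar>y - x\<bar> powr \<alpha>) \<longlongrightarrow> C * \<bar>x - x\<bar> powr \<alpha>) (at x within U)"
        using assms(2) by (intro tendsto_intros tendsto_powr') auto
      then show "((\<lambda>y. C * \<bar>y - x\<bar> powr \<alpha>) \<longlongrightarrow> 0) (at x within U)" using assms(2) by simp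
    qed
  qed
qed

theorem corollary2p14:
  fixes X K U F :: "real set" and N :: nat
    and R :: "nat \<Rightarrow> real \<Rightarrow> real" and r :: "nat \<Rightarrow> real"
    and \<delta> \<alpha> :: real and g :: "real \<Rightarrow> real" and \<nu> :: "real measure"
  assumes "self_similar_IFS X N R r"
    and "open_set_condition N R (interior X)"
    and "self_similar_set X N R K"
    and "has_minkowski_dimension K \<delta>"
    and "admissible_map X \<alpha> U g"
    and "emeasure lborel K = 0"
    and "F = g ` K"
    and "conformal_measure X N R K \<delta> \<nu>"
  shows
    "(\<exists>MK MF. has_average_minkowski_content \<delta> K MK \<and> has_average_minkowski_content \<delta> F MF \<and>
        MF = MK * derivative_moment \<nu> K \<delta> g) \<and>
     (\<not> lattice_IFS N r \<longrightarrow>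
       (\<exists>MK MF. has_minkowski_content \<delta> K MK \<and> has_minkowski_content \<delta> F MF \<and>
          MF = MK * ereal (derivative_moment \<nu> K \<delta> g))) \<and>
     (lattice_IFS N r \<longrightarrow>
       (\<nexists>M. has_minkowski_content \<delta> K M) \<and>
       (\<exists>\<beta> V h. admissible_map X \<beta> V h \<and> (\<exists>M. has_minkowski_content \<delta> (h ` K) M)) \<and>
       (\<exists>\<beta> V h. admissible_map X \<beta> V h \<and> (\<nexists>M. has_minkowski_content \<delta> (h ` K) M)) \<and>
       (\<forall>a. K \<subseteq> {0..1} \<and> maximal_lattice_const N r a \<longrightarrow>
          (\<forall>n\<ge>1. lower_minkowski_content \<delta> (lattice_map \<nu> \<delta> a n ` K) =
                 upper_minkowski_content \<delta> (lattice_map \<nu> \<delta> a n ` K))))"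
proof -
  obtain s b A B where ifs: "affine_ifs N s b K A B \<delta> \<nu>"
    and s: "\<And>i. i \<in> {1..N} \<Longrightarrow> \<bar>s i\<bar> = r i" and ABX: "{A..B} \<subseteq> X"
    using affine_ifs_if_conformal[OF assms(1,2,3,6,8)] by metis
  interpret I: affine_ifs N s b K A B \<delta> \<nu> by (rule ifs)
  have N: "1 \<le> N" and r: "\<And>i. i \<in> {1..N} \<Longrightarrow> r i < 1 \<and> 0 < r i"
    using assms(1) by (auto simp: self_similar_IFS_def)
  have semi: "shift_semigroup {1..N} (\<lambda>i. - ln \<bar>s i\<bar>) = shift_semigroup {1..N} (\<lambda>i. - ln (r i))"
    by (rule shift_semigroup_cong) (simp add: s)
  have U: "0 < \<alpha>" "X \<subseteq> U" "C1_Hoelder_on \<alpha> U g" "\<exists>c>0. \<forall>x\<in>U. c \<le> \<bar>deriv g x\<bar>"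
    using assms(5) by (auto simp: admissible_map_def)
  have g: "{A..B} \<subseteq> U" "\<And>x. x \<in> U \<Longrightarrow> g field_differentiable (at x)" "continuous_on U (deriv g)"
    "\<And>x. x \<in> U \<Longrightarrow> deriv g x \<noteq> 0"
    using ABX U C1_Hoelder_continuous_deriv[OF U(3,1)] by (force simp: C1_Hoelder_on_def)+
  have avg: "\<exists>MK MF. has_average_minkowski_content \<delta> K MK \<and> has_average_minkowski_content \<delta> F MF \<and>
        MF = MK * derivative_moment \<nu> K \<delta> g"
    unfolding assms(7) using I.content_K_average I.C1_image_limits(1)[OF g] by blast
  have nonlattice: "\<exists>MK MF. has_minkowski_content \<delta> K MK \<and> has_minkowski_content \<delta> F MF \<and>
          MF = MK * ereal (derivative_moment \<nu> K \<delta> g)" if "\<not> lattice_IFS N r"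
  proof -
    have Z: "(scaled_tube \<delta> K \<longlongrightarrow> I.L / I.\<mu>) at_top"
      by (rule I.tendsto_nonlattice) (use nonlattice_dense[OF that N r] semi in auto)
    show ?thesis
      unfolding assms(7)
      using has_minkowski_content_if_tendsto[OF Z]
        has_minkowski_content_if_tendsto[OF I.C1_image_limits(2)[OF g Z]]
      by (intro exI conjI) auto
  qed
  have lattice: "(\<nexists>M. has_minkowski_content \<delta> K M) \<and>
       (\<exists>\<beta> V h. admissible_map X \<beta> V h \<and> (\<exists>M. has_minkowski_content \<delta> (h ` K) M)) \<and>
       (\<exists>\<beta> V h. admissible_map X \<beta> V h \<and> (\<nexists>M. has_minkowski_content \<delta> (h ` K) M)) \<and>
       (\<forall>a. K \<subseteq> {0..1} \<and> maximal_lattice_const N r a \<longrightarrow>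
          (\<forall>n\<ge>1. lower_minkowski_content \<delta> (lattice_map \<nu> \<delta> a n ` K) =
                 upper_minkowski_content \<delta> (lattice_map \<nu> \<delta> a n ` K)))" if lat: "lattice_IFS N r"
  proof (intro conjI)
    have tendsto: "\<exists>M. (scaled_tube \<delta> ((\<lambda>x. integral {c..x} (\<lambda>t. I.cdf_slope a n (cdf \<nu> t))) ` K) \<longlongrightarrow> M) at_top"
      if a: "maximal_lattice_const N r a" and n: "1 \<le> n" and c: "c < A" for a n c
    proof -
      obtain m k0 where m: "\<And>i. i \<in> {1..N} \<Longrightarrow> - ln (r i) = real (m i) * a"
        "\<And>k. k0 \<le> k \<Longrightarrow> real k * a \<in> shift_semigroup {1..N} (\<lambda>i. - ln (r i))"
        by (rule maximal_lattice_const_semigroup[OF a N r]) (assumption, rule that)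
      show ?thesis
      proof (rule I.lattice_map_tendsto[OF _ _ _ n c])
        show "0 < a" using a by (simp add: maximal_lattice_const_def)
        show "- ln \<bar>s i\<bar> = real (m i) * a" if "i \<in> {1..N}" for i using m(1)[OF that] s[OF that] by simp
        show "real k * a \<in> shift_semigroup {1..N} (\<lambda>i. - ln \<bar>s i\<bar>)" if "k0 \<le> k" for k
          using m(2)[OF that] semi by simp
      qed
    qed
    obtain a where a: "maximal_lattice_const N r a"
      using maximal_lattice_const_exists[OF lat N r] by blast
    have "0 < a" using a by (simp add: maximal_lattice_const_def)
    show noK: "\<nexists>M. has_minkowski_content \<delta> K M"
    proof -
      obtain m k0 where m: "\<And>i. i \<in> {1..N} \<Longrightarrow> - ln (r i) = real (m i) * a"
        "\<And>k. k0 \<le> k \<Longrightarrow> real k * a \<in> shift_semigroup {1..N} (\<lambda>i. - ln (r i))"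
        by (rule maximal_lattice_const_semigroup[OF a N r]) (assumption, rule that)
      have "\<not> has_minkowski_content \<delta> K M" for M
        by (rule I.no_content_lattice[OF \<open>0 < a\<close>, of m]) (use m(1) s in simp)
      then show ?thesis by blast
    qed
    have "compact X" using assms(1) by (simp add: self_similar_IFS_def)
    then obtain e where e: "\<And>x. x \<in> X \<Longrightarrow> \<bar>x\<bar> \<le> e"
      using compact_imp_bounded[of X] unfolding bounded_iff by auto
    \<comment> \<open>A base point strictly to the left of \<open>X\<close> makes
      \<open>{c<..}\<close> a connected open neighbourhood of \<open>X\<close>; the point
      \<open>- 1\<close> need not lie there, since no position of \<open>K\<close> is assumed at
      this stage.\<close>
    define c where "c = - e - 1"
    have c: "c < x" if "x \<in> X" for x using e[OF that] unfolding c_def abs_le_iff by linarith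
    have "A \<in> X" using ABX I.AB(1) by auto
    let ?h = "\<lambda>x. integral {c..x} (\<lambda>t. I.cdf_slope a 1 (cdf \<nu> t))"
    obtain \<beta> where "0 < \<beta>" "C1_Hoelder_on \<beta> {c<..} ?h" "\<exists>e>0. \<forall>x\<in>{c<..}. e \<le> \<bar>deriv ?h x\<bar>"
      using I.admissible_lattice_map[OF \<open>0 < a\<close>, of c 1] by blast
    then have "admissible_map X \<beta> {c<..} ?h" using c by (auto simp: admissible_map_def)
    moreover have "\<exists>M. has_minkowski_content \<delta> (?h ` K) M"
      using tendsto[OF a, of 1 c] c[OF \<open>A \<in> X\<close>] has_minkowski_content_if_tendsto by blast
    ultimately show "\<exists>\<beta> V h. admissible_map X \<beta> V h \<and> (\<exists>M. has_minkowski_content \<delta> (h ` K) M)" by blast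
    \<comment> \<open>The identity witnesses that the content of an image may fail to exist, as the
      image is \<open>K\<close> itself.\<close>
    have "admissible_map X 1 UNIV (\<lambda>x. x)"
      by (auto simp: admissible_map_def C1_Hoelder_on_def intro!: exI[of _ 1])
    then show "\<exists>\<beta> V h. admissible_map X \<beta> V h \<and> (\<nexists>M. has_minkowski_content \<delta> (h ` K) M)"
      using noK by (intro exI[of _ 1] exI[of _ UNIV] exI[of _ "\<lambda>x. x"]) simp
    show "\<forall>a. K \<subseteq> {0..1} \<and> maximal_lattice_const N r a \<longrightarrow>
          (\<forall>n\<ge>1. lower_minkowski_content \<delta> (lattice_map \<nu> \<delta> a n ` K) =
                 upper_minkowski_content \<delta> (lattice_map \<nu> \<delta> a n ` K))"
    proof (intro allI impI)
      fix a n assume "K \<subseteq> {0..1} \<and> maximal_lattice_const N r a" "1 \<le> (n::nat)"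
      \<comment> \<open>\<open>K \<subseteq> {0..1}\<close> puts the base point \<open>- 1\<close>
        of the lattice map to the left of \<open>K\<close>.\<close>
      moreover from this have "- 1 < A" using I.AB(2) by force
      ultimately obtain M where
        "(scaled_tube \<delta> ((\<lambda>x. integral {- 1..x} (\<lambda>t. I.cdf_slope a n (cdf \<nu> t))) ` K) \<longlongrightarrow> M) at_top"
        using tendsto[of a n "- 1"] by blast
      then have "has_minkowski_content \<delta> (lattice_map \<nu> \<delta> a n ` K) (ereal M)"
        unfolding lattice_map_def[abs_def] I.cdf_slope_def by (rule has_minkowski_content_if_tendsto)
      then show "lower_minkowski_content \<delta> (lattice_map \<nu> \<delta> a n ` K) =
                 upper_minkowski_content \<delta> (lattice_map \<nu> \<delta> a n ` K)"
        by (simp add: has_minkowski_content_def)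
    qed
  qed
  show ?thesis using avg nonlattice lattice by blast
qed

end
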